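(* Let $(X,X^*,R,R^\vee)$ be a root system such that $R$ spans $X^*$ and $-1_X\in W(R)$. Let $\bar c_R: X_{\mathrm{reg}}\times X^*_{\mathrm{reg}}\to\mathbb{Z}$ be the stable discrete series constants, and let $m_R: X_{\mathrm{reg}}\times X^*_{\mathrm{reg}}\to\mathbb{Z}$ be defined by $m_R(x,\lambda)=\psi_R(C_x,x,\lambda)$, where $C_x$ is the unique chamber in $X$ containing $x$. Then $\bar c_R=m_R$.
   Context: Root systems are reduced. $X$ is a finite-dimensional real vector space, $X^*$ its dual, $R\subset X^*$ a root system, $R^\vee\subset X$ its coroots, $W=W(R)$ the Weyl group. Chambers in $X$ are the (open) Weyl chambers. $X_{\mathrm{reg}}$ (resp. $X^*_{\mathrm{reg}}$) is the set of points lying on no root hyperplane in $X$ (resp. no coroot hyperplane in $X^*$), i.e. the union of the Weyl chambers. Definition of $\psi_R$. For a chamber $C$ in $X$, let $\alpha_1,\dots,\alpha_n$ be the simple roots relative to $C$ and $\omega_1,\dots,\omega_n\in X$ the dual basis. For $x=\sum a_i\omega_i\in X$ and $\lambda=\sum b_i\alpha_i\in X^*$ put $I=\{1,\dots,n\}$, $I_x=\{i: a_i\ge 0\}$, $I_\lambda=\{i: b_i\ge0\}$, and $\psi_C(x,\lambda)=(-1)^{|I_\lambda|}$ if $I_\lambda=I\setminus I_x$ and $\psi_C(x,\lambda)=0$ otherwise. For chambers $C_1,C_2$ let $\epsilon(C_1,C_2)=(-1)^{l(C_1,C_2)}$, where $l(C_1,C_2)$ is the number of root hyperplanes separating $C_1,C_2$.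 Then $\psi_R(C_0,x,\lambda)=\sum_C\epsilon(C_0,C)\psi_C(x,\lambda)$, the sum being over all chambers $C$ in $X$. The stable discrete series constants. These form the family of functions $\bar c_R: X_{\mathrm{reg}}\times X^*_{\mathrm{reg}}\to\mathbb{Z}$, one for each root system with $R$ spanning $X^*$ and $-1_X\in W(R)$, that occurs in the character formulas for stable discrete series characters of real reductive groups. It is known that they satisfy the following properties: (1) $\bar c_R(0,0)=1$ if $R$ is empty; (2) $\bar c_R(x,\lambda)$ depends only on the chamber of $X$ containing $x$ and the chamber of $X^*$ containing $\lambda$; (3) $\bar c_R(x,\lambda)=0$ unless $\lambda(x)\le0$; (4) if $x,x'$ lie in adjacent chambers of $X$ separated only by the root hyperplane $Y$, then $\bar c_R(x,\lambda)+\bar c_R(x',\lambda)=2\bar c_{R_Y}(y,\lambda_Y)$, where $R_Y\subset Y^*$ is the root system whose set of coroots is $R^\vee\cap Y$ (it again spans $Y^*$ and has $-1_Y\in W(R_Y)$), $\lambda_Y$ is the restriction of $\lambda$ to $Y$, and $y$ is the unique point of $Y$ on the segment joining $x$ and $x'$; (5) $\bar c_R(wx,w\lambda)=\bar c_R(x,\lambda)$ for $w\in W(R)$. It is also known that the family is characterized uniquely by (1), (3), (4); this may be taken as its definition. *)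

theory Defs
  imports
    "HOL-Analysis.Analysis"
    "HOL-Algebra.Bij"
    "HOL-Algebra.Generated_Groups"
begin

text \<open>
  The vector spaces are the linear subspaces \<open>X\<close> of an arbitrary Euclidean space \<open>'v\<close>. Only its
  linear structure and its topology are used, never its inner product. Subspaces rather than types
  are needed because the stable discrete series constants are characterized by passing from \<open>X\<close>
  to root hyperplanes \<open>Y\<close> of \<open>X\<close>.
  Linear functionals on \<open>X\<close> are functions in \<^term>\<open>extensional X\<close>, so that equality of functionals
  on \<open>X\<close> is equality of functions and \<^term>\<open>restrict l Y\<close> is the restriction of \<open>l\<close> to \<open>Y\<close>.
\<close>

definition dual_space :: "'v::euclidean_space set \<Rightarrow> ('v \<Rightarrow> real) set" where
  "dual_space X = {f \<in> extensional X.
     (\<forall>x\<in>X. \<forall>y\<in>X. f (x + y) = f x + f y) \<and> (\<forall>x\<in>X. \<forall>t. f (t *\<^sub>R x) = t * f x)}"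

definition dual_reflection ::
    "'v::euclidean_space set \<Rightarrow> ('v \<Rightarrow> real) \<Rightarrow> 'v \<Rightarrow> ('v \<Rightarrow> real) \<Rightarrow> ('v \<Rightarrow> real)" where
  "dual_reflection X \<alpha> v f = (\<lambda>x\<in>X. f x - f v * \<alpha> x)"

text \<open>Reduced (crystallographic) root systems in the dual of \<open>X\<close>; that \<open>R\<close> spans the dual is
  required separately.\<close>

definition root_system :: "'v::euclidean_space set \<Rightarrow> ('v \<Rightarrow> real) set \<Rightarrow> bool" where
  "root_system X R \<longleftrightarrow>
     subspace X \<and> finite R \<and> R \<subseteq> dual_space X \<and> (\<lambda>x\<in>X. 0) \<notin> R \<and>
     (\<forall>\<alpha>\<in>R. \<exists>v\<in>X. \<alpha> v = 2 \<and> dual_reflection X \<alpha> v ` R \<subseteq> R \<and> (\<forall>\<beta>\<in>R. \<beta> v \<in> \<int>)) \<and>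
     (\<forall>\<alpha>\<in>R. \<forall>t. (\<lambda>x\<in>X. t * \<alpha> x) \<in> R \<longrightarrow> t = 1 \<or> t = -1)"

definition spans_dual :: "'v::euclidean_space set \<Rightarrow> ('v \<Rightarrow> real) set \<Rightarrow> bool" where
  "spans_dual X R \<longleftrightarrow> (\<forall>f\<in>dual_space X. \<exists>a. \<forall>x\<in>X. f x = (\<Sum>\<alpha>\<in>R. a \<alpha> * \<alpha> x))"

text \<open>When \<open>R\<close> is finite and spans the dual, the reflection attached to a root, and hence the
  coroot, is unique.\<close>

definition coroot :: "'v::euclidean_space set \<Rightarrow> ('v \<Rightarrow> real) set \<Rightarrow> ('v \<Rightarrow> real) \<Rightarrow> 'v" where
  "coroot X R \<alpha> = (THE v. v \<in> X \<and> \<alpha> v = 2 \<and> dual_reflection X \<alpha> v ` R \<subseteq> R)"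

definition coroots :: "'v::euclidean_space set \<Rightarrow> ('v \<Rightarrow> real) set \<Rightarrow> 'v set" where
  "coroots X R = coroot X R ` R"

definition reflection ::
    "'v::euclidean_space set \<Rightarrow> ('v \<Rightarrow> real) set \<Rightarrow> ('v \<Rightarrow> real) \<Rightarrow> ('v \<Rightarrow> 'v)" where
  "reflection X R \<alpha> = (\<lambda>x\<in>X. x - \<alpha> x *\<^sub>R coroot X R \<alpha>)"

definition weyl_group :: "'v::euclidean_space set \<Rightarrow> ('v \<Rightarrow> real) set \<Rightarrow> ('v \<Rightarrow> 'v) set" where
  "weyl_group X R = generate (BijGroup X) (reflection X R ` R)"

definition root_hyperplane :: "'v::euclidean_space set \<Rightarrow> ('v \<Rightarrow> real) \<Rightarrow> 'v set" where
  "root_hyperplane X \<alpha> = {x \<in> X. \<alpha> x = 0}"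

definition regular :: "'v::euclidean_space set \<Rightarrow> ('v \<Rightarrow> real) set \<Rightarrow> 'v set" where
  "regular X R = X - (\<Union>\<alpha>\<in>R. root_hyperplane X \<alpha>)"

definition dual_regular ::
    "'v::euclidean_space set \<Rightarrow> ('v \<Rightarrow> real) set \<Rightarrow> ('v \<Rightarrow> real) set" where
  "dual_regular X R = {l \<in> dual_space X. \<forall>v\<in>coroots X R. l v \<noteq> 0}"

definition chambers :: "'v::euclidean_space set \<Rightarrow> ('v \<Rightarrow> real) set \<Rightarrow> 'v set set" where
  "chambers X R = components (regular X R)"

definition chamber_of :: "'v::euclidean_space set \<Rightarrow> ('v \<Rightarrow> real) set \<Rightarrow> 'v \<Rightarrow> 'v set" where
  "chamber_of X R x = (THE C. C \<in> chambers X R \<and> x \<in> C)"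

definition positive_roots ::
    "('v::euclidean_space \<Rightarrow> real) set \<Rightarrow> 'v set \<Rightarrow> ('v \<Rightarrow> real) set" where
  "positive_roots R C = {\<alpha> \<in> R. \<forall>x\<in>C. \<alpha> x > 0}"

definition simple_roots ::
    "'v::euclidean_space set \<Rightarrow> ('v \<Rightarrow> real) set \<Rightarrow> 'v set \<Rightarrow> ('v \<Rightarrow> real) set" where
  "simple_roots X R C = {\<alpha> \<in> positive_roots R C.
     \<not> (\<exists>\<beta>\<in>positive_roots R C. \<exists>\<gamma>\<in>positive_roots R C. \<alpha> = (\<lambda>x\<in>X. \<beta> x + \<gamma> x))}"

text \<open>The functional basis is indexed by itself: below, \<open>\<Delta>\<close> is the set of simple roots and
  \<^term>\<open>dual_basis X \<Delta> \<alpha>\<close> is the member of the dual basis corresponding to \<open>\<alpha>\<close>.\<close>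

definition dual_basis ::
    "'v::euclidean_space set \<Rightarrow> ('v \<Rightarrow> real) set \<Rightarrow> ('v \<Rightarrow> real) \<Rightarrow> 'v" where
  "dual_basis X \<Delta> \<alpha> = (THE w. w \<in> X \<and> (\<forall>\<beta>\<in>\<Delta>. \<beta> w = (if \<beta> = \<alpha> then 1 else 0)))"

definition primal_coords ::
    "'v::euclidean_space set \<Rightarrow> ('v \<Rightarrow> real) set \<Rightarrow> 'v \<Rightarrow> (('v \<Rightarrow> real) \<Rightarrow> real)" where
  "primal_coords X \<Delta> x =
     (THE a. a \<in> extensional \<Delta> \<and> x = (\<Sum>\<alpha>\<in>\<Delta>. a \<alpha> *\<^sub>R dual_basis X \<Delta> \<alpha>))"

definition dual_coords ::
    "'v::euclidean_space set \<Rightarrow> ('v \<Rightarrow> real) set \<Rightarrow> ('v \<Rightarrow> real) \<Rightarrow> (('v \<Rightarrow> real) \<Rightarrow> real)" where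
  "dual_coords X \<Delta> l =
     (THE b. b \<in> extensional \<Delta> \<and> l = (\<lambda>y\<in>X. \<Sum>\<alpha>\<in>\<Delta>. b \<alpha> * \<alpha> y))"

definition psi_chamber ::
    "'v::euclidean_space set \<Rightarrow> ('v \<Rightarrow> real) set \<Rightarrow> 'v set \<Rightarrow> 'v \<Rightarrow> ('v \<Rightarrow> real) \<Rightarrow> int" where
  "psi_chamber X R C x l =
     (let \<Delta> = simple_roots X R C;
          I\<^sub>x = {\<alpha> \<in> \<Delta>. primal_coords X \<Delta> x \<alpha> \<ge> 0};
          I\<^sub>l = {\<alpha> \<in> \<Delta>. dual_coords X \<Delta> l \<alpha> \<ge> 0}
      in if I\<^sub>l = \<Delta> - I\<^sub>x then (-1) ^ card I\<^sub>l else 0)"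

definition separating_hyperplanes ::
    "'v::euclidean_space set \<Rightarrow> ('v \<Rightarrow> real) set \<Rightarrow> 'v set \<Rightarrow> 'v set \<Rightarrow> 'v set set" where
  "separating_hyperplanes X R C D =
     {root_hyperplane X \<alpha> | \<alpha>. \<alpha> \<in> R \<and> (\<forall>x\<in>C. \<forall>y\<in>D. \<alpha> x * \<alpha> y < 0)}"

definition chamber_sign ::
    "'v::euclidean_space set \<Rightarrow> ('v \<Rightarrow> real) set \<Rightarrow> 'v set \<Rightarrow> 'v set \<Rightarrow> int" where
  "chamber_sign X R C D = (-1) ^ card (separating_hyperplanes X R C D)"

definition psi ::
    "'v::euclidean_space set \<Rightarrow> ('v \<Rightarrow> real) set \<Rightarrow> 'v set \<Rightarrow> 'v \<Rightarrow> ('v \<Rightarrow> real) \<Rightarrow> int" where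
  "psi X R C\<^sub>0 x l = (\<Sum>C\<in>chambers X R. chamber_sign X R C\<^sub>0 C * psi_chamber X R C x l)"

definition m_fun ::
    "'v::euclidean_space set \<Rightarrow> ('v \<Rightarrow> real) set \<Rightarrow> 'v \<Rightarrow> ('v \<Rightarrow> real) \<Rightarrow> int" where
  "m_fun X R x l = psi X R (chamber_of X R x) x l"

definition admissible :: "'v::euclidean_space set \<Rightarrow> ('v \<Rightarrow> real) set \<Rightarrow> bool" where
  "admissible X R \<longleftrightarrow>
     root_system X R \<and> spans_dual X R \<and> (\<lambda>x\<in>X. - x) \<in> weyl_group X R"

text \<open>The root system \<open>R\<^sub>Y\<close> in the dual of the root hyperplane \<open>Y\<close> whose set of coroots is
  \<open>R\<^sup>\<or> \<inter> Y\<close>. It exists and spans the dual of \<open>Y\<close> when \<^term>\<open>admissible X R\<close> holds, and a spanning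
  root system is determined by its coroots.\<close>

definition hyperplane_system ::
    "'v::euclidean_space set \<Rightarrow> ('v \<Rightarrow> real) set \<Rightarrow> 'v set \<Rightarrow> ('v \<Rightarrow> real) set" where
  "hyperplane_system X R Y =
     (THE S. root_system Y S \<and> spans_dual Y S \<and> coroots Y S = coroots X R \<inter> Y)"

text \<open>
  The stable discrete series constants, defined by the properties that characterize the family
  uniquely: normalization, vanishing and the recursion across a wall. The value \<open>c X R x l\<close> is
  meaningful only if \<^term>\<open>admissible X R\<close>, \<^term>\<open>x \<in> regular X R\<close> and \<^term>\<open>l \<in> dual_regular X R\<close>.
  The family ranges over all subspaces \<open>X\<close> of the ambient space \<open>'v\<close>; this suffices since the
  recursion only descends to subspaces of \<open>X\<close>.
\<close>

definition stable_discrete_series_constants ::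
    "('v::euclidean_space set \<Rightarrow> ('v \<Rightarrow> real) set \<Rightarrow> 'v \<Rightarrow> ('v \<Rightarrow> real) \<Rightarrow> int) \<Rightarrow> bool" where
  "stable_discrete_series_constants c \<longleftrightarrow>
     c {0} {} 0 (\<lambda>x\<in>{0}. 0) = 1 \<and>
     (\<forall>X R x l. admissible X R \<and> x \<in> regular X R \<and> l \<in> dual_regular X R \<and> \<not> l x \<le> 0
        \<longrightarrow> c X R x l = 0) \<and>
     (\<forall>X R x x' l Y y. admissible X R \<and> x \<in> regular X R \<and> x' \<in> regular X R \<and>
        l \<in> dual_regular X R \<and>
        separating_hyperplanes X R (chamber_of X R x) (chamber_of X R x') = {Y} \<and>
        y \<in> Y \<inter> closed_segment x x'
        \<longrightarrow> c X R x l + c X R x' l = 2 * c Y (hyperplane_system X R Y) y (restrict l Y))"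

end

theory Submission
  imports Defs
begin

text \<open>
  Both families of functions are compared through two properties. They vanish where \<open>l x > 0\<close>; and
  for \<open>x\<close>, \<open>x'\<close> on the two sides of a root hyperplane \<open>Y\<close>, the two values add up to twice the value of
  the root system of \<open>Y\<close> at the crossing point. For the stable constants these are, with the
  value in dimension zero, the defining properties. Once the function \<open>m\<close> is known to have them, induction on the dimension shows that the
  difference of the two families changes sign at every wall; it vanishes at a point with \<open>l x > 0\<close>, and
  every chamber can be reached from there (\<open>stable_constants_eq_m_fun\<close>).

  With \<open>a\<close> and \<open>b\<close> the coordinates of \<open>x\<close> and \<open>l\<close>, the function \<open>\<psi>\<close> of a chamber is the product over the
  simple roots of the numbers \<open>[b < 0] - [a < 0]\<close>. It depends only on the rays of the closed chamber,
  and it is written \<open>psi_rays\<close> below, for an arbitrary basis of rays. A nonzero product forces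
  \<open>a * b \<le> 0\<close> for each simple root, hence \<open>l x \<le> 0\<close>: this is the vanishing of \<open>m\<close>, term by term.

  For the wall crossing of \<open>m\<close>, let \<open>x\<close> move through \<open>Y\<close>. Only the chambers that have \<open>Y\<close> as a wall
  contribute to the jump, and each contributes, up to sign, \<open>psi_rays\<close> of its facet in \<open>Y\<close>, whatever the sign of
  \<open>b\<close> at the lost ray is. The outcome is a signed sum over the cones into which \<^emph>\<open>all\<close> root hyperplanes cut \<open>Y\<close>.
  It has to be compared with the sum over the chambers of the root system of \<open>Y\<close>, which are coarser.
  Two facts achieve this.

  \<^item> \<open>psi_rays\<close> behaves like a valuation: a linear relation between cones that holds for \<open>l = 0\<close>,
    where \<open>psi_rays\<close> is up to sign the indicator function of the negative of the open cone, holds for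
    every \<open>l\<close> (\<open>psi_rays_linear_relation\<close>). The proof is again a wall crossing argument by
    induction on the dimension.
  \<^item> The signs match (\<open>chamber_sign_restrict\<close>): the reflection in \<open>Y\<close> pairs off the hyperplanes that
    separate two chambers with facets in \<open>Y\<close>, except those orthogonal to \<open>Y\<close>, which are exactly the root
    hyperplanes of the root system of \<open>Y\<close>.

  For the induction the root system of \<open>Y\<close> must span and have \<open>-1\<close> in its Weyl group. The product of
  \<open>-1\<close> with the reflection in \<open>Y\<close> fixes the coroot of \<open>Y\<close>, so by the theorem that stabilizers in a Weyl
  group are generated by reflections it is a product of reflections in roots orthogonal to \<open>Y\<close>
  (\<open>orthogonal_word\<close>). The stabilizer theorem comes from the freeness of the action on chambers (\<open>word_free\<close>).
\<close>

section \<open>Functionals, generic points and galleries\<close>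

definition functional_on :: "'v::real_vector set \<Rightarrow> ('v \<Rightarrow> real) \<Rightarrow> bool" where
  "functional_on V f \<longleftrightarrow>
     (\<forall>x\<in>V. \<forall>y\<in>V. f (x + y) = f x + f y) \<and> (\<forall>x\<in>V. \<forall>t. f (t *\<^sub>R x) = t * f x)"

lemma functional_on_add: "functional_on V f \<Longrightarrow> x \<in> V \<Longrightarrow> y \<in> V \<Longrightarrow> f (x + y) = f x + f y"
  and functional_on_scale: "functional_on V f \<Longrightarrow> x \<in> V \<Longrightarrow> f (t *\<^sub>R x) = t * f x"
  by (auto simp: functional_on_def)

lemma functional_on_uminus: "functional_on V f \<Longrightarrow> x \<in> V \<Longrightarrow> f (- x) = - f x"
  using functional_on_scale[of V f x "-1"] by simp

lemma functional_on_diff: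
  "functional_on V f \<Longrightarrow> subspace V \<Longrightarrow> x \<in> V \<Longrightarrow> y \<in> V \<Longrightarrow> f (x - y) = f x - f y"
  using functional_on_add[of V f x "- y"] functional_on_uminus[of V f y]
  by (simp add: subspace_neg)

lemma functional_on_zero: "functional_on V f \<Longrightarrow> subspace V \<Longrightarrow> f 0 = 0"
  using functional_on_scale[of V f 0 0] subspace_0[of V] by simp

lemma functional_on_sum:
  assumes "functional_on V f" "subspace V" "\<And>i. i \<in> I \<Longrightarrow> g i \<in> V"
  shows "f (\<Sum>i\<in>I. g i) = (\<Sum>i\<in>I. f (g i))"
  using assms(3)
proof (induction I rule: infinite_finite_induct)
  case (insert i I)
  then have "(\<Sum>i\<in>I. g i) \<in> V" using assms(2) by (auto intro: subspace_sum)
  with insert show ?case using assms by (simp add: functional_on_add)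
qed (use assms in \<open>auto simp: functional_on_zero\<close>)

lemma functional_on_subset: "functional_on V f \<Longrightarrow> U \<subseteq> V \<Longrightarrow> functional_on U f"
  unfolding functional_on_def by blast

lemma functional_on_lincomb:
  "functional_on V f \<Longrightarrow> functional_on V g \<Longrightarrow> functional_on V (\<lambda>x. c * f x - d * g x)"
  by (auto simp: functional_on_def algebra_simps)

text \<open>
  A small step in direction \<open>u\<close> keeps the signs of the functionals that do not vanish at \<open>y\<close> and gives the
  others the sign that they have at \<open>u\<close>.
\<close>
lemma small_perturbation:
  assumes V: "subspace V" and A: "finite A" "\<And>a. a \<in> A \<Longrightarrow> functional_on V a"
    and yu: "y \<in> V" "u \<in> V" and u: "\<And>a. a \<in> A \<Longrightarrow> a y = 0 \<Longrightarrow> a u \<noteq> 0"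
  shows "\<forall>\<^sub>F t in at_right (0::real). \<forall>a\<in>A.
           sgn (a (y + t *\<^sub>R u)) = (if a y = 0 then sgn (a u) else sgn (a y))"
proof (rule eventually_ball_finite[OF A(1)], rule ballI)
  fix a assume a: "a \<in> A"
  have eq: "a (y + t *\<^sub>R u) = a y + t * a u" for t
    using A(2)[OF a] yu V by (simp add: functional_on_add functional_on_scale subspace_scale)
  have lim: "((\<lambda>t. a y + t * a u) \<longlongrightarrow> a y + 0 * a u) (at_right 0)"
    by (intro tendsto_intros)
  consider "a y = 0" | "a y > 0" | "a y < 0" by linarith
  then show "\<forall>\<^sub>F t in at_right 0. sgn (a (y + t *\<^sub>R u)) = (if a y = 0 then sgn (a u) else sgn (a y))"
  proof cases
    case 1
    have "\<forall>\<^sub>F t in at_right (0::real). t > 0" by (simp add: eventually_at_right_less)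
    then show ?thesis unfolding eq by eventually_elim (auto simp: 1 sgn_mult)
  next
    case 2
    then have "\<forall>\<^sub>F t in at_right 0. a y + t * a u > 0" using order_tendstoD(1)[OF lim, of 0] by simp
    then show ?thesis unfolding eq by eventually_elim (use 2 in auto)
  next
    case 3
    then have "\<forall>\<^sub>F t in at_right 0. a y + t * a u < 0" using order_tendstoD(2)[OF lim, of 0] by simp
    then show ?thesis unfolding eq by eventually_elim (use 3 in auto)
  qed
qed

lemma small_perturbation_ex:
  assumes V: "subspace V" and A: "finite A" "\<And>a. a \<in> A \<Longrightarrow> functional_on V a"
    and yu: "y \<in> V" "u \<in> V" and u: "\<And>a. a \<in> A \<Longrightarrow> a y = 0 \<Longrightarrow> a u \<noteq> 0"
  obtains t where "t > 0"
    "\<And>a. a \<in> A \<Longrightarrow> sgn (a (y + t *\<^sub>R u)) = (if a y = 0 then sgn (a u) else sgn (a y))"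
proof -
  have "\<forall>\<^sub>F t in at_right (0::real).
           \<forall>a\<in>A. sgn (a (y + t *\<^sub>R u)) = (if a y = 0 then sgn (a u) else sgn (a y))"
    by (rule small_perturbation) (use assms in auto)
  then have "\<forall>\<^sub>F t in at_right (0::real). t > 0 \<and>
      (\<forall>a\<in>A. sgn (a (y + t *\<^sub>R u)) = (if a y = 0 then sgn (a u) else sgn (a y)))"
    by (simp add: eventually_conj_iff eventually_at_right_less)
  then show thesis using that eventually_happens trivial_limit_at_right_real by blast
qed

lemma generic_point_exists:
  assumes V: "subspace V" and A: "finite A" "\<And>a. a \<in> A \<Longrightarrow> functional_on V a"
    and nz: "\<And>a. a \<in> A \<Longrightarrow> \<exists>x\<in>V. a x \<noteq> 0"
  shows "\<exists>y\<in>V. \<forall>a\<in>A. a y \<noteq> 0"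
  using A nz
proof (induction A rule: finite_induct)
  case empty
  then show ?case using subspace_0[OF V] by auto
next
  case (insert a A)
  then obtain y where y: "y \<in> V" "\<forall>b\<in>A. b y \<noteq> 0" by auto
  obtain u where u: "u \<in> V" "a u \<noteq> 0" using insert.prems by auto
  show ?case
  proof (cases "a y = 0")
    case True
    obtain t where "\<And>b. b \<in> insert a A \<Longrightarrow>
        sgn (b (y + t *\<^sub>R u)) = (if b y = 0 then sgn (b u) else sgn (b y))"
      using small_perturbation_ex[OF V, of "insert a A" y u] insert y u True
      by (metis finite.insertI insert_iff)
    then have "\<forall>b\<in>insert a A. b (y + t *\<^sub>R u) \<noteq> 0" using y u True
      by (metis insert_iff sgn_zero_iff)
    then show ?thesis using y u V by (meson subspace_add subspace_scale)
  qed (use y in auto)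
qed

lemma sgn_eq_imp_mult_pos: "sgn (a::real) = sgn b \<Longrightarrow> b \<noteq> 0 \<Longrightarrow> a * b > 0"
  by (metis mult_eq_0_iff not_square_less_zero sgn_mult sgn_greater sgn_less sgn_zero_iff linorder_cases)

text \<open>
  Any two generic points are joined by a gallery of generic points in which consecutive ones are separated by at
  most one hyperplane. The end point is first moved, inside its chamber, so that the segment from \<open>y\<close> never
  meets two hyperplanes at the same time; then the gallery follows that segment, and the number of
  functionals that separate from the end point drops at each crossing.
\<close>
lemma gallery_induct:
  assumes V: "subspace V" and A: "finite A" "\<And>a. a \<in> A \<Longrightarrow> functional_on V a"
    and y: "y \<in> V" "\<And>a. a \<in> A \<Longrightarrow> a y \<noteq> 0"
    and y': "y' \<in> V" "\<And>a. a \<in> A \<Longrightarrow> a y' \<noteq> 0"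
    and base: "P y"
    and step: "\<And>p q. p \<in> V \<Longrightarrow> q \<in> V \<Longrightarrow> (\<And>a. a \<in> A \<Longrightarrow> a p \<noteq> 0) \<Longrightarrow> (\<And>a. a \<in> A \<Longrightarrow> a q \<noteq> 0) \<Longrightarrow>
       (\<And>a b x. a \<in> A \<Longrightarrow> b \<in> A \<Longrightarrow> a p * a q < 0 \<Longrightarrow> b p * b q < 0 \<Longrightarrow> x \<in> V \<Longrightarrow>
           a p * b x = b p * a x) \<Longrightarrow> P p \<Longrightarrow> P q"
  shows "P y'"
  using y base
proof (induction "card {a \<in> A. a y * a y' < 0}" arbitrary: y rule: less_induct)
  case less
  note y = less.prems(1,2)
  define Sep where "Sep = {a \<in> A. a y * a y' < 0}"
  show ?case
  proof (cases "Sep = {}")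
    case True
    then show ?thesis using step[of y y'] y y' less.prems unfolding Sep_def by blast
  next
    case False
    \<comment> \<open>the functionals that a direction must avoid so that no two hyperplanes are met at the same time\<close>
    define G where "G = {(\<lambda>x. a y * b x - b y * a x) | a b. a \<in> A \<and> b \<in> A \<and> (\<exists>x\<in>V. a y * b x \<noteq> b y * a x)}"
    have "G \<subseteq> (\<lambda>(a,b) x. a y * b x - b y * a x) ` (A \<times> A)" by (auto simp: G_def)
    then have finG: "finite G" using A(1) finite_subset by blast
    have Gf: "functional_on V g" if "g \<in> G" for g
      using that A(2) by (auto simp: G_def intro!: functional_on_lincomb)
    have "\<exists>u\<in>V. \<forall>g\<in>G. g u \<noteq> 0"
      by (rule generic_point_exists[OF V finG Gf]) (auto simp: G_def)
    then obtain u where u: "u \<in> V" "\<forall>g\<in>G. g u \<noteq> 0" by blast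
    obtain t where t: "\<And>a. a \<in> A \<union> G \<Longrightarrow>
        sgn (a (y' + t *\<^sub>R u)) = (if a y' = 0 then sgn (a u) else sgn (a y'))"
      using small_perturbation_ex[OF V, of "A \<union> G" y' u] A finG Gf y' u
      by (metis Un_iff finite_Un)
    define e where "e = y' + t *\<^sub>R u"
    have e: "e \<in> V" using y' u V by (simp add: e_def subspace_add subspace_scale)
    have eA: "sgn (a e) = sgn (a y')" if "a \<in> A" for a using t[of a] that y' by (simp add: e_def)
    have eG: "g e \<noteq> 0" if "g \<in> G" for g
      using t[of g] that u by (metis UnCI e_def sgn_zero_iff)
    have prp: "a y * b x = b y * a x" if "a \<in> A" "b \<in> A" "a y * b e = b y * a e" "x \<in> V" for a b x
      using eG[of "\<lambda>x. a y * b x - b y * a x"] that by (auto simp: G_def)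
    have Sep_e: "a \<in> Sep \<longleftrightarrow> a \<in> A \<and> a y * a e < 0" for a
    proof -
      have "a \<in> A \<Longrightarrow> (a y * a e < 0) = (a y * a y' < 0)"
        using eA[of a] by (smt (verit) sgn_less sgn_greater mult_less_0_iff)
      then show ?thesis by (auto simp: Sep_def)
    qed
    \<comment> \<open>the parameter at which the segment from y to e meets the hyperplane of a\<close>
    define \<tau> where "\<tau> = (\<lambda>a::'a \<Rightarrow> real. a y / (a y - a e))"
    have finS: "finite Sep" using A by (simp add: Sep_def)
    then obtain a0 where a0: "a0 \<in> Sep" "\<And>a. a \<in> Sep \<Longrightarrow> \<tau> a0 \<le> \<tau> a"
      using False by (metis arg_min_if_finite(1) arg_min_least)
    define s where "s = \<tau> a0"
    define z where "z = y + s *\<^sub>R (e - y)"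
    have ey: "e - y \<in> V" using e y V by (simp add: subspace_diff)
    have z: "z \<in> V" using y ey V by (simp add: z_def subspace_add subspace_scale)
    have az: "a z = a y + s * (a e - a y)" if "a \<in> A" for a
      using A(2)[OF that] y e ey V
      by (simp add: z_def functional_on_add functional_on_scale functional_on_diff subspace_scale)
    have tau01: "0 < \<tau> a \<and> \<tau> a < 1" if "a \<in> Sep" for a
    proof -
      have "a y * a e < 0" using that Sep_e by auto
      then show ?thesis unfolding \<tau>_def by (auto simp: mult_less_0_iff divide_simps)
    qed
    have s01: "0 < s" "s < 1" using tau01[OF a0(1)] by (auto simp: s_def)
    have az': "a z = (1 - s) * a y + s * a e" if "a \<in> A" for a using az[OF that] by (simp add: algebra_simps)
    have sepz: "a z * a y > 0 \<or> (a z = 0 \<and> a \<in> Sep)" if a: "a \<in> A" for a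
    proof (cases "a \<in> Sep")
      case False
      have "a y * a e > 0" using False a Sep_e y eA[OF a] y'
        by (metis linorder_neqE_linordered_idom mult_eq_0_iff sgn_zero_iff)
      then have "(1 - s) * (a y * a y) + s * (a y * a e) > 0"
      proof (intro add_pos_pos)
        have "a y * a y > 0" using y(2)[OF a] by (simp flip: power2_eq_square)
        then show "(1 - s) * (a y * a y) > 0" using s01 by (intro mult_pos_pos[where a="1 - s"]) auto
        show "s * (a y * a e) > 0" using s01 \<open>a y * a e > 0\<close> by (intro mult_pos_pos[where a=s]) auto
      qed
      then show ?thesis unfolding az'[OF a] by (simp add: algebra_simps)
    next
      case True
      have neg: "a y * a e < 0" using True Sep_e by auto
      have "s \<le> \<tau> a" using a0 True by (simp add: s_def)
      have eq: "a z = (a y - a e) * (\<tau> a - s)"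
      proof -
        have "a y - a e \<noteq> 0" using neg by (auto simp: mult_less_0_iff)
        then have "(a y - a e) * \<tau> a = a y" by (simp add: \<tau>_def)
        then show ?thesis unfolding az[OF a] by (simp add: algebra_simps)
      qed
      have "(a y - a e) * a y > 0" using neg y(2)[OF a] by (simp add: algebra_simps)
         (smt (verit) mult_eq_0_iff not_square_less_zero)
      then have "s < \<tau> a \<Longrightarrow> a z * a y > 0" unfolding eq
        by (metis diff_gt_0_iff_gt mult.assoc mult.commute mult_pos_pos)
      then show ?thesis using \<open>s \<le> \<tau> a\<close> True eq by (cases "s = \<tau> a") auto
    qed
    have sep_dir: "a (e - y) * a y < 0" if "a \<in> Sep" for a
    proof -
      have "a (e - y) = a e - a y" using that A(2)[of a] Sep_e[of a] V e y functional_on_diff[of V a e y] by blast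
      moreover have "a y * a e < 0" "a y * a y > 0" using that Sep_e y
        by (auto simp: zero_less_mult_iff) (use less_linear in blast)
      moreover have "(a e - a y) * a y = a y * a e - a y * a y" by (simp add: algebra_simps)
      ultimately show ?thesis by simp
    qed
    obtain r where r: "r > 0" "\<And>a. a \<in> A \<Longrightarrow>
        sgn (a (z + r *\<^sub>R (e - y))) = (if a z = 0 then sgn (a (e - y)) else sgn (a z))"
    proof (rule small_perturbation_ex[OF V A z ey])
      show "a (e - y) \<noteq> 0" if "a \<in> A" "a z = 0" for a
        using sepz[OF that(1)] that sep_dir[of a] by auto
    qed auto
    define q where "q = z + r *\<^sub>R (e - y)"
    have q: "q \<in> V" using z ey V by (simp add: q_def subspace_add subspace_scale)
    have q_same: "a q * a y > 0" if "a \<in> A" "a z \<noteq> 0" for a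
    proof -
      have "sgn (a q) = sgn (a z)" using r(2)[OF that(1)] that by (simp add: q_def)
      then show ?thesis using sepz[OF that(1)] that(2)
        by (auto simp: zero_less_mult_iff sgn_1_pos sgn_1_neg)
    qed
    have q_opp: "a q * a y < 0 \<and> a \<in> Sep" if "a \<in> A" "a z = 0" for a
    proof -
      have S: "a \<in> Sep" using sepz[OF that(1)] that(2) by auto
      have "sgn (a q) = sgn (a (e - y))" using r(2)[OF that(1)] that by (simp add: q_def)
      then show ?thesis using sep_dir[OF S] S
        by (auto simp: mult_less_0_iff sgn_1_pos sgn_1_neg)
    qed
    have q_gen: "a q \<noteq> 0" if "a \<in> A" for a
      using q_same[OF that] q_opp[OF that] by (cases "a z = 0") auto
    have Pq: "P q"
    proof (rule step[where p = y and q = q])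
      show "y \<in> V" "q \<in> V" "P y" using y q less.prems by auto
      show "a y \<noteq> 0" "a q \<noteq> 0" if "a \<in> A" for a using y(2) q_gen that by auto
    next
      fix a b x assume H: "a \<in> A" "b \<in> A" "a y * a q < 0" "b y * b q < 0" "x \<in> V"
      have az0: "a z = 0" using q_same[of a] H by (smt (verit) mult.commute)
      have bz0: "b z = 0" using q_same[of b] H by (smt (verit) mult.commute)
      have "s * (a y * b e - b y * a e) = a y * b z - b y * a z"
        unfolding az'[OF H(1)] az'[OF H(2)] by (simp add: algebra_simps)
      then have "a y * b e = b y * a e" using az0 bz0 s01 by simp
      then show "a y * b x = b y * a x" using prp H by blast
    qed
    have "{a \<in> A. a q * a y' < 0} \<subset> Sep"
    proof
      show "{a \<in> A. a q * a y' < 0} \<subseteq> Sep"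
      proof safe
        fix a assume a: "a \<in> A" "a q * a y' < 0"
        show "a \<in> Sep"
        proof (cases "a z = 0")
          case False
          then have "a q * a y > 0" using q_same a by blast
          then show ?thesis using a by (auto simp: Sep_def zero_less_mult_iff mult_less_0_iff)
        qed (use q_opp a in blast)
      qed
      have a0A: "a0 \<in> A" using a0 by (simp add: Sep_def)
      have "(a0 y - a0 e) * \<tau> a0 = a0 y" using a0(1) Sep_e[of a0] by (auto simp: \<tau>_def mult_less_0_iff)
      then have "a0 z = 0" using az[OF a0A] by (simp add: s_def algebra_simps)
      then have "a0 q * a0 y < 0" using q_opp a0A by blast
      moreover have "a0 y * a0 y' < 0" using a0(1) by (simp add: Sep_def)
      ultimately have "\<not> a0 q * a0 y' < 0" by (auto simp: mult_less_0_iff)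
      then show "{a \<in> A. a q * a y' < 0} \<noteq> Sep" using a0(1) by blast
    qed
    then have "card {a \<in> A. a q * a y' < 0} < card {a \<in> A. a y * a y' < 0}"
      using finS psubset_card_mono unfolding Sep_def by blast
    then show ?thesis using less.hyps[of q] q q_gen Pq by blast
  qed
qed


section \<open>Cones given by their rays, and linear relations between them\<close>

text \<open>
  For the dual basis \<open>S\<close> of the simple roots of a chamber this is the function \<open>\<psi>\<close> of that chamber: the factor is
  \<open>1\<close> if only \<open>l\<close> is negative, \<open>-1\<close> if only the coordinate of \<open>y\<close> is negative, and \<open>0\<close> if
  the signs agree.
\<close>
definition psi_rays :: "'v::real_vector set \<Rightarrow> 'v \<Rightarrow> ('v \<Rightarrow> real) \<Rightarrow> int" where
  "psi_rays S y l = (\<Prod>s\<in>S. of_bool (l s < 0) - of_bool (representation S y s < 0))"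

lemma functional_on_representation:
  "independent S \<Longrightarrow> functional_on (span S) (\<lambda>x. representation S x s)"
  by (simp add: functional_on_def representation_add representation_scale)

text \<open>
  Since \<open>l y\<close> is the sum of the products of the coordinates of \<open>y\<close> with the values of \<open>l\<close> on the rays, one
  of these products is positive, and the corresponding factor vanishes.
\<close>
lemma psi_rays_eq_0:
  fixes S :: "'v::real_vector set"
  assumes S: "finite S" "independent S" and y: "y \<in> span S" and l: "functional_on (span S) l"
    and pos: "l y > 0"
  shows "psi_rays S y l = 0"
proof -
  have "y = (\<Sum>s\<in>S. representation S y s *\<^sub>R s)"
    using sum_representation_eq[of S y S] S y by simp
  then have "l y = l (\<Sum>s\<in>S. representation S y s *\<^sub>R s)" by simp
  also have "\<dots> = (\<Sum>s\<in>S. l (representation S y s *\<^sub>R s))"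
    by (rule functional_on_sum[OF l]) (auto simp: span_base span_scale)
  also have "\<dots> = (\<Sum>s\<in>S. representation S y s * l s)"
    by (rule sum.cong) (use l in \<open>auto simp: functional_on_scale span_base\<close>)
  finally have eq: "l y = (\<Sum>s\<in>S. representation S y s * l s)" .
  have "\<exists>s\<in>S. representation S y s * l s > 0"
  proof (rule ccontr)
    assume "\<not> ?thesis"
    then have "(\<Sum>s\<in>S. representation S y s * l s) \<le> 0" by (intro sum_nonpos) (simp add: not_less)
    then show False using pos eq by simp
  qed
  then obtain s where s: "s \<in> S" "representation S y s * l s > 0" by blast
  then have "of_bool (l s < 0) - of_bool (representation S y s < 0) = (0::int)"
    by (auto simp: zero_less_mult_iff)
  then show ?thesis unfolding psi_rays_def using s(1) S(1) by (intro prod_zero) blast+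
qed

lemma psi_rays_zero_functional:
  assumes "finite S"
  shows "psi_rays S y (\<lambda>_. 0) = (-1) ^ card S * of_bool (\<forall>s\<in>S. representation S y s < 0)"
proof (cases "\<forall>s\<in>S. representation S y s < 0")
  case False
  then show ?thesis using assms unfolding psi_rays_def by (auto intro!: prod_zero)
qed (simp add: psi_rays_def)

lemma psi_rays_cong:
  assumes "\<And>s. s \<in> S \<Longrightarrow> l s = l' s"
    and "\<And>s. s \<in> S \<Longrightarrow> representation S y s < 0 \<longleftrightarrow> representation S y' s < 0"
  shows "psi_rays S y l = psi_rays S y' l'"
  unfolding psi_rays_def using assms by (intro prod.cong) auto

lemma span_remove_ray:
  assumes S: "finite S" "independent S" "s \<in> S"
  shows "span (S - {s}) = {x \<in> span S. representation S x s = 0}"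
proof safe
  fix x assume x: "x \<in> span (S - {s})"
  show "x \<in> span S" using x span_mono[of "S - {s}" S] by blast
  have "representation S x = representation (S - {s}) x"
    by (rule representation_extend) (use S x in auto)
  then show "representation S x s = 0" using representation_ne_zero[of "S - {s}" x s] by auto
next
  fix x assume x: "x \<in> span S" "representation S x s = 0"
  have "x = (\<Sum>t\<in>S. representation S x t *\<^sub>R t)"
    using sum_representation_eq[of S x S] S x by simp
  also have "\<dots> = (\<Sum>t\<in>S - {s}. representation S x t *\<^sub>R t)"
    using S x by (simp add: sum.remove)
  also have "\<dots> \<in> span (S - {s})" by (intro span_sum span_scale span_base)
  finally show "x \<in> span (S - {s})" .
qed

text \<open>
  Crossing the facet opposite to \<open>s\<close> changes the factor of \<open>s\<close> by \<open>\<plusminus>1\<close> for either sign of \<open>l s\<close>, so the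
  jump is \<open>psi_rays\<close> of the facet and sees only the restriction of \<open>l\<close> to the hyperplane.
\<close>
lemma psi_rays_jump:
  assumes S: "finite S" "independent S" "s \<in> S" and z: "z \<in> span (S - {s})"
    and same: "\<And>t. t \<in> S - {s} \<Longrightarrow> representation S p t < 0 \<longleftrightarrow> representation S z t < 0"
              "\<And>t. t \<in> S - {s} \<Longrightarrow> representation S q t < 0 \<longleftrightarrow> representation S z t < 0"
    and opp: "representation S p s * representation S q s < 0"
  shows "psi_rays S p l - psi_rays S q l =
           (if representation S p s > 0 then 1 else - 1) * psi_rays (S - {s}) z l"
proof -
  have rep: "representation S z = representation (S - {s}) z"
    by (rule representation_extend) (use S z in auto)
  have "psi_rays S r l = (of_bool (l s < 0) - of_bool (representation S r s < 0)) * psi_rays (S - {s}) z l"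
    if "\<And>t. t \<in> S - {s} \<Longrightarrow> representation S r t < 0 \<longleftrightarrow> representation S z t < 0" for r
    unfolding psi_rays_def using S that rep by (simp add: prod.remove)
  from this[of p] this[of q] same opp show ?thesis
    by (auto simp: algebra_simps mult_less_0_iff)
qed

lemma functional_proportional:
  assumes V: "subspace V" and f: "functional_on V f" and g: "functional_on V g"
    and van: "\<And>x. x \<in> V \<Longrightarrow> g x = 0 \<Longrightarrow> f x = 0" and u: "u \<in> V" "g u \<noteq> 0" and x: "x \<in> V"
  shows "f x * g u = g x * f u"
proof -
  have m: "x - (g x / g u) *\<^sub>R u \<in> V" using V x u by (simp add: subspace_diff subspace_scale)
  have "g (x - (g x / g u) *\<^sub>R u) = 0"
    using V x u g by (simp add: functional_on_diff functional_on_scale subspace_scale)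
  then have "f (x - (g x / g u) *\<^sub>R u) = 0" using van m by blast
  then show ?thesis
    using V x u f by (simp add: functional_on_diff functional_on_scale subspace_scale field_simps)
qed

text \<open>
  The point \<open>p\<close> lies next to the point \<open>z\<close> of the hyperplane \<open>H\<close>: a coordinate of \<open>p\<close> has the sign that it has at
  \<open>z\<close>, unless it is a coordinate that vanishes on \<open>H\<close>.
\<close>
definition adjacent_along ::
    "'k set \<Rightarrow> ('k \<Rightarrow> 'v::real_vector set) \<Rightarrow> 'v set \<Rightarrow> 'v \<Rightarrow> 'v \<Rightarrow> bool" where
  "adjacent_along K S H z p \<longleftrightarrow> (\<forall>k\<in>K. \<forall>s\<in>S k.
     representation (S k) p s * representation (S k) z s > 0 \<or> (\<forall>x\<in>H. representation (S k) x s = 0))"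

text \<open>
  Summing the jumps. Each cone has at most one facet in \<open>H\<close>, since two coordinates of a basis are not proportional;
  \<open>K'\<close> collects the cones with a facet \<open>T k\<close> in \<open>H\<close>, and \<open>n'\<close> records on which side of \<open>H\<close> the cone lies.
  It is essential that \<open>K'\<close>, \<open>n'\<close> and \<open>T\<close> serve all points and all functionals \<open>l\<close> simultaneously, so that the case
  \<open>l = 0\<close> gives information about the same combination of facets.
\<close>
lemma wall_crossing_sum:
  fixes S :: "'k \<Rightarrow> 'v::euclidean_space set" and n :: "'k \<Rightarrow> int"
  assumes V: "subspace V" and K: "finite K"
    and S: "\<And>k. k \<in> K \<Longrightarrow> independent (S k)" "\<And>k. k \<in> K \<Longrightarrow> span (S k) = V"
    and g: "functional_on V g" and u: "u \<in> V" "g u \<noteq> 0"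
    and H: "H = {x \<in> V. g x = 0}"
  shows "\<exists>K' n' T. K' \<subseteq> K \<and>
    (\<forall>k\<in>K'. independent (T k) \<and> span (T k) = H \<and> T k \<subseteq> S k) \<and>
    (\<forall>p\<in>V. \<forall>q\<in>V. \<forall>z\<in>H. \<forall>l. g p > 0 \<longrightarrow> g q < 0 \<longrightarrow>
       adjacent_along K S H z p \<longrightarrow> adjacent_along K S H z q \<longrightarrow>
       (\<Sum>k\<in>K. n k * psi_rays (S k) p l) - (\<Sum>k\<in>K. n k * psi_rays (S k) q l) =
       (\<Sum>k\<in>K'. n' k * psi_rays (T k) z l))"
proof -
  define bad where "bad = (\<lambda>k s. s \<in> S k \<and> (\<forall>x\<in>H. representation (S k) x s = 0))"
  define K' where "K' = {k \<in> K. \<exists>s. bad k s}"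
  define w where "w = (\<lambda>k. SOME s. bad k s)"
  define T where "T = (\<lambda>k. S k - {w k})"
  define n' where "n' = (\<lambda>k. n k * (if representation (S k) u (w k) * g u > 0 then 1 else - 1))"
  have fin: "finite (S k)" if "k \<in> K" for k using S(1)[OF that] independent_imp_finite by blast
  have w: "bad k (w k)" if "k \<in> K'" for k
    using that unfolding K'_def w_def by (auto intro: someI)
  have fo: "functional_on V (\<lambda>x. representation (S k) x s)" if "k \<in> K" for k s
    using functional_on_representation[OF S(1)[OF that]] S(2)[OF that] by simp
  have pro: "representation (S k) x s * g u = g x * representation (S k) u s"
    if "k \<in> K" "bad k s" "x \<in> V" for k s x
    by (rule functional_proportional[where f = "\<lambda>x. representation (S k) x s" and V = V])
       (use that V g u fo[of k] in \<open>auto simp: bad_def H\<close>)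
  have SV: "s \<in> V" if "k \<in> K" "s \<in> S k" for k s using S(2)[OF that(1)] that span_base by blast
  have repS: "representation (S k) s t = (if t = s then 1 else 0)" if "k \<in> K" "s \<in> S k" for k s t
    using representation_basis[OF S(1)[OF that(1)] that(2)] by simp
  have nzu: "representation (S k) u s \<noteq> 0" if "k \<in> K" "bad k s" for k s
  proof -
    have sS: "s \<in> S k" using that(2) by (simp add: bad_def)
    show ?thesis using pro[OF that SV[OF that(1) sS]] u(2) repS[OF that(1) sS, of s] by auto
  qed
  have uniq: "s = t" if k: "k \<in> K" and b: "bad k s" "bad k t" for k s t
  proof (rule ccontr)
    have sS: "s \<in> S k" using b(1) by (simp add: bad_def)
    assume "s \<noteq> t"
    then have "representation (S k) s t = 0" using repS[OF k sS, of t] by simp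
    then have "g s = 0" using pro[OF k b(2) SV[OF k sS]] nzu[OF k b(2)] by simp
    then have "s \<in> H" using SV[OF k sS] by (simp add: H)
    then have "representation (S k) s s = 0" using b(1) by (simp add: bad_def)
    then show False using repS[OF k sS, of s] by simp
  qed
  have spanT: "span (T k) = H" if "k \<in> K'" for k
  proof -
    have k: "k \<in> K" and b: "bad k (w k)" using that w by (auto simp: K'_def)
    have "span (T k) = {x \<in> V. representation (S k) x (w k) = 0}"
      unfolding T_def using span_remove_ray[of "S k" "w k"] fin[OF k] S k b by (auto simp: bad_def)
    also have "\<dots> = H"
    proof -
      have "representation (S k) x (w k) = 0 \<longleftrightarrow> g x = 0" if "x \<in> V" for x
        using pro[OF k b that] nzu[OF k b] u(2) by (metis mult_eq_0_iff)
      then show ?thesis unfolding H by blast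
    qed
    finally show ?thesis .
  qed
  show ?thesis
  proof (intro exI[of _ K'] exI[of _ n'] exI[of _ T] conjI ballI allI impI)
    show "K' \<subseteq> K" by (auto simp: K'_def)
    show "independent (T k)" if "k \<in> K'" for k
      using that S(1) independent_mono[of "S k" "T k"] by (auto simp: T_def K'_def)
    show "T k \<subseteq> S k" if "k \<in> K'" for k by (auto simp: T_def)
    show "span (T k) = H" if "k \<in> K'" for k using spanT that .
    fix p q z l
    assume p: "p \<in> V" and q: "q \<in> V" and z: "z \<in> H" and gpq: "g p > 0" "g q < 0"
      and side: "adjacent_along K S H z p" "adjacent_along K S H z q"
    note p = p gpq(1) and q = q gpq(2)
    have side': "(representation (S k) p s < 0 \<longleftrightarrow> representation (S k) z s < 0) \<and>
                 (representation (S k) q s < 0 \<longleftrightarrow> representation (S k) z s < 0)"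
      if "k \<in> K" "s \<in> S k" "\<not> bad k s" for k s
      using side that by (force simp: bad_def zero_less_mult_iff adjacent_along_def)
    have each: "n k * psi_rays (S k) p l - n k * psi_rays (S k) q l =
        (if k \<in> K' then n' k * psi_rays (T k) z l else 0)" if k: "k \<in> K" for k
    proof (cases "k \<in> K'")
      case False
      then have "psi_rays (S k) p l = psi_rays (S k) q l"
        using side'[OF k] k by (intro psi_rays_cong) (auto simp: K'_def)
      then show ?thesis using False by simp
    next
      case True
      have b: "bad k (w k)" using w True .
      have pp: "representation (S k) p (w k) * g u = g p * representation (S k) u (w k)"
        and qq: "representation (S k) q (w k) * g u = g q * representation (S k) u (w k)"
        using pro[OF k b] p q by auto
      have sp: "representation (S k) p (w k) > 0 \<longleftrightarrow> representation (S k) u (w k) * g u > 0"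
      proof -
        have "representation (S k) p (w k) * (g u)\<^sup>2 = g p * (representation (S k) u (w k) * g u)"
          using pp by (simp add: power2_eq_square algebra_simps)
        moreover have "(g u)\<^sup>2 > 0" using u(2) by simp
        ultimately show ?thesis using p(2) by (metis zero_less_mult_iff not_less_iff_gr_or_eq)
      qed
      have op: "representation (S k) p (w k) * representation (S k) q (w k) < 0"
      proof -
        have "(representation (S k) p (w k) * representation (S k) q (w k)) * (g u)\<^sup>2
              = (g p * g q) * (representation (S k) u (w k))\<^sup>2"
          using arg_cong2[OF pp qq, of "(*)"] by (simp add: power2_eq_square algebra_simps)
        also have "\<dots> < 0" using p q nzu[OF k b] by (simp add: mult_less_0_iff)
        finally show ?thesis using u(2) by (simp add: mult_less_0_iff)
      qed
      have "psi_rays (S k) p l - psi_rays (S k) q l =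
           (if representation (S k) p (w k) > 0 then 1 else - 1) * psi_rays (S k - {w k}) z l"
      proof (rule psi_rays_jump[OF fin[OF k] S(1)[OF k] _ _ _ _ op])
        show "w k \<in> S k" using b by (simp add: bad_def)
        show "z \<in> span (S k - {w k})" using spanT[OF True] z by (simp add: T_def)
        fix t assume t: "t \<in> S k - {w k}"
        then have "\<not> bad k t" using uniq[OF k b, of t] by auto
        then show "representation (S k) p t < 0 \<longleftrightarrow> representation (S k) z t < 0"
          "representation (S k) q t < 0 \<longleftrightarrow> representation (S k) z t < 0"
          using side'[OF k, of t] t by auto
      qed
      then show ?thesis using True sp by (simp add: n'_def T_def flip: right_diff_distrib)
    qed
    have "(\<Sum>k\<in>K. n k * psi_rays (S k) p l) - (\<Sum>k\<in>K. n k * psi_rays (S k) q l) =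
        (\<Sum>k\<in>K. if k \<in> K' then n' k * psi_rays (T k) z l else 0)"
      using each by (simp flip: sum_subtractf)
    also have "\<dots> = (\<Sum>k\<in>K'. n' k * psi_rays (T k) z l)"
      using K by (intro sum.mono_neutral_cong_right) (auto simp: K'_def)
    finally show "(\<Sum>k\<in>K. n k * psi_rays (S k) p l) - (\<Sum>k\<in>K. n k * psi_rays (S k) q l) =
       (\<Sum>k\<in>K'. n' k * psi_rays (T k) z l)" .
  qed
qed

text \<open>
  Linear relations between cones pass from \<open>l = 0\<close> to every \<open>l\<close>. The sum is zero at a generic point where
  \<open>l\<close> is positive, because there each term is zero. It does not change along a gallery: its jump at a wall is a
  combination of facets, which satisfies the hypothesis in the wall, because the jump of the zero
  function is zero, and hence vanishes by induction on the dimension. The hypothesis is only required off a finite set of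
  hyperplanes, since the points of a wall at which it is verified must be generic as well.
\<close>
theorem psi_rays_linear_relation:
  fixes S :: "'k \<Rightarrow> 'v::euclidean_space set" and n :: "'k \<Rightarrow> int"
  assumes "subspace V" and "finite K"
    and "\<And>k. k \<in> K \<Longrightarrow> independent (S k)" "\<And>k. k \<in> K \<Longrightarrow> span (S k) = V"
    and "finite A" "\<And>a. a \<in> A \<Longrightarrow> functional_on V a"
    and "\<And>y. y \<in> V \<Longrightarrow> (\<And>a. a \<in> A \<Longrightarrow> a y \<noteq> 0) \<Longrightarrow> (\<Sum>k\<in>K. n k * psi_rays (S k) y (\<lambda>_. 0)) = 0"
    and "functional_on V l" and "y \<in> V" and "\<And>a. a \<in> A \<Longrightarrow> a y \<noteq> 0"
    and "\<And>k s. k \<in> K \<Longrightarrow> s \<in> S k \<Longrightarrow> representation (S k) y s \<noteq> 0"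
  shows "(\<Sum>k\<in>K. n k * psi_rays (S k) y l) = 0"
  using assms
proof (induction "dim V" arbitrary: V K n S A y rule: less_induct)
  case less
  note V = less.prems(1) and K = less.prems(2) and S = less.prems(3,4) and A = less.prems(5,6)
    and zero = less.prems(7) and l = less.prems(8) and y = less.prems(9-11)
  have SV: "s \<in> V" if "k \<in> K" "s \<in> S k" for k s using S(2)[OF that(1)] that span_base by blast
  have fin: "finite (S k)" if "k \<in> K" for k using S(1)[OF that] independent_imp_finite by blast
  have fo: "functional_on V (\<lambda>x. representation (S k) x s)" if "k \<in> K" for k s
    using functional_on_representation[OF S(1)[OF that]] S(2)[OF that] by simp
  show ?case
  proof (cases "\<forall>x\<in>V. l x = 0")
    case True
    have "(\<Sum>k\<in>K. n k * psi_rays (S k) y l) = (\<Sum>k\<in>K. n k * psi_rays (S k) y (\<lambda>_. 0))"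
    proof (rule sum.cong[OF refl])
      fix k assume k: "k \<in> K"
      have "psi_rays (S k) y l = psi_rays (S k) y (\<lambda>_. 0)"
        by (rule psi_rays_cong) (use True SV[OF k] in auto)
      then show "n k * psi_rays (S k) y l = n k * psi_rays (S k) y (\<lambda>_. 0)" by simp
    qed
    then show ?thesis using zero y by auto
  next
    case False
    define A' where "A' = A \<union> (\<Union>k\<in>K. (\<lambda>s x. representation (S k) x s) ` S k)"
    have A': "finite A'" "\<And>a. a \<in> A' \<Longrightarrow> functional_on V a"
      using A K fin fo by (auto simp: A'_def)
    have A'_rep: "(\<lambda>x. representation (S k) x s) \<in> A'" if "k \<in> K" "s \<in> S k" for k s
      using that by (auto simp: A'_def)
    have yA': "a y \<noteq> 0" if "a \<in> A'" for a using that y by (auto simp: A'_def)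
    have "\<exists>y1\<in>V. \<forall>a\<in>insert l A'. a y1 \<noteq> 0"
      using A' l y(1) yA' False by (intro generic_point_exists[OF V]) auto
    then obtain y0 where y0: "y0 \<in> V" "\<And>a. a \<in> insert l A' \<Longrightarrow> a y0 \<noteq> 0" by blast
    \<comment> \<open>a generic point where l is positive, and the whole sum therefore vanishes\<close>
    define y1 where "y1 = (if l y0 > 0 then y0 else - y0)"
    have y1: "y1 \<in> V" using y0 V by (simp add: y1_def subspace_neg)
    have y1A: "a y1 \<noteq> 0" if "a \<in> A'" for a
      using y0(2)[of a] functional_on_uminus[OF A'(2)[OF that] y0(1)] that by (auto simp: y1_def)
    have ly1: "l y1 > 0"
      using y0(2)[of l] functional_on_uminus[OF l y0(1)] by (auto simp: y1_def)
    define D where "D = (\<lambda>p. \<Sum>k\<in>K. n k * psi_rays (S k) p l)"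
    have "D y1 = 0" unfolding D_def
    proof (rule sum.neutral, rule ballI)
      fix k assume k: "k \<in> K"
      have "psi_rays (S k) y1 l = 0"
        by (rule psi_rays_eq_0[OF fin[OF k] S(1)[OF k]]) (use S(2)[OF k] y1 l ly1 in auto)
      then show "n k * psi_rays (S k) y1 l = 0" by simp
    qed
    have "D y = 0"
    proof (rule gallery_induct[where P = "\<lambda>p. D p = 0" and V = V and A = A' and y = y1 and y' = y])
      show "subspace V" "finite A'" "y1 \<in> V" "y \<in> V" "D y1 = 0" using V A' y1 y \<open>D y1 = 0\<close> by auto
      show "functional_on V a" "a y1 \<noteq> 0" "a y \<noteq> 0" if "a \<in> A'" for a
        using A'(2) y1A yA' that by auto
    next
      fix p q
      assume p: "p \<in> V" "\<And>a. a \<in> A' \<Longrightarrow> a p \<noteq> 0" and q: "q \<in> V" "\<And>a. a \<in> A' \<Longrightarrow> a q \<noteq> 0"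
        and sep: "\<And>a b x. a \<in> A' \<Longrightarrow> b \<in> A' \<Longrightarrow> a p * a q < 0 \<Longrightarrow> b p * b q < 0 \<Longrightarrow> x \<in> V \<Longrightarrow>
           a p * b x = b p * a x"
        and D0: "D p = 0"
      have "D p = D q"
      proof (cases "\<exists>g\<in>A'. g p * g q < 0")
        case False
        show ?thesis unfolding D_def
        proof (rule sum.cong[OF refl])
          fix k assume k: "k \<in> K"
          have "psi_rays (S k) p l = psi_rays (S k) q l"
          proof (rule psi_rays_cong)
            fix s assume "s \<in> S k"
            note m = A'_rep[OF k this]
            have "\<not> representation (S k) p s * representation (S k) q s < 0" using False m by force
            moreover have "representation (S k) p s \<noteq> 0" using p(2)[OF m] by simp
            moreover have "representation (S k) q s \<noteq> 0" using q(2)[OF m] by simp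
            ultimately show "(representation (S k) p s < 0) = (representation (S k) q s < 0)"
              by (auto simp: mult_less_0_iff)
          qed simp
          then show "n k * psi_rays (S k) p l = n k * psi_rays (S k) q l" by simp
        qed
      next
        case True
        then obtain g where g: "g \<in> A'" "g p * g q < 0" by blast
        note gf = A'(2)[OF g(1)]
        define H where "H = {x \<in> V. g x = 0}"
        have gp: "g p \<noteq> 0" using p g by blast
        have H: "subspace H" unfolding H_def subspace_def
          using V gf by (auto simp: functional_on_add functional_on_scale functional_on_zero
              subspace_0 subspace_add subspace_scale)
        have "H \<subset> V" using p(1) gp by (auto simp: H_def)
        then have dimH: "dim H < dim V"
          using V H by (intro dim_psubset) (simp add: span_eq_iff[THEN iffD2])
        obtain K' n' T where K': "K' \<subseteq> K"
          and T: "\<forall>k\<in>K'. independent (T k) \<and> span (T k) = H \<and> T k \<subseteq> S k"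
          and cross: "\<forall>p\<in>V. \<forall>q\<in>V. \<forall>z\<in>H. \<forall>l. g p > 0 \<longrightarrow> g q < 0 \<longrightarrow>
            adjacent_along K S H z p \<longrightarrow> adjacent_along K S H z q \<longrightarrow>
            (\<Sum>k\<in>K. n k * psi_rays (S k) p l) - (\<Sum>k\<in>K. n k * psi_rays (S k) q l) =
            (\<Sum>k\<in>K'. n' k * psi_rays (T k) z l)"
          using wall_crossing_sum[where n = n and S = S, OF V K S gf p(1) gp H_def] by blast
        obtain p' q' where pq: "p' \<in> V" "q' \<in> V" "g p' > 0" "g q' < 0"
          "p' = p \<and> q' = q \<or> p' = q \<and> q' = p"
          using g(2) p q by (auto simp: mult_less_0_iff)
        \<comment> \<open>a positive multiple of the point where the segment from p' to q' meets H\<close>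
        define z where "z = g p' *\<^sub>R q' - g q' *\<^sub>R p'"
        have z: "z \<in> H" using pq V gf
          by (simp add: z_def H_def functional_on_diff functional_on_scale subspace_diff subspace_scale)
        have az: "a z = (- g q') * a p' + g p' * a q'" if "a \<in> A'" for a
          using A'(2)[OF that] pq(1,2) V
          by (simp add: z_def functional_on_diff functional_on_scale subspace_scale)
        have off: "a p' * a z > 0 \<and> a q' * a z > 0" if a: "a \<in> A'" and nv: "\<exists>x\<in>H. a x \<noteq> 0" for a
        proof -
          have "\<not> a p * a q < 0"
          proof
            assume "a p * a q < 0"
            then have *: "g p * a x = a p * g x" if "x \<in> V" for x using sep g a that by blast
            obtain x where "x \<in> V" "g x = 0" "a x \<noteq> 0" using nv by (auto simp: H_def)
            then show False using *[of x] gp by simp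
          qed
          then have same: "a p' * a q' > 0" using p(2)[OF a] q(2)[OF a] pq(5)
            by (auto simp: mult_less_0_iff zero_less_mult_iff)
          have sq: "a p' * a p' > 0" "a q' * a q' > 0" using same by (auto simp: zero_less_mult_iff)
          have pp: "x * y + v * w > 0" if "x > 0" "y > 0" "v > 0" "w > 0" for x y v w :: real
            using that by (simp add: add_pos_pos)
          have "a p' * a z = (- g q') * (a p' * a p') + g p' * (a p' * a q')"
            "a q' * a z = (- g q') * (a p' * a q') + g p' * (a q' * a q')"
            unfolding az[OF a] by (simp_all add: algebra_simps)
          moreover have "(- g q') * (a p' * a p') + g p' * (a p' * a q') > 0"
            "(- g q') * (a p' * a q') + g p' * (a q' * a q') > 0"
            by (rule pp; use same sq pq in simp)+
          ultimately show ?thesis by simp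
        qed
        define AH where "AH = {a \<in> A'. \<exists>x\<in>H. a x \<noteq> 0}"
        have HV: "H \<subseteq> V" by (auto simp: H_def)
        have "(\<Sum>k\<in>K'. n' k * psi_rays (T k) z l) = 0"
        proof (rule less.hyps[OF dimH H finite_subset[OF K' K], where A = AH])
          show "independent (T k)" "span (T k) = H" if "k \<in> K'" for k using T that by auto
          show "finite AH" using A' by (simp add: AH_def)
          show "functional_on H a" if "a \<in> AH" for a
            using that A'(2) functional_on_subset[OF _ HV] by (auto simp: AH_def)
          show "functional_on H l" using l functional_on_subset[OF _ HV] by blast
          show "z \<in> H" by (rule z)
          show "a z \<noteq> 0" if "a \<in> AH" for a using off[of a] that by (auto simp: AH_def)
          show "representation (T k) z s \<noteq> 0" if k: "k \<in> K'" and s: "s \<in> T k" for k s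
          proof -
            have kK: "k \<in> K" and sS: "s \<in> S k" using k s K' T by blast+
            have sH: "s \<in> H" using T k s span_base by blast
            have "representation (S k) s s \<noteq> 0" using representation_basis[OF S(1)[OF kK] sS] by simp
            then have "representation (S k) z s \<noteq> 0"
              using off[OF A'_rep[OF kK sS]] sH by force
            moreover have "representation (S k) z = representation (T k) z"
              by (rule representation_extend[OF S(1)[OF kK]]) (use T k z in auto)
            ultimately show ?thesis by simp
          qed
          fix w assume w: "w \<in> H" and wA: "\<And>a. a \<in> AH \<Longrightarrow> a w \<noteq> 0"
          have wV: "w \<in> V" using w HV by blast
          have move: "\<exists>w'\<in>V. sgn (g w') = sgn (g v) \<and> (\<forall>a\<in>A'. a w' \<noteq> 0 \<and> (a w \<noteq> 0 \<longrightarrow> a w' * a w > 0))"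
            if v: "v \<in> V" "\<And>a. a \<in> A' \<Longrightarrow> a v \<noteq> 0" for v
          proof -
            obtain t where t: "t > 0" "\<And>a. a \<in> A' \<Longrightarrow>
                sgn (a (w + t *\<^sub>R v)) = (if a w = 0 then sgn (a v) else sgn (a w))"
              using small_perturbation_ex[OF V A' wV v(1)] v(2) by metis
            show ?thesis
            proof (intro bexI conjI ballI impI)
              show "w + t *\<^sub>R v \<in> V" using wV v V by (simp add: subspace_add subspace_scale)
              show "sgn (g (w + t *\<^sub>R v)) = sgn (g v)" using t(2)[OF g(1)] w by (simp add: H_def)
              fix a assume a: "a \<in> A'"
              show "a (w + t *\<^sub>R v) \<noteq> 0" using t(2)[OF a] v(2)[OF a] by (metis sgn_zero_iff)
              show "a (w + t *\<^sub>R v) * a w > 0" if "a w \<noteq> 0" 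
                using t(2)[OF a] that by (intro sgn_eq_imp_mult_pos) auto
            qed
          qed
          have p'A: "a p' \<noteq> 0" and q'A: "a q' \<noteq> 0" if "a \<in> A'" for a
            using p(2)[OF that] q(2)[OF that] pq(5) by auto
          obtain w1 where w1: "w1 \<in> V" "sgn (g w1) = sgn (g p')"
            "\<And>a. a \<in> A' \<Longrightarrow> a w1 \<noteq> 0" "\<And>a. a \<in> A' \<Longrightarrow> a w \<noteq> 0 \<Longrightarrow> a w1 * a w > 0"
            using move[of p'] pq(1) p'A by blast
          obtain w2 where w2: "w2 \<in> V" "sgn (g w2) = sgn (g q')"
            "\<And>a. a \<in> A' \<Longrightarrow> a w2 \<noteq> 0" "\<And>a. a \<in> A' \<Longrightarrow> a w \<noteq> 0 \<Longrightarrow> a w2 * a w > 0"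
            using move[of q'] pq(2) q'A by blast
          have "(\<Sum>k\<in>K. n k * psi_rays (S k) w1 (\<lambda>_. 0)) - (\<Sum>k\<in>K. n k * psi_rays (S k) w2 (\<lambda>_. 0)) =
              (\<Sum>k\<in>K'. n' k * psi_rays (T k) w (\<lambda>_. 0))"
          proof (rule cross[rule_format, OF w1(1) w2(1) w])
            show "g w1 > 0" using w1(2) pq(3) by (metis sgn_greater)
            show "g w2 < 0" using w2(2) pq(4) by (metis sgn_less)
            have nz: "representation (S k) w s \<noteq> 0"
              if ks: "k \<in> K" "s \<in> S k" and nv: "\<exists>x\<in>H. representation (S k) x s \<noteq> 0" for k s
              using wA[of "\<lambda>x. representation (S k) x s"] A'_rep[OF ks] nv by (simp add: AH_def)
            show "adjacent_along K S H w w1" "adjacent_along K S H w w2" unfolding adjacent_along_def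
              using w1(4)[OF A'_rep] w2(4)[OF A'_rep] nz by blast+
          qed
          moreover have "(\<Sum>k\<in>K. n k * psi_rays (S k) w1 (\<lambda>_. 0)) = 0"
            using zero[OF w1(1)] w1(3) by (auto simp: A'_def)
          moreover have "(\<Sum>k\<in>K. n k * psi_rays (S k) w2 (\<lambda>_. 0)) = 0"
            using zero[OF w2(1)] w2(3) by (auto simp: A'_def)
          ultimately show "(\<Sum>k\<in>K'. n' k * psi_rays (T k) w (\<lambda>_. 0)) = 0" by simp
        qed
        moreover have "D p' - D q' = (\<Sum>k\<in>K'. n' k * psi_rays (T k) z l)" unfolding D_def
        proof (rule cross[rule_format, OF pq(1,2) z pq(3,4)])
          show "adjacent_along K S H z p'" "adjacent_along K S H z q'" unfolding adjacent_along_def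
            using off[OF A'_rep] by blast+
        qed
        ultimately show ?thesis using pq(5) by auto
      qed
      then show "D q = 0" using D0 by simp
    qed
    then show ?thesis by (simp add: D_def)
  qed
qed


section \<open>Chambers as classes of sign vectors\<close>

lemma dual_space_iff: "f \<in> dual_space X \<longleftrightarrow> f \<in> extensional X \<and> functional_on X f"
  by (auto simp: dual_space_def functional_on_def)

lemma functional_on_restrict:
  "subspace X \<Longrightarrow> functional_on X (restrict f X) \<longleftrightarrow> functional_on X f"
  by (simp add: functional_on_def subspace_add subspace_scale)

lemma functional_on_inner:
  fixes V :: "'v::euclidean_space set"
  assumes V: "subspace V" and f: "functional_on V f"
  obtains a where "a \<in> V" "\<And>x. x \<in> V \<Longrightarrow> f x = a \<bullet> x"
proof -
  obtain B where B: "B \<subseteq> V" "pairwise orthogonal B" "\<And>x. x \<in> B \<Longrightarrow> norm x = 1"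
      "independent B" "card B = dim V" "span B = V"
    using orthonormal_basis_subspace[OF V] by metis
  have fin: "finite B" using B(4) independent_imp_finite by blast
  define a where "a = (\<Sum>b\<in>B. f b *\<^sub>R b)"
  have "f x = a \<bullet> x" if x: "x \<in> V" for x
  proof -
    have "f x = f (\<Sum>b\<in>B. (x \<bullet> b) *\<^sub>R b)"
      using orthonormal_basis_expand[OF B(2,3) _ fin, of x] x B(6) by simp
    also have "\<dots> = (\<Sum>b\<in>B. f ((x \<bullet> b) *\<^sub>R b))"
      by (rule functional_on_sum[OF f V]) (use B(1) V in \<open>auto intro: subspace_scale\<close>)
    also have "\<dots> = (\<Sum>b\<in>B. (x \<bullet> b) * f b)"
      by (rule sum.cong) (use B(1) f in \<open>auto simp: functional_on_scale\<close>)
    also have "\<dots> = a \<bullet> x"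
      unfolding a_def inner_sum_left by (intro sum.cong) (auto simp: inner_commute)
    finally show ?thesis .
  qed
  moreover have "a \<in> V" unfolding a_def
    by (intro subspace_sum[OF V] subspace_scale[OF V]) (use B(1) in auto)
  ultimately show thesis using that by blast
qed

lemma functional_on_continuous:
  fixes V :: "'v::euclidean_space set"
  assumes "subspace V" and "functional_on V f" shows "continuous_on V f"
proof -
  obtain a where "\<And>x. x \<in> V \<Longrightarrow> f x = a \<bullet> x" using functional_on_inner[OF assms] by metis
  then show ?thesis by (simp add: continuous_on_inner cong: continuous_on_cong)
qed

lemma in_span_image:
  fixes f :: "'i \<Rightarrow> 'v::real_vector"
  assumes "finite I" "y \<in> span (f ` I)"
  shows "\<exists>c. y = (\<Sum>i\<in>I. c i *\<^sub>R f i)"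
  using assms(2)
proof (induction rule: span_induct_alt)
  case base
  show ?case by (rule exI[of _ "\<lambda>_. 0"]) simp
next
  case (step c x y)
  then obtain d i where d: "y = (\<Sum>i\<in>I. d i *\<^sub>R f i)" "i \<in> I" "x = f i" by blast
  have "c *\<^sub>R x + y = (\<Sum>j\<in>I. (d j + (if j = i then c else 0)) *\<^sub>R f j)"
    using assms(1) d by (simp add: scaleR_left_distrib sum.distrib if_distrib[of "\<lambda>c. c *\<^sub>R _"] sum.delta cong: if_cong)
  then show ?case by (rule exI[where x = "\<lambda>j. d j + (if j = i then c else 0)"])
qed

definition chamber_at :: "'v set \<Rightarrow> ('v \<Rightarrow> real) set \<Rightarrow> 'v \<Rightarrow> 'v set" where
  "chamber_at X R x = {y \<in> X. \<forall>\<alpha>\<in>R. \<alpha> x * \<alpha> y > 0}"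

lemma regular_iff: "x \<in> regular X R \<longleftrightarrow> x \<in> X \<and> (\<forall>\<alpha>\<in>R. \<alpha> x \<noteq> 0)"
  by (auto simp: regular_def root_hyperplane_def)

lemma chamber_at_refl: "x \<in> regular X R \<Longrightarrow> x \<in> chamber_at X R x"
  by (auto simp: regular_iff chamber_at_def zero_less_mult_iff)

lemma chamber_at_regular: "y \<in> chamber_at X R x \<Longrightarrow> y \<in> regular X R"
  by (force simp: chamber_at_def regular_iff)

lemma chamber_at_eq_iff:
  assumes "x \<in> regular X R" "y \<in> regular X R"
  shows "chamber_at X R x = chamber_at X R y \<longleftrightarrow> y \<in> chamber_at X R x"
proof
  assume "chamber_at X R x = chamber_at X R y"
  then show "y \<in> chamber_at X R x" using chamber_at_refl[OF assms(2)] by simp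
next
  assume "y \<in> chamber_at X R x"
  then have "\<And>\<alpha>. \<alpha> \<in> R \<Longrightarrow> \<alpha> x > 0 \<longleftrightarrow> \<alpha> y > 0" "\<And>\<alpha>. \<alpha> \<in> R \<Longrightarrow> \<alpha> x < 0 \<longleftrightarrow> \<alpha> y < 0"
    by (auto simp: chamber_at_def zero_less_mult_iff)
  then show "chamber_at X R x = chamber_at X R y"
    by (auto simp: chamber_at_def zero_less_mult_iff)
qed

text \<open>
  Sign classes are convex, hence connected; conversely a functional without zeros on a connected set has constant
  sign there.
\<close>
lemma component_eq_chamber_at:
  fixes X :: "'v::euclidean_space set"
  assumes X: "subspace X" and R: "R \<subseteq> dual_space X" and x: "x \<in> regular X R"
  shows "connected_component_set (regular X R) x = chamber_at X R x"
proof
  have f: "functional_on X \<alpha>" if "\<alpha> \<in> R" for \<alpha> using R that by (auto simp: dual_space_iff)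
  have "convex (chamber_at X R x)"
  proof (rule convexI)
    fix p q and u v :: real
    assume p: "p \<in> chamber_at X R x" and q: "q \<in> chamber_at X R x" and uv: "0 \<le> u" "0 \<le> v" "u + v = 1"
    have pq: "p \<in> X" "q \<in> X" using p q by (auto simp: chamber_at_def)
    show "u *\<^sub>R p + v *\<^sub>R q \<in> chamber_at X R x" unfolding chamber_at_def
    proof safe
      show "u *\<^sub>R p + v *\<^sub>R q \<in> X" using pq X by (simp add: subspace_add subspace_scale)
      fix \<alpha> assume a: "\<alpha> \<in> R"
      have "\<alpha> (u *\<^sub>R p + v *\<^sub>R q) = u * \<alpha> p + v * \<alpha> q"
        using functional_on_add[OF f[OF a]] functional_on_scale[OF f[OF a]] pq X
        by (simp add: subspace_scale)
      then have eq: "\<alpha> x * \<alpha> (u *\<^sub>R p + v *\<^sub>R q) = u * (\<alpha> x * \<alpha> p) + v * (\<alpha> x * \<alpha> q)"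
        by (simp add: algebra_simps)
      have pos: "\<alpha> x * \<alpha> p > 0" "\<alpha> x * \<alpha> q > 0" using p q a by (auto simp: chamber_at_def)
      show "\<alpha> x * \<alpha> (u *\<^sub>R p + v *\<^sub>R q) > 0"
      proof (cases "u = 0")
        case False
        then have "u * (\<alpha> x * \<alpha> p) > 0" "v * (\<alpha> x * \<alpha> q) \<ge> 0" using uv pos
          by (simp_all del: zero_less_mult_iff add: mult_pos_pos)
        then show ?thesis unfolding eq by linarith
      qed (use uv pos eq in simp)
    qed
  qed
  then show "chamber_at X R x \<subseteq> connected_component_set (regular X R) x"
    using chamber_at_refl[OF x] chamber_at_regular
    by (intro connected_component_maximal) (auto intro: convex_connected)
  show "connected_component_set (regular X R) x \<subseteq> chamber_at X R x"
  proof
    fix y assume y: "y \<in> connected_component_set (regular X R) x"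
    let ?C = "connected_component_set (regular X R) x"
    have sub: "?C \<subseteq> regular X R" by (rule connected_component_subset)
    have con: "connected ?C" by (rule connected_connected_component)
    have xC: "x \<in> ?C" using x connected_component_refl by fastforce
    have CX: "?C \<subseteq> X" using sub by (auto simp: regular_iff)
    have "\<alpha> x * \<alpha> y > 0" if a: "\<alpha> \<in> R" for \<alpha>
    proof (rule ccontr)
      assume n: "\<not> \<alpha> x * \<alpha> y > 0"
      have "connected (\<alpha> ` ?C)"
        using con continuous_on_subset[OF functional_on_continuous[OF X f[OF a]] CX]
        by (rule connected_continuous_image[rotated])
      then have "0 \<in> \<alpha> ` ?C"
        using n xC y connected_contains_Icc[of "\<alpha> ` ?C" "\<alpha> x" "\<alpha> y"]
          connected_contains_Icc[of "\<alpha> ` ?C" "\<alpha> y" "\<alpha> x"]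
        by (auto simp: not_less mult_le_0_iff)
      then show False using sub a by (auto simp: regular_iff)
    qed
    then show "y \<in> chamber_at X R x" using y CX by (auto simp: chamber_at_def)
  qed
qed

lemma chambers_eq:
  fixes X :: "'v::euclidean_space set"
  assumes "subspace X" "R \<subseteq> dual_space X"
  shows "chambers X R = chamber_at X R ` regular X R"
  unfolding chambers_def components_def using component_eq_chamber_at[OF assms] by auto

lemma chamber_of_eq:
  fixes X :: "'v::euclidean_space set"
  assumes "subspace X" "R \<subseteq> dual_space X" "x \<in> regular X R"
  shows "chamber_of X R x = chamber_at X R x"
  unfolding chamber_of_def chambers_eq[OF assms(1,2)]
proof (rule the_equality)
  fix C assume "C \<in> chamber_at X R ` regular X R \<and> x \<in> C"
  then show "C = chamber_at X R x" using chamber_at_eq_iff[OF _ assms(3)] by auto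
qed (use assms chamber_at_refl in auto)

lemma finite_chambers:
  fixes X :: "'v::euclidean_space set"
  assumes "subspace X" "R \<subseteq> dual_space X" "finite R"
  shows "finite (chambers X R)"
proof -
  have "chamber_at X R x = {y \<in> X. \<forall>\<alpha>\<in>R. \<alpha> y \<noteq> 0 \<and> (\<alpha> y > 0 \<longleftrightarrow> \<alpha> \<in> {\<alpha> \<in> R. \<alpha> x > 0})}"
    if "x \<in> regular X R" for x
    using that by (auto simp: chamber_at_def regular_iff zero_less_mult_iff)
  then have "chamber_at X R x \<in> (\<lambda>P. {y \<in> X. \<forall>\<alpha>\<in>R. \<alpha> y \<noteq> 0 \<and> (\<alpha> y > 0 \<longleftrightarrow> \<alpha> \<in> P)}) ` Pow R"
    if "x \<in> regular X R" for x
    using that by (intro image_eqI[of _ _ "{\<alpha> \<in> R. \<alpha> x > 0}"]) auto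
  then have "chambers X R \<subseteq> (\<lambda>P. {y \<in> X. \<forall>\<alpha>\<in>R. \<alpha> y \<noteq> 0 \<and> (\<alpha> y > 0 \<longleftrightarrow> \<alpha> \<in> P)}) ` Pow R"
    unfolding chambers_eq[OF assms(1,2)] by blast
  then show ?thesis by (rule finite_subset) (simp add: assms(3))
qed

lemma positive_roots_chamber_at:
  assumes "x \<in> regular X R" shows "positive_roots R (chamber_at X R x) = {\<alpha> \<in> R. \<alpha> x > 0}"
  unfolding positive_roots_def
proof (intro Collect_cong conj_cong refl)
  fix \<alpha> assume "\<alpha> \<in> R"
  then show "(\<forall>y\<in>chamber_at X R x. \<alpha> y > 0) \<longleftrightarrow> \<alpha> x > 0"
    using chamber_at_refl[OF assms] by (force simp: chamber_at_def zero_less_mult_iff)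
qed

lemma separating_hyperplanes_chamber_at:
  assumes "x \<in> regular X R" "y \<in> regular X R"
  shows "separating_hyperplanes X R (chamber_at X R x) (chamber_at X R y) =
         root_hyperplane X ` {\<alpha> \<in> R. \<alpha> x * \<alpha> y < 0}"
proof -
  have "(\<forall>p\<in>chamber_at X R x. \<forall>q\<in>chamber_at X R y. \<alpha> p * \<alpha> q < 0) \<longleftrightarrow> \<alpha> x * \<alpha> y < 0"
    if "\<alpha> \<in> R" for \<alpha>
  proof
    assume "\<forall>p\<in>chamber_at X R x. \<forall>q\<in>chamber_at X R y. \<alpha> p * \<alpha> q < 0"
    then show "\<alpha> x * \<alpha> y < 0" using chamber_at_refl assms by blast
  next
    assume neg: "\<alpha> x * \<alpha> y < 0"
    show "\<forall>p\<in>chamber_at X R x. \<forall>q\<in>chamber_at X R y. \<alpha> p * \<alpha> q < 0"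
    proof (intro ballI)
      fix p q assume "p \<in> chamber_at X R x" "q \<in> chamber_at X R y"
      then have "\<alpha> x * \<alpha> p > 0" "\<alpha> y * \<alpha> q > 0" using that by (auto simp: chamber_at_def)
      then show "\<alpha> p * \<alpha> q < 0" using neg by (auto simp: zero_less_mult_iff mult_less_0_iff)
    qed
  qed
  then show ?thesis unfolding separating_hyperplanes_def by blast
qed

section \<open>Dual bases\<close>

lemma sum_mult_delta:
  fixes c :: "'i \<Rightarrow> real"
  assumes "finite I" "i \<in> I"
  shows "(\<Sum>j\<in>I. c j * (if i = j then 1 else 0)) = c i" "(\<Sum>j\<in>I. c j * (if j = i then 1 else 0)) = c i"
  using assms by (simp_all add: if_distrib[of "\<lambda>x. _ * x"] cong: if_cong)

locale functional_basis =
  fixes V :: "'v::euclidean_space set" and \<Delta> :: "('v \<Rightarrow> real) set"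
  assumes V: "subspace V" and fin: "finite \<Delta>"
    and functional: "\<alpha> \<in> \<Delta> \<Longrightarrow> functional_on V \<alpha>"
    and independent: "\<lbrakk>\<And>x. x \<in> V \<Longrightarrow> (\<Sum>\<alpha>\<in>\<Delta>. c \<alpha> * \<alpha> x) = 0; \<alpha> \<in> \<Delta>\<rbrakk> \<Longrightarrow> c \<alpha> = 0"
    and spanning: "functional_on V f \<Longrightarrow> \<exists>c. \<forall>x\<in>V. f x = (\<Sum>\<alpha>\<in>\<Delta>. c \<alpha> * \<alpha> x)"
begin

lemma separating:
  assumes "x \<in> V" "\<And>\<alpha>. \<alpha> \<in> \<Delta> \<Longrightarrow> \<alpha> x = 0" shows "x = 0"
proof -
  have "functional_on V (\<lambda>y. x \<bullet> y)" by (simp add: functional_on_def inner_add_right)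
  then obtain c where "\<forall>y\<in>V. x \<bullet> y = (\<Sum>\<alpha>\<in>\<Delta>. c \<alpha> * \<alpha> y)" using spanning by blast
  then have "x \<bullet> x = 0" using assms by (simp add: sum.neutral)
  then show ?thesis by simp
qed

text \<open>
  Represent the functionals by vectors through the ambient inner product. The component of the
  vector of \<open>\<beta>\<close> orthogonal to all other vectors is nonzero by independence, and a multiple of it is the dual vector.
\<close>
lemma dual_vector_exists:
  assumes \<beta>: "\<beta> \<in> \<Delta>"
  shows "\<exists>w\<in>V. \<forall>\<alpha>\<in>\<Delta>. \<alpha> w = (if \<alpha> = \<beta> then 1 else 0)"
proof -
  have "\<exists>r. \<forall>\<alpha>\<in>\<Delta>. r \<alpha> \<in> V \<and> (\<forall>x\<in>V. \<alpha> x = r \<alpha> \<bullet> x)"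
    by (rule bchoice) (metis functional_on_inner[OF V functional])
  then obtain r where r: "\<And>\<alpha>. \<alpha> \<in> \<Delta> \<Longrightarrow> r \<alpha> \<in> V" "\<And>\<alpha> x. \<alpha> \<in> \<Delta> \<Longrightarrow> x \<in> V \<Longrightarrow> \<alpha> x = r \<alpha> \<bullet> x"
    by blast
  obtain y z where y: "y \<in> span (r ` (\<Delta> - {\<beta>}))"
    and z: "\<And>w. w \<in> span (r ` (\<Delta> - {\<beta>})) \<Longrightarrow> orthogonal z w" and eq: "r \<beta> = y + z"
    using orthogonal_subspace_decomp_exists by blast
  have yV: "y \<in> V" using y r(1) span_minimal[OF _ V, of "r ` (\<Delta> - {\<beta>})"] by blast
  have zV: "z \<in> V" using eq yV r(1)[OF \<beta>] V by (metis add_diff_cancel_left' subspace_diff)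
  have zy: "z \<bullet> y = 0" using z[OF y] by (simp add: orthogonal_def)
  have z0: "\<alpha> z = 0" if "\<alpha> \<in> \<Delta> - {\<beta>}" for \<alpha>
    using z[OF span_base, of "r \<alpha>"] that r(2)[of \<alpha> z] zV by (auto simp: orthogonal_def inner_commute)
  have "z \<noteq> 0"
  proof
    assume "z = 0"
    then have "r \<beta> \<in> span (r ` (\<Delta> - {\<beta>}))" using eq y by simp
    then obtain c where c: "r \<beta> = (\<Sum>\<alpha>\<in>\<Delta> - {\<beta>}. c \<alpha> *\<^sub>R r \<alpha>)"
      using in_span_image[of "\<Delta> - {\<beta>}" "r \<beta>" r] fin by blast
    define d where "d = (\<lambda>\<alpha>. if \<alpha> = \<beta> then -1 else c \<alpha>)"
    have "(\<Sum>\<alpha>\<in>\<Delta>. d \<alpha> * \<alpha> x) = 0" if x: "x \<in> V" for x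
    proof -
      have "\<beta> x = (\<Sum>\<alpha>\<in>\<Delta> - {\<beta>}. c \<alpha> * \<alpha> x)"
        using r(2)[OF \<beta> x] r(2)[OF _ x] unfolding c by (simp add: inner_sum_left)
      then show ?thesis using fin \<beta> by (simp add: sum.remove[of \<Delta> \<beta>] d_def)
    qed
    then show False using independent[of d \<beta>] \<beta> by (simp add: d_def)
  qed
  moreover have "\<beta> z = z \<bullet> z" using r(2)[OF \<beta> zV] eq zy by (simp add: inner_add_left inner_commute[of y z])
  ultimately have bz: "\<beta> z \<noteq> 0" by simp
  show ?thesis
  proof (intro bexI ballI)
    show "(1 / \<beta> z) *\<^sub>R z \<in> V" using zV V by (simp add: subspace_scale)
    fix \<alpha> assume a: "\<alpha> \<in> \<Delta>"
    have "\<alpha> ((1 / \<beta> z) *\<^sub>R z) = (1 / \<beta> z) * \<alpha> z"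
      by (rule functional_on_scale[OF functional[OF a] zV])
    then show "\<alpha> ((1 / \<beta> z) *\<^sub>R z) = (if \<alpha> = \<beta> then 1 else 0)" using z0[of \<alpha>] a bz by auto
  qed
qed

abbreviation "\<omega> \<equiv> dual_basis V \<Delta>"

lemma dual_basis: assumes "\<beta> \<in> \<Delta>"
  shows "\<omega> \<beta> \<in> V" "\<And>\<alpha>. \<alpha> \<in> \<Delta> \<Longrightarrow> \<alpha> (\<omega> \<beta>) = (if \<alpha> = \<beta> then 1 else 0)"
proof -
  have "\<exists>!w. w \<in> V \<and> (\<forall>\<alpha>\<in>\<Delta>. \<alpha> w = (if \<alpha> = \<beta> then 1 else 0))"
  proof (rule ex_ex1I)
    show "\<exists>w. w \<in> V \<and> (\<forall>\<alpha>\<in>\<Delta>. \<alpha> w = (if \<alpha> = \<beta> then 1 else 0))"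
      using dual_vector_exists[OF assms] by blast
    fix v w assume H: "v \<in> V \<and> (\<forall>\<alpha>\<in>\<Delta>. \<alpha> v = (if \<alpha> = \<beta> then 1 else 0))"
      "w \<in> V \<and> (\<forall>\<alpha>\<in>\<Delta>. \<alpha> w = (if \<alpha> = \<beta> then 1 else 0))"
    have "v - w = 0"
    proof (rule separating)
      show "v - w \<in> V" using H V by (simp add: subspace_diff)
      fix \<alpha> assume a: "\<alpha> \<in> \<Delta>"
      have "\<alpha> (v - w) = \<alpha> v - \<alpha> w" using functional_on_diff[OF functional[OF a] V] H by blast
      then show "\<alpha> (v - w) = 0" using H a by simp
    qed
    then show "v = w" by simp
  qed
  from theI'[OF this, folded dual_basis_def]
  show "\<omega> \<beta> \<in> V" "\<And>\<alpha>. \<alpha> \<in> \<Delta> \<Longrightarrow> \<alpha> (\<omega> \<beta>) = (if \<alpha> = \<beta> then 1 else 0)" by blast+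
qed

lemma dual_basis_inj: "inj_on \<omega> \<Delta>"
  by (rule inj_onI) (metis dual_basis(2) zero_neq_one)

lemma functional_comb:
  assumes f: "functional_on V f"
  shows "f (\<Sum>\<beta>\<in>\<Delta>. c \<beta> *\<^sub>R \<omega> \<beta>) = (\<Sum>\<beta>\<in>\<Delta>. c \<beta> * f (\<omega> \<beta>))"
proof -
  have "f (\<Sum>\<beta>\<in>\<Delta>. c \<beta> *\<^sub>R \<omega> \<beta>) = (\<Sum>\<beta>\<in>\<Delta>. f (c \<beta> *\<^sub>R \<omega> \<beta>))"
    by (rule functional_on_sum[OF f V]) (use dual_basis V in \<open>auto intro: subspace_scale\<close>)
  also have "\<dots> = (\<Sum>\<beta>\<in>\<Delta>. c \<beta> * f (\<omega> \<beta>))"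
    by (rule sum.cong) (use dual_basis f in \<open>auto simp: functional_on_scale\<close>)
  finally show ?thesis .
qed

lemma root_comb: assumes "\<alpha> \<in> \<Delta>" shows "\<alpha> (\<Sum>\<beta>\<in>\<Delta>. c \<beta> *\<^sub>R \<omega> \<beta>) = c \<alpha>"
proof -
  have "\<alpha> (\<Sum>\<beta>\<in>\<Delta>. c \<beta> *\<^sub>R \<omega> \<beta>) = (\<Sum>\<beta>\<in>\<Delta>. c \<beta> * (if \<alpha> = \<beta> then 1 else 0))"
    using functional_comb[OF functional[OF assms]] dual_basis(2)[OF _ assms] by simp
  then show ?thesis using sum_mult_delta(1)[OF fin assms] by simp
qed

lemma dual_basis_expand: assumes x: "x \<in> V" shows "x = (\<Sum>\<alpha>\<in>\<Delta>. \<alpha> x *\<^sub>R \<omega> \<alpha>)"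
proof -
  have S: "(\<Sum>\<alpha>\<in>\<Delta>. \<alpha> x *\<^sub>R \<omega> \<alpha>) \<in> V"
    by (intro subspace_sum[OF V] subspace_scale[OF V] dual_basis)
  have "x - (\<Sum>\<alpha>\<in>\<Delta>. \<alpha> x *\<^sub>R \<omega> \<alpha>) = 0"
  proof (rule separating)
    show "x - (\<Sum>\<alpha>\<in>\<Delta>. \<alpha> x *\<^sub>R \<omega> \<alpha>) \<in> V" using x S V by (simp add: subspace_diff)
    fix \<beta> assume b: "\<beta> \<in> \<Delta>"
    show "\<beta> (x - (\<Sum>\<alpha>\<in>\<Delta>. \<alpha> x *\<^sub>R \<omega> \<alpha>)) = 0"
      using functional_on_diff[OF functional[OF b] V x S] root_comb[OF b, of "\<lambda>\<alpha>. \<alpha> x"] by simp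
  qed
  then show ?thesis by simp
qed

lemma functional_expand:
  assumes f: "functional_on V f" and x: "x \<in> V" shows "f x = (\<Sum>\<alpha>\<in>\<Delta>. \<alpha> x * f (\<omega> \<alpha>))"
  using functional_comb[OF f, of "\<lambda>\<alpha>. \<alpha> x"] dual_basis_expand[OF x] by simp

lemma rays_independent: "independent (\<omega> ` \<Delta>)"
proof (rule independent_if_scalars_zero)
  show "finite (\<omega> ` \<Delta>)" using fin by simp
  fix f x assume z: "(\<Sum>x\<in>\<omega> ` \<Delta>. f x *\<^sub>R x) = 0" and x: "x \<in> \<omega> ` \<Delta>"
  then obtain \<alpha> where a: "\<alpha> \<in> \<Delta>" "x = \<omega> \<alpha>" by blast
  have "(\<Sum>\<beta>\<in>\<Delta>. f (\<omega> \<beta>) *\<^sub>R \<omega> \<beta>) = 0" using z by (simp add: sum.reindex[OF dual_basis_inj])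
  then have "\<alpha> 0 = f x" using root_comb[OF a(1), of "\<lambda>\<beta>. f (\<omega> \<beta>)"] a by simp
  then show "f x = 0" using functional_on_zero[OF functional[OF a(1)] V] by simp
qed

lemma rays_span: "span (\<omega> ` \<Delta>) = V"
proof
  show "span (\<omega> ` \<Delta>) \<subseteq> V" by (rule span_minimal) (use dual_basis V in auto)
  show "V \<subseteq> span (\<omega> ` \<Delta>)"
  proof
    fix x assume "x \<in> V"
    have "(\<Sum>\<alpha>\<in>\<Delta>. \<alpha> x *\<^sub>R \<omega> \<alpha>) \<in> span (\<omega> ` \<Delta>)" by (intro span_sum span_scale span_base) auto
    then show "x \<in> span (\<omega> ` \<Delta>)" using dual_basis_expand[OF \<open>x \<in> V\<close>] by simp
  qed
qed

lemma rays_representation: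
  assumes x: "x \<in> V" and a: "\<alpha> \<in> \<Delta>" shows "representation (\<omega> ` \<Delta>) x (\<omega> \<alpha>) = \<alpha> x"
proof -
  have f: "functional_on V (\<lambda>x. representation (\<omega> ` \<Delta>) x (\<omega> \<alpha>))"
    using functional_on_representation[OF rays_independent] rays_span by simp
  have r: "representation (\<omega> ` \<Delta>) (\<omega> \<beta>) (\<omega> \<alpha>) = (if \<beta> = \<alpha> then 1 else 0)" if "\<beta> \<in> \<Delta>" for \<beta>
    using representation_basis[OF rays_independent, of "\<omega> \<beta>"] that a dual_basis_inj
    by (auto simp: inj_on_eq_iff)
  show ?thesis using functional_expand[OF f x] r sum_mult_delta(2)[OF fin a, of "\<lambda>\<beta>. \<beta> x"] by simp
qed

lemma card_basis: "card \<Delta> = dim V"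
  using dim_eq_card[OF _ rays_independent, of V] rays_span card_image[OF dual_basis_inj]
  by (metis V span_eq_iff)

lemma primal_coords_eq: assumes x: "x \<in> V" and a: "\<alpha> \<in> \<Delta>" shows "primal_coords V \<Delta> x \<alpha> = \<alpha> x"
proof -
  have "primal_coords V \<Delta> x = restrict (\<lambda>\<alpha>. \<alpha> x) \<Delta>" unfolding primal_coords_def
  proof (rule the_equality)
    show "restrict (\<lambda>\<alpha>. \<alpha> x) \<Delta> \<in> extensional \<Delta> \<and>
          x = (\<Sum>\<alpha>\<in>\<Delta>. restrict (\<lambda>\<alpha>. \<alpha> x) \<Delta> \<alpha> *\<^sub>R \<omega> \<alpha>)"
      using dual_basis_expand[OF x] by simp
    fix c assume c: "c \<in> extensional \<Delta> \<and> x = (\<Sum>\<alpha>\<in>\<Delta>. c \<alpha> *\<^sub>R \<omega> \<alpha>)"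
    then show "c = restrict (\<lambda>\<alpha>. \<alpha> x) \<Delta>"
      using root_comb[of _ c] by (intro extensionalityI[of _ \<Delta>]) auto
  qed
  then show ?thesis using a by simp
qed

lemma dual_coords_eq:
  assumes l: "l \<in> dual_space V" and a: "\<alpha> \<in> \<Delta>" shows "dual_coords V \<Delta> l \<alpha> = l (\<omega> \<alpha>)"
proof -
  have lf: "functional_on V l" and le: "l \<in> extensional V" using l by (auto simp: dual_space_iff)
  have "dual_coords V \<Delta> l = restrict (\<lambda>\<alpha>. l (\<omega> \<alpha>)) \<Delta>" unfolding dual_coords_def
  proof (rule the_equality)
    have "l = (\<lambda>y\<in>V. \<Sum>\<alpha>\<in>\<Delta>. l (\<omega> \<alpha>) * \<alpha> y)"
      using functional_expand[OF lf] le by (intro extensionalityI[of _ V]) (auto simp: mult.commute)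
    then show "restrict (\<lambda>\<alpha>. l (\<omega> \<alpha>)) \<Delta> \<in> extensional \<Delta> \<and>
          l = (\<lambda>y\<in>V. \<Sum>\<alpha>\<in>\<Delta>. restrict (\<lambda>\<alpha>. l (\<omega> \<alpha>)) \<Delta> \<alpha> * \<alpha> y)" by simp
    fix c assume c: "c \<in> extensional \<Delta> \<and> l = (\<lambda>y\<in>V. \<Sum>\<alpha>\<in>\<Delta>. c \<alpha> * \<alpha> y)"
    have "l (\<omega> \<beta>) = c \<beta>" if b: "\<beta> \<in> \<Delta>" for \<beta>
    proof -
      have "l (\<omega> \<beta>) = (\<lambda>y\<in>V. \<Sum>\<alpha>\<in>\<Delta>. c \<alpha> * \<alpha> y) (\<omega> \<beta>)"
        by (rule fun_cong[of l]) (use c in blast)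
      also have "\<dots> = (\<Sum>\<alpha>\<in>\<Delta>. c \<alpha> * \<alpha> (\<omega> \<beta>))" using dual_basis(1)[OF b] by simp
      also have "\<dots> = (\<Sum>\<alpha>\<in>\<Delta>. c \<alpha> * (if \<alpha> = \<beta> then 1 else 0))"
        using dual_basis(2)[OF b] by (intro sum.cong) auto
      finally show ?thesis using sum_mult_delta(2)[OF fin b] by simp
    qed
    moreover have "c \<in> extensional \<Delta>" using c by blast
    ultimately show "c = restrict (\<lambda>\<alpha>. l (\<omega> \<alpha>)) \<Delta>" by (intro extensionalityI[of _ \<Delta>]) auto
  qed
  then show ?thesis using a by simp
qed

end

lemma sign_pattern_prod:
  fixes a b :: "'i \<Rightarrow> real"
  assumes "finite \<Delta>"
  shows "(\<Prod>i\<in>\<Delta>. of_bool (b i < 0) - of_bool (a i < 0)) =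
     (if {i \<in> \<Delta>. b i \<ge> 0} = \<Delta> - {i \<in> \<Delta>. a i \<ge> 0} then (-1) ^ card {i \<in> \<Delta>. b i \<ge> 0} else (0::int))"
proof (cases "{i \<in> \<Delta>. b i \<ge> 0} = \<Delta> - {i \<in> \<Delta>. a i \<ge> 0}")
  case True
  have "(\<Prod>i\<in>\<Delta>. of_bool (b i < 0) - of_bool (a i < 0)) = (\<Prod>i\<in>\<Delta>. if b i \<ge> 0 then - 1 else (1::int))"
  proof (rule prod.cong[OF refl])
    fix i assume "i \<in> \<Delta>"
    then have "b i \<ge> 0 \<longleftrightarrow> \<not> a i \<ge> 0" using True by blast
    then show "of_bool (b i < 0) - of_bool (a i < 0) = (if b i \<ge> 0 then - 1 else (1::int))" by auto
  qed
  also have "\<dots> = (-1) ^ card {i \<in> \<Delta>. b i \<ge> 0}"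
    using assms by (simp add: prod.inter_filter[symmetric])
  finally show ?thesis using True by simp
next
  case False
  then obtain i where "i \<in> \<Delta>" "(b i \<ge> 0) = (a i \<ge> 0)" by blast
  then have "of_bool (b i < 0) - of_bool (a i < 0) = (0::int)" by (cases "b i \<ge> 0") auto
  then show ?thesis using False assms \<open>i \<in> \<Delta>\<close> by (simp, intro bexI[of _ i]) auto
qed

lemma psi_chamber_eq_psi_rays:
  fixes X :: "'v::euclidean_space set"
  assumes b: "functional_basis X (simple_roots X R C)" and x: "x \<in> X" and l: "l \<in> dual_space X"
  shows "psi_chamber X R C x l =
         psi_rays (dual_basis X (simple_roots X R C) ` simple_roots X R C) x l"
proof -
  interpret functional_basis X "simple_roots X R C" by (rule b)
  define \<Delta> where "\<Delta> = simple_roots X R C"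
  have "psi_rays (\<omega> ` \<Delta>) x l =
      (\<Prod>\<alpha>\<in>\<Delta>. of_bool (dual_coords X \<Delta> l \<alpha> < 0) - of_bool (primal_coords X \<Delta> x \<alpha> < 0))"
    unfolding psi_rays_def
    using rays_representation[OF x] primal_coords_eq[OF x] dual_coords_eq[OF l]
    by (subst prod.reindex) (auto simp: \<Delta>_def dual_basis_inj intro!: prod.cong)
  also have "\<dots> = psi_chamber X R C x l"
    using fin by (subst sign_pattern_prod) (auto simp: psi_chamber_def Let_def \<Delta>_def)
  finally show ?thesis by (simp add: \<Delta>_def)
qed


section \<open>Coroots, the invariant form and simple roots\<close>

locale spanning_root_system =
  fixes X :: "'v::euclidean_space set" and R :: "('v \<Rightarrow> real) set"
  assumes root_system: "root_system X R" and spans: "spans_dual X R"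
begin

lemma X: "subspace X" and finite_roots: "finite R" and roots_dual: "R \<subseteq> dual_space X"
  using root_system by (auto simp: root_system_def)

lemma root_functional: "\<alpha> \<in> R \<Longrightarrow> functional_on X \<alpha>"
  and root_extensional: "\<alpha> \<in> R \<Longrightarrow> \<alpha> \<in> extensional X"
  using roots_dual by (auto simp: dual_space_iff)

lemma root_add: "\<alpha> \<in> R \<Longrightarrow> x \<in> X \<Longrightarrow> y \<in> X \<Longrightarrow> \<alpha> (x + y) = \<alpha> x + \<alpha> y"
  and root_minus: "\<alpha> \<in> R \<Longrightarrow> x \<in> X \<Longrightarrow> y \<in> X \<Longrightarrow> \<alpha> (x - y) = \<alpha> x - \<alpha> y"
  and root_scale: "\<alpha> \<in> R \<Longrightarrow> x \<in> X \<Longrightarrow> \<alpha> (t *\<^sub>R x) = t * \<alpha> x"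
  and root_uminus: "\<alpha> \<in> R \<Longrightarrow> x \<in> X \<Longrightarrow> \<alpha> (- x) = - \<alpha> x"
  using functional_on_add functional_on_diff functional_on_scale functional_on_uminus
    root_functional X by blast+

lemma root_eqI: "\<lbrakk>\<alpha> \<in> R; f \<in> extensional X; \<And>x. x \<in> X \<Longrightarrow> \<alpha> x = f x\<rbrakk> \<Longrightarrow> \<alpha> = f"
  using root_extensional extensionalityI by blast

lemma root_nonzero: assumes "\<alpha> \<in> R" shows "\<exists>x\<in>X. \<alpha> x \<noteq> 0"
proof (rule ccontr)
  assume "\<not> ?thesis"
  then have "\<alpha> = (\<lambda>x\<in>X. 0)" using assms by (intro root_eqI) auto
  then show False using assms root_system by (auto simp: root_system_def)
qed

lemma reduced:
  assumes "\<alpha> \<in> R" "\<beta> \<in> R" "\<And>x. x \<in> X \<Longrightarrow> \<beta> x = t * \<alpha> x" shows "t = 1 \<or> t = -1"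
proof -
  have "\<beta> = (\<lambda>x\<in>X. t * \<alpha> x)" using assms by (intro root_eqI) auto
  then show ?thesis using assms(1,2) root_system by (auto simp: root_system_def)
qed

lemma separating:
  assumes x: "x \<in> X" "\<And>\<alpha>. \<alpha> \<in> R \<Longrightarrow> \<alpha> x = 0" shows "x = 0"
proof -
  have "(\<lambda>y\<in>X. x \<bullet> y) \<in> dual_space X"
    by (simp add: dual_space_iff functional_on_restrict[OF X]) (simp add: functional_on_def inner_add_right)
  then obtain a where "\<forall>y\<in>X. (\<lambda>y\<in>X. x \<bullet> y) y = (\<Sum>\<alpha>\<in>R. a \<alpha> * \<alpha> y)"
    using spans unfolding spans_dual_def by blast
  then have "x \<bullet> x = (\<Sum>\<alpha>\<in>R. a \<alpha> * \<alpha> x)" using x(1) by (metis restrict_apply')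
  also have "\<dots> = 0" using x(2) by (simp add: sum.neutral)
  finally show ?thesis by simp
qed

text \<open>
  Two reflections with the same root differ by a transvection. It maps \<open>R\<close> into itself, so each of its orbits in the
  finite set \<open>R\<close> is finite, which forces it to be the identity; and \<open>R\<close> separates points.
\<close>
lemma coroot_unique:
  assumes a: "\<alpha> \<in> R" and v: "v \<in> X" "\<alpha> v = 2" "dual_reflection X \<alpha> v ` R \<subseteq> R"
    and v': "v' \<in> X" "\<alpha> v' = 2" "dual_reflection X \<alpha> v' ` R \<subseteq> R"
  shows "v = v'"
proof -
  have "f v = f v'" if f: "f \<in> R" for f
  proof (rule ccontr)
    assume ne: "f v \<noteq> f v'"
    define d where "d = f v' - f v"
    \<comment> \<open>the orbit of f under the product of the two reflections\<close>
    define g where "g = (\<lambda>k::nat. \<lambda>x\<in>X. f x + real k * d * \<alpha> x)"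
    have "g k \<in> R" for k
    proof (induction k)
      case 0
      have "f = g 0" using f by (intro root_eqI) (auto simp: g_def)
      then show ?case using f by simp
    next
      case (Suc k)
      have mem: "dual_reflection X \<alpha> v (dual_reflection X \<alpha> v' (g k)) \<in> R" using Suc v(3) v'(3) by blast
      have eq: "dual_reflection X \<alpha> v (dual_reflection X \<alpha> v' (g k)) = g (Suc k)"
        unfolding dual_reflection_def g_def
      proof (rule restrict_ext)
        fix x assume x: "x \<in> X"
        have "(f x + real k * d * \<alpha> x) - (f v' + real k * d * 2) * \<alpha> x
            - ((f v + real k * d * 2) - (f v' + real k * d * 2) * 2) * \<alpha> x
            = f x + real k * d * \<alpha> x + (f v' - f v) * \<alpha> x"
          by (simp add: left_diff_distrib distrib_right)
        also have "\<dots> = f x + real (Suc k) * d * \<alpha> x"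
          unfolding d_def[symmetric] by (simp add: distrib_right)
        finally show "(\<lambda>x\<in>X. (\<lambda>x\<in>X. f x + real k * d * \<alpha> x) x - (\<lambda>x\<in>X. f x + real k * d * \<alpha> x) v' * \<alpha> x) x -
            (\<lambda>x\<in>X. (\<lambda>x\<in>X. f x + real k * d * \<alpha> x) x - (\<lambda>x\<in>X. f x + real k * d * \<alpha> x) v' * \<alpha> x) v * \<alpha> x
            = f x + real (Suc k) * d * \<alpha> x"
          using x v(1) v'(1) by (simp only: restrict_apply' v(2) v'(2))
      qed
      show ?case using mem unfolding eq .
    qed
    then have "range g \<subseteq> R" by blast
    then have "finite (range g)" using finite_roots by (rule finite_subset)
    moreover have "inj g"
    proof (rule injI)
      fix i j assume "g i = g j"
      then have "g i v = g j v" by simp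
      then show "i = j" using ne v(1,2) by (simp add: g_def d_def)
    qed
    ultimately show False using finite_imageD infinite_UNIV_nat by blast
  qed
  then have "v - v' = 0"
    using v(1) v'(1) X by (intro separating) (auto simp: subspace_diff root_minus)
  then show ?thesis by simp
qed

abbreviation "cr \<equiv> coroot X R"

lemma coroot_eqI:
  assumes "\<alpha> \<in> R" "v \<in> X" "\<alpha> v = 2" "\<And>\<beta>. \<beta> \<in> R \<Longrightarrow> (\<lambda>x\<in>X. \<beta> x - \<beta> v * \<alpha> x) \<in> R"
  shows "cr \<alpha> = v"
  unfolding coroot_def
proof (rule the_equality)
  show "v \<in> X \<and> \<alpha> v = 2 \<and> dual_reflection X \<alpha> v ` R \<subseteq> R"
    using assms by (auto simp: dual_reflection_def)
  then show "w = v" if "w \<in> X \<and> \<alpha> w = 2 \<and> dual_reflection X \<alpha> w ` R \<subseteq> R" for w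
    using coroot_unique[OF assms(1)] that by blast
qed

lemma coroot:
  assumes a: "\<alpha> \<in> R"
  shows "cr \<alpha> \<in> X" "\<alpha> (cr \<alpha>) = 2" "\<And>\<beta>. \<beta> \<in> R \<Longrightarrow> (\<lambda>x\<in>X. \<beta> x - \<beta> (cr \<alpha>) * \<alpha> x) \<in> R"
    "\<And>\<beta>. \<beta> \<in> R \<Longrightarrow> \<beta> (cr \<alpha>) \<in> \<int>"
proof -
  obtain v where v: "v \<in> X" "\<alpha> v = 2" "dual_reflection X \<alpha> v ` R \<subseteq> R" "\<forall>\<beta>\<in>R. \<beta> v \<in> \<int>"
    using root_system a unfolding root_system_def by blast
  have "cr \<alpha> = v" by (rule coroot_eqI) (use a v in \<open>auto simp: dual_reflection_def\<close>)
  then show "cr \<alpha> \<in> X" "\<alpha> (cr \<alpha>) = 2" "\<And>\<beta>. \<beta> \<in> R \<Longrightarrow> (\<lambda>x\<in>X. \<beta> x - \<beta> (cr \<alpha>) * \<alpha> x) \<in> R"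
    "\<And>\<beta>. \<beta> \<in> R \<Longrightarrow> \<beta> (cr \<alpha>) \<in> \<int>"
    using v by (auto simp: dual_reflection_def)
qed

definition refl :: "('v \<Rightarrow> real) \<Rightarrow> 'v \<Rightarrow> 'v" where "refl \<alpha> x = x - \<alpha> x *\<^sub>R cr \<alpha>"

definition refl_root :: "('v \<Rightarrow> real) \<Rightarrow> ('v \<Rightarrow> real) \<Rightarrow> ('v \<Rightarrow> real)" where
  "refl_root \<alpha> \<beta> = (\<lambda>x\<in>X. \<beta> (refl \<alpha> x))"

lemma refl_in: "\<alpha> \<in> R \<Longrightarrow> x \<in> X \<Longrightarrow> refl \<alpha> x \<in> X"
  using X coroot(1) by (simp add: refl_def subspace_diff subspace_scale)

lemma functional_refl:
  "functional_on X f \<Longrightarrow> \<alpha> \<in> R \<Longrightarrow> x \<in> X \<Longrightarrow> f (refl \<alpha> x) = f x - \<alpha> x * f (cr \<alpha>)"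
  using X coroot(1) by (simp add: refl_def functional_on_diff functional_on_scale subspace_scale)

lemma refl_refl: assumes "\<alpha> \<in> R" "x \<in> X" shows "refl \<alpha> (refl \<alpha> x) = x"
proof -
  have "\<alpha> (refl \<alpha> x) = - \<alpha> x" using functional_refl[OF root_functional[OF assms(1)] assms] coroot(2)[OF assms(1)] by simp
  then have "refl \<alpha> (refl \<alpha> x) = refl \<alpha> x + \<alpha> x *\<^sub>R cr \<alpha>" by (simp add: refl_def[of \<alpha> "refl \<alpha> x"])
  then show ?thesis by (simp add: refl_def)
qed

lemma refl_add: "\<alpha> \<in> R \<Longrightarrow> x \<in> X \<Longrightarrow> y \<in> X \<Longrightarrow> refl \<alpha> (x + y) = refl \<alpha> x + refl \<alpha> y"
  by (simp add: refl_def root_add scaleR_left_distrib)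

lemma refl_scale: "\<alpha> \<in> R \<Longrightarrow> x \<in> X \<Longrightarrow> refl \<alpha> (t *\<^sub>R x) = t *\<^sub>R refl \<alpha> x"
  by (simp add: refl_def root_scale scaleR_right_diff_distrib)

lemma refl_root_apply: "x \<in> X \<Longrightarrow> refl_root \<alpha> \<beta> x = \<beta> (refl \<alpha> x)"
  by (simp add: refl_root_def)

lemma refl_root_in: assumes "\<alpha> \<in> R" "\<beta> \<in> R" shows "refl_root \<alpha> \<beta> \<in> R"
proof -
  have "refl_root \<alpha> \<beta> = (\<lambda>x\<in>X. \<beta> x - \<beta> (cr \<alpha>) * \<alpha> x)"
    unfolding refl_root_def using functional_refl[OF root_functional[OF assms(2)] assms(1)]
    by (intro restrict_ext) (simp add: mult.commute)
  then show ?thesis using coroot(3)[OF assms] by simp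
qed

lemma refl_root_refl_root: assumes "\<alpha> \<in> R" "\<beta> \<in> R" shows "refl_root \<alpha> (refl_root \<alpha> \<beta>) = \<beta>"
  by (rule sym, rule root_eqI[OF assms(2)])
     (use assms in \<open>auto simp: refl_root_def refl_in refl_refl\<close>)

lemma neg_root: assumes "\<alpha> \<in> R" shows "(\<lambda>x\<in>X. - \<alpha> x) \<in> R"
proof -
  have "refl_root \<alpha> \<alpha> = (\<lambda>x\<in>X. - \<alpha> x)"
    unfolding refl_root_def using functional_refl[OF root_functional[OF assms] assms] coroot(2)[OF assms]
    by (intro restrict_ext) simp
  then show ?thesis using refl_root_in[OF assms assms] by simp
qed

lemma coroot_refl_root:
  assumes a: "\<alpha> \<in> R" and b: "\<beta> \<in> R" shows "cr (refl_root \<alpha> \<beta>) = refl \<alpha> (cr \<beta>)"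
proof (rule coroot_eqI)
  have v: "refl \<alpha> (cr \<beta>) \<in> X" using refl_in[OF a coroot(1)[OF b]] .
  show "refl_root \<alpha> \<beta> \<in> R" using refl_root_in[OF a b] .
  show "refl \<alpha> (cr \<beta>) \<in> X" by (rule v)
  show "refl_root \<alpha> \<beta> (refl \<alpha> (cr \<beta>)) = 2"
    using v by (simp add: refl_root_apply refl_refl[OF a coroot(1)[OF b]] coroot(2)[OF b])
  fix \<gamma> assume c: "\<gamma> \<in> R"
  have "refl_root \<alpha> (refl_root \<beta> (refl_root \<alpha> \<gamma>)) =
        (\<lambda>x\<in>X. \<gamma> x - \<gamma> (refl \<alpha> (cr \<beta>)) * refl_root \<alpha> \<beta> x)"
  proof (rule root_eqI)
    show "refl_root \<alpha> (refl_root \<beta> (refl_root \<alpha> \<gamma>)) \<in> R"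
      using a b c refl_root_in by blast
    fix x assume x: "x \<in> X"
    let ?y = "refl \<alpha> x"
    have y: "?y \<in> X" using refl_in[OF a x] .
    have "refl \<alpha> (refl \<beta> ?y) = refl \<alpha> (?y + (- \<beta> ?y) *\<^sub>R cr \<beta>)" by (simp add: refl_def[of \<beta>])
    also have "\<dots> = refl \<alpha> ?y + (- \<beta> ?y) *\<^sub>R refl \<alpha> (cr \<beta>)"
      using y coroot(1)[OF b] X by (simp only: refl_add[OF a] refl_scale[OF a] subspace_scale)
    finally have eq: "refl \<alpha> (refl \<beta> ?y) = x - \<beta> ?y *\<^sub>R refl \<alpha> (cr \<beta>)"
      using refl_refl[OF a x] by simp
    have "\<gamma> (refl \<alpha> (refl \<beta> ?y)) = \<gamma> x - \<beta> ?y * \<gamma> (refl \<alpha> (cr \<beta>))"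
      unfolding eq using functional_on_diff[OF root_functional[OF c] X x, of "\<beta> ?y *\<^sub>R refl \<alpha> (cr \<beta>)"]
        functional_on_scale[OF root_functional[OF c] v] v X by (simp add: subspace_scale)
    then show "refl_root \<alpha> (refl_root \<beta> (refl_root \<alpha> \<gamma>)) x =
        (\<lambda>x\<in>X. \<gamma> x - \<gamma> (refl \<alpha> (cr \<beta>)) * refl_root \<alpha> \<beta> x) x"
      using x y refl_in[OF b y] by (simp add: refl_root_apply mult.commute)
  qed simp
  then show "(\<lambda>x\<in>X. \<gamma> x - \<gamma> (refl \<alpha> (cr \<beta>)) * refl_root \<alpha> \<beta> x) \<in> R"
    using a b c refl_root_in by metis
qed

text \<open>
  An inner product on \<open>X\<close> that is invariant under the Weyl group, since reflections permute the roots.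
\<close>
definition form :: "'v \<Rightarrow> 'v \<Rightarrow> real" where "form x y = (\<Sum>\<gamma>\<in>R. \<gamma> x * \<gamma> y)"

lemma form_commute: "form x y = form y x"
  unfolding form_def by (simp add: mult.commute)

lemma functional_form: "x \<in> X \<Longrightarrow> functional_on X (form x)"
  unfolding functional_on_def form_def
  by (auto simp: root_add root_scale
      distrib_left sum.distrib sum_distrib_left mult.left_commute intro!: sum.cong)

lemma form_pos: assumes x: "x \<in> X" "x \<noteq> 0" shows "form x x > 0"
proof -
  obtain \<gamma> where "\<gamma> \<in> R" "\<gamma> x \<noteq> 0" using separating x by blast
  then show ?thesis unfolding form_def
    by (intro sum_pos2[OF finite_roots, of \<gamma>]) (auto simp flip: power2_eq_square)
qed

lemma form_refl:
  assumes a: "\<alpha> \<in> R" and x: "x \<in> X" and y: "y \<in> X"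
  shows "form (refl \<alpha> x) (refl \<alpha> y) = form x y"
  unfolding form_def
  by (rule sum.reindex_bij_witness[where i = "refl_root \<alpha>" and j = "refl_root \<alpha>"])
     (use assms in \<open>auto simp: refl_root_refl_root refl_root_in refl_root_apply\<close>)

text \<open>
  The reflection is an isometry that negates its coroot.
\<close>
lemma form_coroot:
  assumes a: "\<alpha> \<in> R" and x: "x \<in> X"
  shows "2 * form x (cr \<alpha>) = \<alpha> x * form (cr \<alpha>) (cr \<alpha>)"
proof -
  note c = coroot(1,2)[OF a]
  have "refl \<alpha> (cr \<alpha>) = - cr \<alpha>" using c by (simp add: refl_def scaleR_2)
  then have "form x (cr \<alpha>) = form (refl \<alpha> x) (- cr \<alpha>)" using form_refl[OF a x c(1)] by simp
  also have "\<dots> = - form (cr \<alpha>) (refl \<alpha> x)"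
    using functional_on_uminus[OF functional_form[OF refl_in[OF a x]] c(1)] form_commute by simp
  also have "\<dots> = - (form (cr \<alpha>) x - \<alpha> x * form (cr \<alpha>) (cr \<alpha>))"
    using functional_refl[OF functional_form[OF c(1)] a x] by simp
  finally show ?thesis by (simp add: form_commute)
qed

lemma form_coroot_pos: assumes a: "\<alpha> \<in> R" shows "form (cr \<alpha>) (cr \<alpha>) > 0"
proof (rule form_pos)
  show "cr \<alpha> \<noteq> 0" using coroot(2)[OF a] functional_on_zero[OF root_functional[OF a] X] by auto
qed (use coroot(1)[OF a] in simp)

text \<open>
  The vector that represents the functional \<open>\<Sum>\<alpha>\<in>Q. c \<alpha> * \<alpha>\<close> through the invariant form
  (\<open>form_coroot_comb\<close>).
\<close>
definition coroot_comb :: "('v \<Rightarrow> real) set \<Rightarrow> (('v \<Rightarrow> real) \<Rightarrow> real) \<Rightarrow> 'v" where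
  "coroot_comb Q c = (\<Sum>\<alpha>\<in>Q. (2 * c \<alpha> / form (cr \<alpha>) (cr \<alpha>)) *\<^sub>R cr \<alpha>)"

lemma coroot_comb:
  assumes Q: "Q \<subseteq> R"
  shows coroot_comb_in: "coroot_comb Q c \<in> X"
    and functional_coroot_comb: "functional_on X f \<Longrightarrow>
      f (coroot_comb Q c) = (\<Sum>\<alpha>\<in>Q. (2 * c \<alpha> / form (cr \<alpha>) (cr \<alpha>)) * f (cr \<alpha>))"
    and form_coroot_comb: "x \<in> X \<Longrightarrow> form x (coroot_comb Q c) = (\<Sum>\<alpha>\<in>Q. c \<alpha> * \<alpha> x)"
proof -
  have in_X: "(2 * c \<alpha> / form (cr \<alpha>) (cr \<alpha>)) *\<^sub>R cr \<alpha> \<in> X" if "\<alpha> \<in> Q" for \<alpha>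
    using that Q coroot(1)[of \<alpha>] X by (auto intro: subspace_scale)
  show "coroot_comb Q c \<in> X" unfolding coroot_comb_def by (intro subspace_sum[OF X] in_X)
  show f: "f (coroot_comb Q c) = (\<Sum>\<alpha>\<in>Q. (2 * c \<alpha> / form (cr \<alpha>) (cr \<alpha>)) * f (cr \<alpha>))"
    if f: "functional_on X f" for f
  proof -
    have "f (coroot_comb Q c) = (\<Sum>\<alpha>\<in>Q. f ((2 * c \<alpha> / form (cr \<alpha>) (cr \<alpha>)) *\<^sub>R cr \<alpha>))"
      unfolding coroot_comb_def by (rule functional_on_sum[OF f X in_X])
    also have "\<dots> = (\<Sum>\<alpha>\<in>Q. (2 * c \<alpha> / form (cr \<alpha>) (cr \<alpha>)) * f (cr \<alpha>))"
      by (intro sum.cong HOL.refl functional_on_scale[OF f] coroot(1)) (use Q in auto)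
    finally show ?thesis .
  qed
  show "form x (coroot_comb Q c) = (\<Sum>\<alpha>\<in>Q. c \<alpha> * \<alpha> x)" if x: "x \<in> X"
    unfolding f[OF functional_form[OF x]]
  proof (rule sum.cong[OF HOL.refl])
    fix \<alpha> assume "\<alpha> \<in> Q"
    then have a: "\<alpha> \<in> R" using Q by blast
    have "(2 * c \<alpha> / form (cr \<alpha>) (cr \<alpha>)) * form x (cr \<alpha>) =
        c \<alpha> / form (cr \<alpha>) (cr \<alpha>) * (2 * form x (cr \<alpha>))" by simp
    also have "\<dots> = c \<alpha> * \<alpha> x" unfolding form_coroot[OF a x] using form_coroot_pos[OF a] by simp
    finally show "(2 * c \<alpha> / form (cr \<alpha>) (cr \<alpha>)) * form x (cr \<alpha>) = c \<alpha> * \<alpha> x" .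
  qed
qed

lemma orthogonal_commute:
  assumes "\<alpha> \<in> R" "\<beta> \<in> R" shows "\<alpha> (cr \<beta>) = 0 \<longleftrightarrow> \<beta> (cr \<alpha>) = 0"
proof -
  have "\<alpha> (cr \<beta>) * form (cr \<alpha>) (cr \<alpha>) = \<beta> (cr \<alpha>) * form (cr \<beta>) (cr \<beta>)"
    using form_coroot[OF assms(1) coroot(1)[OF assms(2)]] form_coroot[OF assms(2) coroot(1)[OF assms(1)]]
      form_commute[of "cr \<alpha>" "cr \<beta>"] by linarith
  then show ?thesis using form_coroot_pos[OF assms(1)] form_coroot_pos[OF assms(2)]
    by (metis less_irrefl mult_eq_0_iff)
qed

text \<open>
  By the strict Cauchy--Schwarz inequality the product of the two positive integers \<open>\<alpha> (cr \<beta>)\<close> and \<open>\<beta> (cr \<alpha>)\<close> is less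
  than \<open>4\<close>, so one of them is \<open>1\<close>, and the corresponding reflection produces the difference. The point \<open>p\<close>
  excludes \<open>\<alpha> = - \<beta>\<close>, the only other case of equality for reduced systems.
\<close>
lemma root_diff:
  assumes a: "\<alpha> \<in> R" and b: "\<beta> \<in> R" and ne: "\<alpha> \<noteq> \<beta>" and p: "p \<in> X" "\<alpha> p > 0" "\<beta> p > 0"
    and acute: "\<alpha> (cr \<beta>) > 0"
  shows "(\<lambda>x\<in>X. \<alpha> x - \<beta> x) \<in> R"
proof -
  define A where "A = form (cr \<alpha>) (cr \<alpha>)"
  define B where "B = form (cr \<beta>) (cr \<beta>)"
  define C where "C = form (cr \<alpha>) (cr \<beta>)"
  note ca = coroot(1)[OF a] and cb = coroot(1)[OF b]
  have AB: "A > 0" "B > 0" using form_coroot_pos a b by (auto simp: A_def B_def)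
  have C1: "2 * C = \<beta> (cr \<alpha>) * B" unfolding C_def B_def using form_coroot[OF b ca] .
  have C2: "2 * C = \<alpha> (cr \<beta>) * A"
    using form_coroot[OF a cb] form_commute[of "cr \<alpha>" "cr \<beta>"] by (simp only: C_def A_def)
  \<comment> \<open>the defect in the Cauchy--Schwarz inequality for the two coroots\<close>
  define w where "w = B *\<^sub>R cr \<alpha> - C *\<^sub>R cr \<beta>"
  have w: "w \<in> X" using ca cb X by (simp add: w_def subspace_diff subspace_scale)
  have formw: "form y w = B * form y (cr \<alpha>) - C * form y (cr \<beta>)" if "y \<in> X" for y
    using functional_on_diff[OF functional_form[OF that] X, of "B *\<^sub>R cr \<alpha>" "C *\<^sub>R cr \<beta>"]
      functional_on_scale[OF functional_form[OF that] ca] functional_on_scale[OF functional_form[OF that] cb]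
      ca cb X by (simp add: w_def subspace_scale)
  have "w \<noteq> 0"
  proof
    assume w0: "w = 0"
    have *: "\<alpha> x * (A * B) = \<beta> x * (B * C)" if x: "x \<in> X" for x
    proof -
      have "form x w = 0" using w0 functional_on_zero[OF functional_form[OF x] X] by simp
      then have "B * (2 * form x (cr \<alpha>)) = C * (2 * form x (cr \<beta>))" using formw[OF x] by simp
      then show ?thesis unfolding form_coroot[OF a x] form_coroot[OF b x] A_def[symmetric] B_def[symmetric]
        by (simp add: mult_ac)
    qed
    have "\<alpha> p * (A * B) > 0" using p AB by simp
    then have C: "C > 0" using *[OF p(1)] p AB by (simp add: zero_less_mult_iff)
    have **: "\<alpha> x = C / A * \<beta> x" if "x \<in> X" for x using *[OF that] AB by (simp add: field_simps)
    have "C / A = 1 \<or> C / A = -1" by (rule reduced[OF b a **])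
    moreover have "C / A > 0" using C AB by simp
    ultimately have one: "C / A = 1" by linarith
    have "\<alpha> = \<beta>"
    proof (rule root_eqI[OF a root_extensional[OF b]])
      show "\<alpha> x = \<beta> x" if "x \<in> X" for x using **[OF that] unfolding one by simp
    qed
    then show False using ne by simp
  qed
  then have "form w w > 0" using form_pos w by blast
  moreover have "form w w = B * (A * B - C * C)"
  proof -
    have "form (cr \<alpha>) w = B * A - C * C" "form (cr \<beta>) w = B * C - C * B"
      using formw[OF ca] formw[OF cb] form_commute[of "cr \<alpha>" "cr \<beta>"] by (simp_all only: A_def B_def C_def)
    then show ?thesis using formw[OF w] form_commute[of w "cr \<alpha>"] form_commute[of w "cr \<beta>"]
      by (simp add: right_diff_distrib mult_ac)
  qed
  ultimately have CS: "C * C < A * B" using AB by (simp add: zero_less_mult_iff)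
  obtain i j where ij: "\<alpha> (cr \<beta>) = of_int i" "\<beta> (cr \<alpha>) = of_int j"
    using coroot(4) a b by (meson Ints_cases)
  have "\<alpha> (cr \<beta>) * A > 0" using acute AB by simp
  then have Cpos: "C > 0" using C2 by linarith
  have i: "i > 0" using acute ij by simp
  have "\<beta> (cr \<alpha>) * B > 0" using C1 Cpos by linarith
  then have j: "j > 0" using AB ij by (simp add: zero_less_mult_iff)
  have "of_int (i * j) * (A * B) = 4 * (C * C)"
    using arg_cong2[OF C1 C2, of "(*)"] ij by (simp add: algebra_simps)
  then have "of_int (i * j) * (A * B) < 4 * (A * B)" using CS by simp
  then have "real_of_int (i * j) < of_int 4" using AB by (simp add: mult_less_cancel_right)
  then have "i * j < 4" by (simp only: of_int_less_iff)
  then have "i = 1 \<or> j = 1"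
  proof -
    have "\<not> (i \<ge> 2 \<and> j \<ge> 2)" using \<open>i * j < 4\<close> mult_mono[of 2 i 2 j] by auto
    then show ?thesis using i j by linarith
  qed
  then show ?thesis
  proof
    assume "i = 1"
    then show ?thesis using coroot(3)[OF b a] ij by simp
  next
    assume "j = 1"
    then have "(\<lambda>x\<in>X. \<beta> x - \<alpha> x) \<in> R" using coroot(3)[OF a b] ij by simp
    from neg_root[OF this] show ?thesis by (simp cong: restrict_cong)
  qed
qed

end

locale based_root_system = spanning_root_system +
  fixes p assumes p: "p \<in> regular X R"
begin

definition "P = {\<alpha> \<in> R. \<alpha> p > 0}"
definition "\<Delta> = simple_roots X R (chamber_at X R p)"

lemma pX: "p \<in> X" using p by (simp add: regular_iff)

lemma simple_iff: "\<alpha> \<in> \<Delta> \<longleftrightarrow> \<alpha> \<in> P \<and> \<not> (\<exists>\<beta>\<in>P. \<exists>\<gamma>\<in>P. \<alpha> = (\<lambda>x\<in>X. \<beta> x + \<gamma> x))"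
  unfolding \<Delta>_def simple_roots_def positive_roots_chamber_at[OF p] P_def[symmetric] by simp

lemma simpleD: "\<alpha> \<in> \<Delta> \<Longrightarrow> \<alpha> \<in> R \<and> \<alpha> p > 0" using simple_iff by (auto simp: P_def)

lemma finite_simple: "finite \<Delta>" using finite_roots simpleD finite_subset[of \<Delta> R] by blast

text \<open>
  A positive root that is not simple is a sum of two positive roots with smaller values at \<open>p\<close>.
\<close>
lemma positive_root_comb:
  assumes "\<alpha> \<in> P"
  shows "\<exists>c. (\<forall>\<beta>\<in>\<Delta>. c \<beta> \<ge> 0) \<and> (\<forall>x\<in>X. \<alpha> x = (\<Sum>\<beta>\<in>\<Delta>. c \<beta> * \<beta> x))"
  using assms
proof (induction "card {\<beta> \<in> P. \<beta> p < \<alpha> p}" arbitrary: \<alpha> rule: less_induct)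
  case less
  show ?case
  proof (cases "\<alpha> \<in> \<Delta>")
    case True
    show ?thesis
    proof (intro exI conjI ballI)
      show "\<alpha> x = (\<Sum>\<beta>\<in>\<Delta>. (if \<beta> = \<alpha> then 1 else 0) * \<beta> x)" for x
        using sum_mult_delta(2)[OF finite_simple True, of "\<lambda>\<beta>. \<beta> x"] by (simp add: mult.commute)
    qed simp
  next
    case False
    then obtain \<beta> \<gamma> where bc: "\<beta> \<in> P" "\<gamma> \<in> P" "\<alpha> = (\<lambda>x\<in>X. \<beta> x + \<gamma> x)"
      using less.prems simple_iff by blast
    have finP: "finite P" using finite_roots by (simp add: P_def)
    have lt: "\<beta> p < \<alpha> p" "\<gamma> p < \<alpha> p" using bc pX by (auto simp: P_def)
    have "{\<delta> \<in> P. \<delta> p < \<eta> p} \<subset> {\<delta> \<in> P. \<delta> p < \<alpha> p}" if "\<eta> \<in> P" "\<eta> p < \<alpha> p" for \<eta>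
      using that by force
    then have cd: "card {\<delta> \<in> P. \<delta> p < \<eta> p} < card {\<delta> \<in> P. \<delta> p < \<alpha> p}" if "\<eta> \<in> P" "\<eta> p < \<alpha> p" for \<eta>
      using that finP by (intro psubset_card_mono) auto
    obtain c where c: "\<forall>\<delta>\<in>\<Delta>. c \<delta> \<ge> 0" "\<forall>x\<in>X. \<beta> x = (\<Sum>\<delta>\<in>\<Delta>. c \<delta> * \<delta> x)"
      using less.hyps[OF cd[OF bc(1) lt(1)] bc(1)] by blast
    obtain d where d: "\<forall>\<delta>\<in>\<Delta>. d \<delta> \<ge> 0" "\<forall>x\<in>X. \<gamma> x = (\<Sum>\<delta>\<in>\<Delta>. d \<delta> * \<delta> x)"
      using less.hyps[OF cd[OF bc(2) lt(2)] bc(2)] by blast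
    show ?thesis
      by (rule exI[of _ "\<lambda>\<delta>. c \<delta> + d \<delta>"]) (use c d bc(3) in \<open>simp add: distrib_right sum.distrib\<close>)
  qed
qed

text \<open>
  Otherwise the difference is a root, and whichever sign it has at \<open>p\<close>, one of the two simple roots decomposes.
\<close>
lemma simple_obtuse:
  assumes "\<alpha> \<in> \<Delta>" "\<beta> \<in> \<Delta>" "\<alpha> \<noteq> \<beta>" shows "\<alpha> (cr \<beta>) \<le> 0"
proof (rule ccontr)
  assume "\<not> \<alpha> (cr \<beta>) \<le> 0"
  define \<gamma> where "\<gamma> = (\<lambda>x\<in>X. \<alpha> x - \<beta> x)"
  have g: "\<gamma> \<in> R" unfolding \<gamma>_def
    by (rule root_diff) (use assms simpleD pX \<open>\<not> \<alpha> (cr \<beta>) \<le> 0\<close> in auto)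
  have g': "(\<lambda>x\<in>X. - \<gamma> x) \<in> R" by (rule neg_root[OF g])
  have "\<gamma> p \<noteq> 0" using p g by (auto simp: regular_iff)
  then consider "\<gamma> p > 0" | "- \<gamma> p > 0" by linarith
  then show False
  proof cases
    case 1
    have "\<alpha> = (\<lambda>x\<in>X. \<beta> x + \<gamma> x)"
      using assms simpleD by (intro root_eqI) (auto simp: \<gamma>_def)
    moreover have "\<beta> \<in> P" "\<gamma> \<in> P" using 1 g assms simpleD by (auto simp: P_def)
    ultimately show False using assms simple_iff by blast
  next
    case 2
    have "\<beta> = (\<lambda>x\<in>X. \<alpha> x + (\<lambda>x\<in>X. - \<gamma> x) x)"
      using assms simpleD by (intro root_eqI) (auto simp: \<gamma>_def)
    moreover have "\<alpha> \<in> P" "(\<lambda>x\<in>X. - \<gamma> x) \<in> P" using 2 g' assms simpleD pX by (auto simp: P_def)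
    ultimately show False using assms simple_iff by blast
  qed
qed

text \<open>
  Vectors in an open half space with pairwise nonpositive inner products are independent: separate a relation into its
  positive part, represented by \<open>z\<close>, and its negative part; obtuseness gives \<open>form z z \<le> 0\<close>, and then
  evaluation at \<open>p\<close> shows that both parts are trivial.
\<close>
lemma simple_independent:
  assumes c: "\<And>x. x \<in> X \<Longrightarrow> (\<Sum>\<alpha>\<in>\<Delta>. c \<alpha> * \<alpha> x) = 0" and a: "\<alpha> \<in> \<Delta>"
  shows "c \<alpha> = 0"
proof -
  define Q where "Q = {\<alpha> \<in> \<Delta>. c \<alpha> > 0}"
  have fin: "finite Q" "Q \<subseteq> \<Delta>" using finite_simple by (auto simp: Q_def)
  have split: "(\<Sum>\<alpha>\<in>Q. c \<alpha> * \<alpha> x) = (\<Sum>\<alpha>\<in>\<Delta> - Q. - c \<alpha> * \<alpha> x)" if "x \<in> X" for x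
    using c[OF that] sum.subset_diff[OF fin(2) finite_simple, of "\<lambda>\<alpha>. c \<alpha> * \<alpha> x"]
    by (simp add: sum_negf)
  have QR: "Q \<subseteq> R" using fin simpleD by blast
  define z where "z = coroot_comb Q c"
  have z: "z \<in> X" unfolding z_def by (rule coroot_comb_in[OF QR])
  have formz: "form x z = (\<Sum>\<alpha>\<in>Q. c \<alpha> * \<alpha> x)" if "x \<in> X" for x
    unfolding z_def by (rule form_coroot_comb[OF QR that])
  have "form z z \<le> 0"
  proof -
    have "form z z = (\<Sum>\<beta>\<in>\<Delta> - Q. - c \<beta> * \<beta> z)" using formz[OF z] split[OF z] by simp
    also have "\<dots> \<le> 0"
    proof (rule sum_nonpos)
      fix \<beta> assume b: "\<beta> \<in> \<Delta> - Q"
      have "\<beta> z = (\<Sum>\<alpha>\<in>Q. (2 * c \<alpha> / form (cr \<alpha>) (cr \<alpha>)) * \<beta> (cr \<alpha>))"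
        unfolding z_def by (rule functional_coroot_comb[OF QR]) (use b simpleD root_functional in auto)
      also have "\<dots> \<le> 0"
      proof (rule sum_nonpos)
        fix \<alpha> assume "\<alpha> \<in> Q"
        then have "\<alpha> \<in> \<Delta>" "c \<alpha> > 0" "\<alpha> \<noteq> \<beta>" using b by (auto simp: Q_def)
        then show "(2 * c \<alpha> / form (cr \<alpha>) (cr \<alpha>)) * \<beta> (cr \<alpha>) \<le> 0"
          using form_coroot_pos[of \<alpha>] simpleD[of \<alpha>] simple_obtuse[of \<beta> \<alpha>] b
          by (intro mult_nonneg_nonpos) auto
      qed
      finally show "- c \<beta> * \<beta> z \<le> 0" using b by (intro mult_nonneg_nonpos) (auto simp: Q_def)
    qed
    finally show ?thesis .
  qed
  then have "z = 0" using form_pos z by force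
  then have "(\<Sum>\<alpha>\<in>Q. c \<alpha> * \<alpha> p) = 0"
    using formz[OF pX] functional_on_zero[OF functional_form[OF pX] X] by simp
  moreover have terms: "c \<alpha> * \<alpha> p > 0" if "\<alpha> \<in> Q" for \<alpha>
    using that simpleD by (auto simp: Q_def)
  ultimately have Q: "Q = {}"
    using fin(1) sum_pos[of Q "\<lambda>\<alpha>. c \<alpha> * \<alpha> p"] by fastforce
  have "(\<Sum>\<alpha>\<in>\<Delta>. - c \<alpha> * \<alpha> p) = 0" using split[OF pX] Q by simp
  moreover have "- c \<alpha> * \<alpha> p \<ge> 0" if "\<alpha> \<in> \<Delta>" for \<alpha>
    using that Q simpleD[OF that] by (intro mult_nonneg_nonneg) (auto simp: Q_def)
  ultimately have "- c \<alpha> * \<alpha> p = 0" using finite_simple a by (metis (no_types, lifting) sum_nonneg_eq_0_iff)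
  then show ?thesis using simpleD[OF a] by simp
qed

lemma root_comb_simple:
  assumes "\<alpha> \<in> R" shows "\<exists>c. \<forall>x\<in>X. \<alpha> x = (\<Sum>\<beta>\<in>\<Delta>. c \<beta> * \<beta> x)"
proof (cases "\<alpha> p > 0")
  case True
  then show ?thesis using positive_root_comb[of \<alpha>] assms by (auto simp: P_def)
next
  case False
  then have "(\<lambda>x\<in>X. - \<alpha> x) \<in> P"
    using neg_root[OF assms] assms p pX by (auto simp: P_def regular_iff not_less order_le_less)
  then obtain c where "\<forall>x\<in>X. (\<lambda>x\<in>X. - \<alpha> x) x = (\<Sum>\<beta>\<in>\<Delta>. c \<beta> * \<beta> x)"
    using positive_root_comb by blast
  then have "\<forall>x\<in>X. \<alpha> x = (\<Sum>\<beta>\<in>\<Delta>. - c \<beta> * \<beta> x)" by (simp add: sum_negf) (metis minus_minus)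
  then show ?thesis by (rule exI[where x = "\<lambda>\<beta>. - c \<beta>"])
qed

lemma functional_basis_simple: "functional_basis X \<Delta>"
proof
  show "subspace X" by (rule X)
  show "finite \<Delta>" by (rule finite_simple)
  show "functional_on X \<alpha>" if "\<alpha> \<in> \<Delta>" for \<alpha> using simpleD that root_functional by blast
  show "c \<alpha> = 0" if "\<And>x. x \<in> X \<Longrightarrow> (\<Sum>\<alpha>\<in>\<Delta>. c \<alpha> * \<alpha> x) = 0" "\<alpha> \<in> \<Delta>" for c \<alpha>
    using simple_independent[of c \<alpha>] that by blast
  fix f assume "functional_on X f"
  then have "restrict f X \<in> dual_space X" using X by (simp add: dual_space_iff functional_on_restrict)
  then obtain a where a: "\<forall>x\<in>X. restrict f X x = (\<Sum>\<gamma>\<in>R. a \<gamma> * \<gamma> x)"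
    using spans unfolding spans_dual_def by blast
  have "\<exists>d. \<forall>\<gamma>\<in>R. \<forall>x\<in>X. \<gamma> x = (\<Sum>\<beta>\<in>\<Delta>. d \<gamma> \<beta> * \<beta> x)"
    using root_comb_simple by (intro bchoice) blast
  then obtain d where d: "\<forall>\<gamma>\<in>R. \<forall>x\<in>X. \<gamma> x = (\<Sum>\<beta>\<in>\<Delta>. d \<gamma> \<beta> * \<beta> x)" by blast
  have "f x = (\<Sum>\<beta>\<in>\<Delta>. (\<Sum>\<gamma>\<in>R. a \<gamma> * d \<gamma> \<beta>) * \<beta> x)" if x: "x \<in> X" for x
  proof -
    have "f x = (\<Sum>\<gamma>\<in>R. a \<gamma> * \<gamma> x)" using a x by simp
    also have "\<dots> = (\<Sum>\<gamma>\<in>R. a \<gamma> * (\<Sum>\<beta>\<in>\<Delta>. d \<gamma> \<beta> * \<beta> x))"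
    proof (rule sum.cong[OF refl])
      fix \<gamma> assume "\<gamma> \<in> R"
      then have "\<gamma> x = (\<Sum>\<beta>\<in>\<Delta>. d \<gamma> \<beta> * \<beta> x)" using d x by blast
      then show "a \<gamma> * \<gamma> x = a \<gamma> * (\<Sum>\<beta>\<in>\<Delta>. d \<gamma> \<beta> * \<beta> x)" by (rule arg_cong)
    qed
    also have "\<dots> = (\<Sum>\<gamma>\<in>R. \<Sum>\<beta>\<in>\<Delta>. a \<gamma> * d \<gamma> \<beta> * \<beta> x)" by (simp add: sum_distrib_left mult.assoc)
    also have "\<dots> = (\<Sum>\<beta>\<in>\<Delta>. \<Sum>\<gamma>\<in>R. a \<gamma> * d \<gamma> \<beta> * \<beta> x)" by (rule sum.swap)
    finally show ?thesis by (simp add: sum_distrib_right)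
  qed
  then show "\<exists>c. \<forall>x\<in>X. f x = (\<Sum>\<beta>\<in>\<Delta>. c \<beta> * \<beta> x)"
    by (intro exI[of _ "\<lambda>\<beta>. \<Sum>\<gamma>\<in>R. a \<gamma> * d \<gamma> \<beta>"]) blast
qed

end


section \<open>Words of reflections\<close>

lemma mult_pos_trans: "(a::real) * b > 0 \<Longrightarrow> b * c > 0 \<Longrightarrow> a * c > 0"
  by (auto simp: zero_less_mult_iff)

lemma mult_pos_neg_trans: "(a::real) * b > 0 \<Longrightarrow> b * c < 0 \<Longrightarrow> a * c < 0"
  by (auto simp: zero_less_mult_iff mult_less_0_iff)

lemma last_prefix_with:
  assumes "f []" "\<not> f xs" shows "\<exists>as d bs. xs = as @ d # bs \<and> f as \<and> \<not> f (as @ [d])"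
  using assms
proof (induction xs rule: rev_induct)
  case (snoc x xs)
  show ?case
  proof (cases "f xs")
    case True
    then show ?thesis using snoc.prems by (intro exI[of _ xs] exI[of _ x] exI[of _ "[]"]) simp
  next
    case False
    then obtain as d bs where "xs = as @ d # bs" "f as" "\<not> f (as @ [d])" using snoc by blast
    then show ?thesis by (intro exI[of _ as] exI[of _ d] exI[of _ "bs @ [x]"]) simp
  qed
qed simp

context spanning_root_system
begin

text \<open>
  Elements of the Weyl group are handled as words of reflections acting on points, the last letter first.
\<close>
definition word :: "('v \<Rightarrow> real) list \<Rightarrow> 'v \<Rightarrow> 'v" where "word bs x = foldr refl bs x"

lemma word_Nil [simp]: "word [] x = x" and word_Cons [simp]: "word (b # bs) x = refl b (word bs x)"
  and word_append [simp]: "word (as @ bs) x = word as (word bs x)"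
  by (auto simp: word_def)

lemma word_in: "set bs \<subseteq> R \<Longrightarrow> x \<in> X \<Longrightarrow> word bs x \<in> X"
  by (induction bs) (auto simp: refl_in)

lemma word_rev: "set bs \<subseteq> R \<Longrightarrow> x \<in> X \<Longrightarrow> word (rev bs) (word bs x) = x"
  by (induction bs arbitrary: x) (auto simp: refl_refl word_in)

lemma word_rev': "set bs \<subseteq> R \<Longrightarrow> x \<in> X \<Longrightarrow> word bs (word (rev bs) x) = x"
  using word_rev[of "rev bs" x] by simp

lemma word_add: "set bs \<subseteq> R \<Longrightarrow> x \<in> X \<Longrightarrow> y \<in> X \<Longrightarrow> word bs (x + y) = word bs x + word bs y"
  by (induction bs) (auto simp: refl_add word_in)

lemma word_scale: "set bs \<subseteq> R \<Longrightarrow> x \<in> X \<Longrightarrow> word bs (t *\<^sub>R x) = t *\<^sub>R word bs x"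
  by (induction bs) (auto simp: refl_scale word_in)

text \<open>
  The conjugate of a reflection is the reflection in the transported root.
\<close>
lemma refl_conjugate:
  assumes "set bs \<subseteq> R" "c \<in> R" "b \<in> R" "\<And>x. x \<in> X \<Longrightarrow> b x = c (word bs x)" "x \<in> X"
  shows "word bs (refl b x) = refl c (word bs x)"
  using assms
proof (induction bs arbitrary: c)
  case Nil
  then have "b = c" by (intro root_eqI) (auto simp: root_extensional)
  then show ?case by simp
next
  case (Cons a bs)
  have a: "a \<in> R" and bs: "set bs \<subseteq> R" using Cons.prems by auto
  note y = word_in[OF bs Cons.prems(5)]
  have "word bs (refl b x) = refl (refl_root a c) (word bs x)"
    by (rule Cons.IH[OF bs refl_root_in[OF a Cons.prems(2)] Cons.prems(3) _ Cons.prems(5)])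
       (use Cons.prems(4) in \<open>simp add: refl_root_apply word_in[OF bs]\<close>)
  also have "\<dots> = word bs x + (- c (refl a (word bs x))) *\<^sub>R refl a (cr c)"
    by (simp add: refl_def[of "refl_root a c"] coroot_refl_root[OF a Cons.prems(2)] refl_root_apply[OF y])
  finally have "refl a (word bs (refl b x)) =
      refl a (word bs x) + (- c (refl a (word bs x))) *\<^sub>R refl a (refl a (cr c))"
    using y refl_in[OF a coroot(1)[OF Cons.prems(2)]] X
    by (simp only: refl_add[OF a] refl_scale[OF a] subspace_scale)
  then show ?case
    by (simp add: refl_def[of c] refl_refl[OF a coroot(1)[OF Cons.prems(2)]])
qed

definition proportional :: "('v \<Rightarrow> real) \<Rightarrow> ('v \<Rightarrow> real) \<Rightarrow> bool" where
  "proportional b g \<longleftrightarrow> (\<exists>t. \<forall>x\<in>X. b x = t * g x)"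

lemma proportional_roots:
  assumes b: "b \<in> R" and g: "g \<in> R" and pr: "proportional b g"
  shows "b = g \<or> b = (\<lambda>x\<in>X. - g x)"
proof -
  obtain t where t: "\<And>x. x \<in> X \<Longrightarrow> b x = t * g x" using pr by (auto simp: proportional_def)
  then have "t = 1 \<or> t = -1" using reduced[OF g b] by blast
  then show ?thesis
  proof
    assume "t = 1"
    then have "b = g" using t b root_extensional[OF g] by (intro root_eqI) auto
    then show ?thesis ..
  next
    assume "t = -1"
    then have "b = (\<lambda>x\<in>X. - g x)" using t b by (intro root_eqI) auto
    then show ?thesis ..
  qed
qed

lemma coroot_neg: assumes g: "g \<in> R" shows "cr (\<lambda>x\<in>X. - g x) = - cr g"
proof -
  note c = coroot(1,2)[OF g]
  have "refl_root g g = (\<lambda>x\<in>X. - g x)"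
    unfolding refl_root_def using functional_refl[OF root_functional[OF g] g] c
    by (intro restrict_ext) simp
  moreover have "refl g (cr g) = - cr g" using c by (simp add: refl_def scaleR_2)
  ultimately show ?thesis using coroot_refl_root[OF g g] by simp
qed

lemma refl_proportional:
  assumes "b \<in> R" "g \<in> R" "proportional b g" "x \<in> X" shows "refl b x = refl g x"
  using proportional_roots[OF assms(1-3)]
proof
  assume "b = (\<lambda>x\<in>X. - g x)"
  then show ?thesis using coroot_neg[OF assms(2)] assms(4) by (simp add: refl_def)
qed simp

section \<open>Galleries and free action on chambers\<close>

text \<open>
  Reflection subgroups, and not only the full Weyl group, are needed: the roots orthogonal to a given
  one form such a subset.
\<close>
definition reflection_closed :: "('v \<Rightarrow> real) set \<Rightarrow> bool" where
  "reflection_closed Q \<longleftrightarrow> Q \<subseteq> R \<and> (\<forall>a\<in>Q. \<forall>b\<in>Q. refl_root a b \<in> Q)"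

lemma reflection_closed_roots: "reflection_closed R" by (simp add: reflection_closed_def refl_root_in)

lemma reflection_closedD: "reflection_closed Q \<Longrightarrow> b \<in> Q \<Longrightarrow> b \<in> R" by (auto simp: reflection_closed_def)

lemma reflection_closed_word:
  assumes "reflection_closed Q" "set bs \<subseteq> Q" "c \<in> Q" shows "\<exists>b\<in>Q. \<forall>x\<in>X. b x = c (word bs x)"
  using assms(2,3)
proof (induction bs arbitrary: c)
  case (Cons a bs)
  then have "refl_root a c \<in> Q" using assms(1) by (auto simp: reflection_closed_def)
  then obtain b where b: "b \<in> Q" "\<forall>x\<in>X. b x = refl_root a c (word bs x)"
    using Cons.IH[of "refl_root a c"] Cons.prems by force
  have "set bs \<subseteq> R" using Cons.prems assms(1) by (auto simp: reflection_closed_def)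
  then show ?case using b by (intro bexI[of _ b]) (auto simp: refl_root_apply word_in)
qed auto

definition same_side :: "('v \<Rightarrow> real) set \<Rightarrow> 'v \<Rightarrow> 'v \<Rightarrow> bool" where
  "same_side Q x y \<longleftrightarrow> (\<forall>b\<in>Q. b x * b y > 0)"

lemma same_side_trans: "same_side Q x y \<Longrightarrow> same_side Q y z \<Longrightarrow> same_side Q x z"
  unfolding same_side_def using mult_pos_trans by blast

lemma same_side_refl: "x \<in> regular X Q \<Longrightarrow> same_side Q x x"
  unfolding same_side_def regular_iff by (simp flip: power2_eq_square)

lemma same_side_word:
  assumes Q: "reflection_closed Q" "set bs \<subseteq> Q" and xy: "x \<in> X" "y \<in> X" "same_side Q x y"
  shows "same_side Q (word bs x) (word bs y)"
  unfolding same_side_def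
proof
  fix c assume "c \<in> Q"
  then obtain b where "b \<in> Q" "\<forall>x\<in>X. b x = c (word bs x)" using reflection_closed_word[OF Q] by blast
  then show "c (word bs x) * c (word bs y) > 0" using xy by (auto simp: same_side_def)
qed

definition adjacent :: "('v \<Rightarrow> real) set \<Rightarrow> ('v \<Rightarrow> real) \<Rightarrow> 'v \<Rightarrow> 'v \<Rightarrow> bool" where
  "adjacent Q g x y \<longleftrightarrow> x \<in> regular X Q \<and> y \<in> regular X Q \<and> g \<in> Q \<and> g x * g y < 0 \<and>
     (\<forall>b\<in>Q. b x * b y < 0 \<longrightarrow> proportional b g)"

text \<open>
  In the chamber of \<open>x\<close>, this says that \<open>g\<close> is simple up to sign, in a form that avoids simple roots: the
  reflection in \<open>g\<close> moves \<open>x\<close> across no hyperplane but that of \<open>g\<close>.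
\<close>
definition wall :: "('v \<Rightarrow> real) set \<Rightarrow> 'v \<Rightarrow> ('v \<Rightarrow> real) \<Rightarrow> bool" where
  "wall Q x g \<longleftrightarrow> g \<in> Q \<and> (\<forall>b\<in>Q. b x * b (refl g x) < 0 \<longrightarrow> proportional b g)"

lemma adjacent_proportional:
  "adjacent Q g x y \<Longrightarrow> b \<in> Q \<Longrightarrow> b x * b y < 0 \<Longrightarrow> \<exists>t. \<forall>x\<in>X. b x = t * g x"
  by (simp add: adjacent_def proportional_def)

text \<open>
  The segment from \<open>p\<close> to \<open>q\<close> meets the hyperplane of \<open>g\<close> in a multiple of the point \<open>z\<close>, which lies
  on no other hyperplane and is fixed by the reflection. Near \<open>z\<close> reflection in \<open>g\<close> therefore exchanges the two sides.
\<close>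
lemma adjacent_refl:
  assumes Q: "reflection_closed Q" and ad: "adjacent Q g p q"
  shows "same_side Q p (refl g q)"
  unfolding same_side_def
proof
  fix d assume d: "d \<in> Q"
  have pq: "p \<in> X" "q \<in> X" "\<And>b. b \<in> Q \<Longrightarrow> b p \<noteq> 0" "\<And>b. b \<in> Q \<Longrightarrow> b q \<noteq> 0"
    and gpq: "g p * g q < 0" and gQ: "g \<in> Q"
    using ad by (auto simp: adjacent_def regular_iff)
  have gR: "g \<in> R" and dR: "d \<in> R" using Q gQ d reflection_closedD by auto
  define e where "e = refl_root g d"
  have eQ: "e \<in> Q" using Q gQ d by (auto simp: reflection_closed_def e_def)
  have eR: "e \<in> R" using Q eQ reflection_closedD by auto
  have e: "e x = d (refl g x)" if "x \<in> X" for x using that by (simp add: e_def refl_root_apply)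
  show "d p * d (refl g q) > 0"
  proof (cases "e p * e q < 0")
    case True
    then obtain t where t: "\<And>x. x \<in> X \<Longrightarrow> e x = t * g x"
      using adjacent_proportional[OF ad eQ True] by blast
    have "d p = e (refl g p)" using e[OF refl_in[OF gR pq(1)]] refl_refl[OF gR pq(1)] by simp
    also have "\<dots> = t * g (refl g p)" using t refl_in[OF gR pq(1)] .
    also have "g (refl g p) = - g p"
      using functional_refl[OF root_functional[OF gR] gR pq(1)] coroot(2)[OF gR] by simp
    finally have "d p = - e p" using t[OF pq(1)] by simp
    then show ?thesis using True e[OF pq(2)] by simp
  next
    case False
    then have epq: "e p * e q > 0" using pq(3,4)[OF eQ] by (metis linorder_neqE_linordered_idom mult_eq_0_iff)
    \<comment> \<open>a positive multiple of the point where the segment meets the hyperplane of g\<close>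
    define z where "z = (g p * g p) *\<^sub>R q - (g p * g q) *\<^sub>R p"
    have z: "z \<in> X" using pq X by (simp add: z_def subspace_diff subspace_scale)
    have bz: "b z = (g p * g p) * b q - (g p * g q) * b p" if "b \<in> R" for b
      unfolding z_def using pq X that by (simp add: root_minus root_scale subspace_scale)
    have gz: "g z = 0" using bz[OF gR] by simp
    have gpp: "g p * g p > 0" using pq(3)[OF gQ] by (simp flip: power2_eq_square)
    have side: "b z * b p > 0 \<and> b z * b q > 0" if b: "b \<in> Q" "b p * b q > 0" for b
    proof -
      have bR: "b \<in> R" using Q b reflection_closedD by auto
      have sq: "b p * b p > 0" "b q * b q > 0" using pq(3,4)[OF b(1)] by (simp_all flip: power2_eq_square)
      have "(g p * g p) * (b p * b q) > 0" "- (g p * g q) * (b p * b p) > 0"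
        "(g p * g p) * (b q * b q) > 0" "- (g p * g q) * (b p * b q) > 0"
        using gpp gpq b(2) sq by (auto intro: mult_pos_pos mult_neg_pos)
      moreover have "b z * b p = (g p * g p) * (b p * b q) + (- (g p * g q) * (b p * b p))"
        "b z * b q = (g p * g p) * (b q * b q) + (- (g p * g q) * (b p * b q))"
        unfolding bz[OF bR] by (simp_all add: algebra_simps)
      ultimately show ?thesis by linarith
    qed
    have ez: "e z = d z" using e[OF z] gz by (simp add: refl_def)
    have "e z * e q > 0" using side[OF eQ epq] by simp
    then have "d z \<noteq> 0" using ez by auto
    have "\<not> d p * d q < 0"
    proof
      assume "d p * d q < 0"
      then obtain t where "\<And>x. x \<in> X \<Longrightarrow> d x = t * g x"
        using adjacent_proportional[OF ad d] by blast
      then show False using z gz \<open>d z \<noteq> 0\<close> by simp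
    qed
    then have "d p * d q > 0" using pq(3,4)[OF d] by (metis linorder_neqE_linordered_idom mult_eq_0_iff)
    then have "d z * d p > 0" using side d by blast
    then have "d p * d z > 0" by (simp add: mult.commute)
    moreover have "d z * d (refl g q) > 0" using \<open>e z * e q > 0\<close> ez e[OF pq(2)] by simp
    ultimately show ?thesis by (rule mult_pos_trans)
  qed
qed

lemma adjacent_wall:
  assumes Q: "reflection_closed Q" and ad: "adjacent Q g p q"
  shows "wall Q p g" and "same_side Q (refl g p) q"
proof -
  have gQ: "g \<in> Q" and pq: "p \<in> X" "q \<in> X" using ad by (auto simp: adjacent_def regular_iff)
  have gR: "g \<in> R" using Q gQ reflection_closedD by auto
  have "same_side Q (word [g] p) (word [g] (refl g q))"
    by (rule same_side_word[OF Q]) (use gQ pq adjacent_refl[OF assms] refl_in[OF gR] in auto)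
  then show *: "same_side Q (refl g p) q" using refl_refl[OF gR pq(2)] by simp
  show "wall Q p g" unfolding wall_def
  proof (intro conjI ballI impI)
    fix b assume b: "b \<in> Q" "b p * b (refl g p) < 0"
    then have "b (refl g p) * b q > 0" using * by (auto simp: same_side_def)
    then have "b p * b q < 0" using b by (auto simp: zero_less_mult_iff mult_less_0_iff)
    then show "proportional b g" using ad b by (auto simp: adjacent_def)
  qed (rule gQ)
qed

lemma regular_word:
  assumes "reflection_closed Q" "set bs \<subseteq> Q" "x \<in> regular X Q" shows "word bs x \<in> regular X Q"
  unfolding regular_iff
proof (intro conjI ballI)
  have "set bs \<subseteq> R" using assms by (auto simp: reflection_closed_def)
  then show "word bs x \<in> X" using assms word_in by (auto simp: regular_iff)
  fix c assume "c \<in> Q"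
  then obtain b where "b \<in> Q" "\<forall>x\<in>X. b x = c (word bs x)" using reflection_closed_word[OF assms(1,2)] by blast
  then show "c (word bs x) \<noteq> 0" using assms(3) by (metis regular_iff)
qed

text \<open>
  A wall crossing next to the chamber of \<open>word cs p\<close> is the image under the word of a crossing next to
  the chamber of \<open>p\<close>.
\<close>
lemma adjacent_pullback:
  assumes Q: "reflection_closed Q" "set cs \<subseteq> Q" and p: "p \<in> regular X Q"
    and ad: "adjacent Q g u v" and su: "same_side Q (word cs p) u"
  obtains h where "h \<in> Q" "\<And>x. x \<in> X \<Longrightarrow> h x = g (word cs x)" "adjacent Q h p (word (rev cs) v)"
proof -
  have csR: "set cs \<subseteq> R" using Q by (auto simp: reflection_closed_def)
  have uv: "u \<in> X" "v \<in> X" "v \<in> regular X Q" and g: "g \<in> Q" "g u * g v < 0"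
    using ad by (auto simp: adjacent_def regular_iff)
  have pX: "p \<in> X" using p by (simp add: regular_iff)
  obtain h where h: "h \<in> Q" "\<forall>x\<in>X. h x = g (word cs x)" using reflection_closed_word[OF Q g(1)] by blast
  have v': "word (rev cs) v \<in> X" using uv csR word_in[of "rev cs"] by auto
  have wv: "word cs (word (rev cs) v) = v" by (rule word_rev'[OF csR uv(2)])
  have "adjacent Q h p (word (rev cs) v)" unfolding adjacent_def
  proof (intro conjI ballI impI)
    show "p \<in> regular X Q" by (rule p)
    show "word (rev cs) v \<in> regular X Q" using regular_word[OF Q(1), of "rev cs" v] Q(2) uv(3) by simp
    show "h \<in> Q" by (rule h(1))
    have "g (word cs p) * g u > 0" using su g by (auto simp: same_side_def)
    then have "g (word cs p) * g v < 0" using g(2) by (rule mult_pos_neg_trans)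
    then show "h p * h (word (rev cs) v) < 0" using h(2) pX v' wv by simp
    fix b assume b: "b \<in> Q" "b p * b (word (rev cs) v) < 0"
    obtain c where c: "c \<in> Q" "\<forall>x\<in>X. c x = b (word (rev cs) x)"
      using reflection_closed_word[OF Q(1) _ b(1), of "rev cs"] Q(2) by auto
    have cw: "c (word cs x) = b x" if "x \<in> X" for x
      using c(2) word_in[OF csR that] word_rev[OF csR that] by simp
    have "c u * c (word cs p) > 0" using su c(1) by (auto simp: same_side_def mult.commute)
    moreover have "c (word cs p) * c v < 0" using cw[OF pX] c(2) uv(2) b(2) by simp
    ultimately have "c u * c v < 0" by (rule mult_pos_neg_trans)
    then obtain t where t: "\<And>x. x \<in> X \<Longrightarrow> c x = t * g x"
      using adjacent_proportional[OF ad c(1)] by blast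
    have "b x = t * h x" if "x \<in> X" for x
      using cw[OF that] t[OF word_in[OF csR that]] h(2) that by simp
    then show "proportional b h" by (auto simp: proportional_def)
  qed
  then show thesis using that h by blast
qed

lemma root_gallery_induct:
  assumes Q: "reflection_closed Q" and x: "x \<in> regular X Q" and y: "y \<in> regular X Q" and base: "Pr x"
    and same: "\<And>u v. v \<in> regular X Q \<Longrightarrow> same_side Q u v \<Longrightarrow> Pr u \<Longrightarrow> Pr v"
    and step: "\<And>g u v. adjacent Q g u v \<Longrightarrow> Pr u \<Longrightarrow> Pr v"
  shows "Pr y"
proof (rule gallery_induct[where V = X and A = Q and y = x and y' = y])
  show "subspace X" "finite Q" "x \<in> X" "y \<in> X" "Pr x"
    using X Q finite_roots finite_subset x y base by (auto simp: reflection_closed_def regular_iff)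
  show "functional_on X a" "a x \<noteq> 0" "a y \<noteq> 0" if "a \<in> Q" for a
    using that Q root_functional x y by (auto simp: reflection_closed_def regular_iff)
next
  fix u v assume u: "u \<in> X" "\<And>a. a \<in> Q \<Longrightarrow> a u \<noteq> 0" and v: "v \<in> X" "\<And>a. a \<in> Q \<Longrightarrow> a v \<noteq> 0"
    and sep: "\<And>a b x. a \<in> Q \<Longrightarrow> b \<in> Q \<Longrightarrow> a u * a v < 0 \<Longrightarrow> b u * b v < 0 \<Longrightarrow> x \<in> X \<Longrightarrow>
      a u * b x = b u * a x" and Pu: "Pr u"
  have reg: "u \<in> regular X Q" "v \<in> regular X Q" using u v by (auto simp: regular_iff)
  show "Pr v"
  proof (cases "\<exists>g\<in>Q. g u * g v < 0")
    case False
    then have "same_side Q u v" unfolding same_side_def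
      using u(2) v(2) by (metis linorder_neqE_linordered_idom mult_eq_0_iff)
    then show ?thesis using same reg(2) Pu by blast
  next
    case True
    then obtain g where g: "g \<in> Q" "g u * g v < 0" by blast
    have "adjacent Q g u v" unfolding adjacent_def
    proof (intro conjI ballI impI reg g)
      fix b assume b: "b \<in> Q" "b u * b v < 0"
      have "b x = (b u / g u) * g x" if "x \<in> X" for x
        using sep[OF g(1) b(1) g(2) b(2) that] u(2)[OF g(1)] by (simp add: field_simps)
      then show "proportional b g" unfolding proportional_def by blast
    qed
    then show ?thesis using step Pu by blast
  qed
qed

text \<open>
  Each step of a gallery that leaves the chamber of \<open>word cs p\<close> through a wall extends the word by the wall of
  \<open>p\<close> that corresponds to it.
\<close>
lemma chambers_transitive:
  assumes Q: "reflection_closed Q" and p: "p \<in> regular X Q" and y: "y \<in> regular X Q"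
  shows "\<exists>cs. set cs \<subseteq> {g. wall Q p g} \<and> same_side Q (word cs p) y"
proof (rule root_gallery_induct[OF Q p y])
  show "\<exists>cs. set cs \<subseteq> {g. wall Q p g} \<and> same_side Q (word cs p) p"
    using same_side_refl[OF p] by (intro exI[of _ "[]"]) simp
next
  fix u v assume "same_side Q u v" "\<exists>cs. set cs \<subseteq> {g. wall Q p g} \<and> same_side Q (word cs p) u"
  then show "\<exists>cs. set cs \<subseteq> {g. wall Q p g} \<and> same_side Q (word cs p) v"
    using same_side_trans by blast
next
  fix g u v assume ad: "adjacent Q g u v"
    and "\<exists>cs. set cs \<subseteq> {g. wall Q p g} \<and> same_side Q (word cs p) u"
  then obtain cs where cs: "set cs \<subseteq> {g. wall Q p g}" "same_side Q (word cs p) u" by blast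
  have v: "v \<in> X" using ad by (simp add: adjacent_def regular_iff)
  have csQ: "set cs \<subseteq> Q" using cs(1) by (auto simp: wall_def)
  have csR: "set cs \<subseteq> R" using csQ Q by (auto simp: reflection_closed_def)
  obtain h where h: "h \<in> Q" "adjacent Q h p (word (rev cs) v)"
    using adjacent_pullback[OF Q csQ p ad cs(2)] by blast
  note w = adjacent_wall[OF Q h(2)]
  have hR: "h \<in> R" using Q h reflection_closedD by auto
  have "same_side Q (word cs (refl h p)) (word cs (word (rev cs) v))"
    by (rule same_side_word[OF Q csQ _ _ w(2)])
       (use p hR csR v word_in[of "rev cs" v] in \<open>auto simp: regular_iff refl_in\<close>)
  then have "same_side Q (word (cs @ [h]) p) v" using word_rev'[OF csR v] by simp
  then show "\<exists>cs. set cs \<subseteq> {g. wall Q p g} \<and> same_side Q (word cs p) v"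
    using cs(1) w(1) by (intro exI[of _ "cs @ [h]"]) auto
qed

text \<open>
  Every root hyperplane is a wall of some chamber, namely of one close to a generic point \<open>z\<close> of it; transport that
  chamber to the chamber of \<open>p\<close>.
\<close>
lemma refl_word_of_walls:
  assumes Q: "reflection_closed Q" and p: "p \<in> regular X Q" and b: "b \<in> Q"
  shows "\<exists>cs. set cs \<subseteq> {g. wall Q p g} \<and> (\<forall>x\<in>X. refl b x = word cs x)"
proof -
  define H where "H = {x \<in> X. b x = 0}"
  have bR: "b \<in> R" using Q b reflection_closedD by auto
  note bf = root_functional[OF bR]
  have pX: "p \<in> X" using p by (simp add: regular_iff)
  have QR: "Q \<subseteq> R" using Q by (simp add: reflection_closed_def)
  have H: "subspace H" "H \<subseteq> X" unfolding H_def subspace_def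
    using X bR functional_on_zero[OF bf X] by (auto simp: root_add root_scale subspace_0 subspace_add subspace_scale)
  have pr: "proportional c b" if c: "c \<in> Q" "\<forall>x\<in>H. c x = 0" for c
  proof -
    have "c x = (c p / b p) * b x" if x: "x \<in> X" for x
      using functional_proportional[where f = c and g = b and u = p and x = x and V = X]
        X root_functional[of c] bf c x pX p b QR by (auto simp: H_def regular_iff field_simps)
    then show ?thesis unfolding proportional_def by blast
  qed
  have "\<exists>z\<in>H. \<forall>c\<in>{c \<in> Q. \<exists>x\<in>H. c x \<noteq> 0}. c z \<noteq> 0"
  proof (rule generic_point_exists[OF H(1)])
    show "finite {c \<in> Q. \<exists>x\<in>H. c x \<noteq> 0}" using finite_subset[OF QR finite_roots] by simp
    show "functional_on H c" if "c \<in> {c \<in> Q. \<exists>x\<in>H. c x \<noteq> 0}" for c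
      using that QR root_functional[of c] functional_on_subset[OF _ H(2)] by auto
  qed auto
  then obtain z where z: "z \<in> H" "\<And>c. c \<in> Q \<Longrightarrow> \<exists>x\<in>H. c x \<noteq> 0 \<Longrightarrow> c z \<noteq> 0" by blast
  have zX: "z \<in> X" using z H by auto
  have npX: "- p \<in> X" using X pX by (simp add: subspace_neg)
  have fin: "finite Q" "\<And>c. c \<in> Q \<Longrightarrow> functional_on X c"
    using QR finite_roots finite_subset root_functional by auto
  have nz: "c p \<noteq> 0" "c (- p) \<noteq> 0" if "c \<in> Q" for c
    using p that QR root_uminus[of c p] pX by (auto simp: regular_iff)
  obtain s where s: "\<And>c. c \<in> Q \<Longrightarrow> sgn (c (z + s *\<^sub>R p)) = (if c z = 0 then sgn (c p) else sgn (c z))"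
    using small_perturbation_ex[OF X fin zX pX] nz by metis
  obtain r where r: "\<And>c. c \<in> Q \<Longrightarrow> sgn (c (z + r *\<^sub>R - p)) = (if c z = 0 then sgn (c (- p)) else sgn (c z))"
    using small_perturbation_ex[OF X fin zX npX] nz by metis
  define u where "u = z + s *\<^sub>R p"
  define v where "v = z + r *\<^sub>R - p"
  have uv: "u \<in> X" "v \<in> X" using zX pX npX X by (auto simp: u_def v_def subspace_add subspace_diff subspace_scale)
  have nzu: "c u \<noteq> 0" and nzv: "c v \<noteq> 0" if "c \<in> Q" for c
    using arg_cong[OF s[OF that], of "\<lambda>a. a = 0"] arg_cong[OF r[OF that], of "\<lambda>a. a = 0"] nz[OF that]
    unfolding u_def[symmetric] v_def[symmetric]
    by (auto simp: sgn_zero_iff split: if_splits)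
  have same: "c u * c v > 0" if "c \<in> Q" "c z \<noteq> 0" for c
  proof (rule sgn_eq_imp_mult_pos)
    show "sgn (c u) = sgn (c v)" using s[OF that(1)] r[OF that(1)] that(2) by (simp add: u_def v_def)
  qed (rule nzv[OF that(1)])
  have "adjacent Q b u v" unfolding adjacent_def
  proof (intro conjI ballI impI)
    show "u \<in> regular X Q" "v \<in> regular X Q" using uv nzu nzv by (auto simp: regular_iff)
    show "b \<in> Q" by (rule b)
    have "sgn (b u) = - sgn (b v)"
      using s[OF b] r[OF b] z(1) root_uminus[OF bR pX] by (simp add: u_def v_def H_def sgn_minus)
    then show "b u * b v < 0" using nzv[OF b]
      by (cases "b v > 0") (auto simp: sgn_1_pos sgn_1_neg mult_less_0_iff not_less order_le_less)
    fix c assume c: "c \<in> Q" "c u * c v < 0"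
    have "\<not> (\<exists>x\<in>H. c x \<noteq> 0)" using same[OF c(1)] z(2)[OF c(1)] c(2) by force
    then show "proportional c b" using pr c(1) by blast
  qed
  moreover obtain cs where cs: "set cs \<subseteq> {g. wall Q p g}" "same_side Q (word cs p) u"
    using chambers_transitive[OF Q p, of u] uv nzu by (auto simp: regular_iff)
  moreover have csQ: "set cs \<subseteq> Q" using cs(1) by (auto simp: wall_def)
  ultimately obtain h where h: "h \<in> Q" "\<And>x. x \<in> X \<Longrightarrow> h x = b (word cs x)" "adjacent Q h p (word (rev cs) v)"
    using adjacent_pullback[OF Q csQ p] by blast
  have csR: "set cs \<subseteq> R" and hR: "h \<in> R" using csQ h(1) QR by auto
  have "refl b x = word (cs @ [h] @ rev cs) x" if x: "x \<in> X" for x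
  proof -
    have y: "word (rev cs) x \<in> X" using word_in[of "rev cs" x] csR x by simp
    show ?thesis using refl_conjugate[OF csR bR hR h(2) y] word_rev'[OF csR x] by simp
  qed
  then show ?thesis using cs(1) adjacent_wall(1)[OF Q h(3)]
    by (intro exI[of _ "cs @ [h] @ rev cs"]) auto
qed

lemma word_of_walls:
  assumes Q: "reflection_closed Q" and p: "p \<in> regular X Q" and bs: "set bs \<subseteq> Q"
  shows "\<exists>cs. set cs \<subseteq> {g. wall Q p g} \<and> (\<forall>x\<in>X. word bs x = word cs x)"
  using bs
proof (induction bs)
  case (Cons b bs)
  then obtain cs where cs: "set cs \<subseteq> {g. wall Q p g}" "\<forall>x\<in>X. word bs x = word cs x" by auto
  obtain ds where ds: "set ds \<subseteq> {g. wall Q p g}" "\<forall>x\<in>X. refl b x = word ds x"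
    using refl_word_of_walls[OF Q p, of b] Cons.prems by auto
  have "set bs \<subseteq> R" using Cons.prems Q by (auto simp: reflection_closed_def)
  then have "word (b # bs) x = word (ds @ cs) x" if "x \<in> X" for x
    using cs(2) ds(2) word_in[of bs x] that by simp
  then show ?case using cs(1) ds(1) by (intro exI[of _ "ds @ cs"]) auto
qed (auto intro: exI[of _ "[]"])

text \<open>
  The deletion argument. The word describes a gallery from the chamber of \<open>p\<close> to itself that begins by crossing the
  hyperplane of its first letter \<open>c\<close>, so it crosses the same hyperplane again, at a letter \<open>d\<close>. The reflection
  met at that moment is the one in \<open>c\<close>, and both letters can be removed.
\<close>
lemma word_of_walls_free:
  assumes Q: "reflection_closed Q" and p: "p \<in> regular X Q"
  shows "set cs \<subseteq> {g. wall Q p g} \<Longrightarrow> same_side Q p (word cs p) \<Longrightarrow> \<forall>x\<in>X. word cs x = x"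
proof (induction "length cs" arbitrary: cs rule: less_induct)
  case less
  show ?case
  proof (cases cs)
    case (Cons c cs')
    have cQ: "c \<in> Q" and csQ: "set cs' \<subseteq> Q" using less.prems(1) Cons by (auto simp: wall_def)
    have QR: "Q \<subseteq> R" using Q by (simp add: reflection_closed_def)
    have cR: "c \<in> R" and csR: "set cs' \<subseteq> R" using cQ csQ QR by auto
    have pX: "p \<in> X" using p by (simp add: regular_iff)
    \<comment> \<open>f as: after the letters c # as the gallery is still on the far side of the hyperplane of c\<close>
    define f where "f = (\<lambda>as. c p * c (word (c # as) p) < 0)"
    have "c (refl c p) = - c p"
      using functional_refl[OF root_functional[OF cR] cR pX] coroot(2)[OF cR] by simp
    then have "f []" using p cQ by (simp add: f_def regular_iff) (simp flip: power2_eq_square)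
    moreover have "\<not> f cs'" using less.prems(2) cQ Cons by (auto simp: f_def same_side_def not_less less_imp_le)
    ultimately obtain as d bs where sp: "cs' = as @ d # bs" "f as" "\<not> f (as @ [d])"
      using last_prefix_with[of f cs'] by blast
    have asQ: "set (c # as) \<subseteq> Q" and dQ: "d \<in> Q" and bsQ: "set bs \<subseteq> Q" using csQ cQ sp(1) by auto
    have asR: "set (c # as) \<subseteq> R" and as'R: "set as \<subseteq> R" and dR: "d \<in> R" and bsR: "set bs \<subseteq> R"
      using asQ dQ bsQ QR by auto
    obtain b where b: "b \<in> Q" "\<forall>x\<in>X. b x = c (word (c # as) x)"
      using reflection_closed_word[OF Q asQ cQ] by blast
    have bR: "b \<in> R" using b QR by auto
      have "word (c # as @ [d]) p \<in> regular X Q"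
      using regular_word[OF Q, of "c # as @ [d]" p] asQ dQ p by simp
    then have "c (word (c # as @ [d]) p) \<noteq> 0" using cQ by (auto simp: regular_iff)
    moreover have "c p \<noteq> 0" using p cQ by (auto simp: regular_iff)
    ultimately have pos: "c p * c (word (c # as @ [d]) p) > 0"
      using sp(3) unfolding f_def by (metis linorder_neqE_linordered_idom mult_eq_0_iff append_Cons)
    have "b p * b (refl d p) < 0"
    proof -
      have 1: "b p = c (word (c # as) p)" using b(2) pX by blast
      have 2: "b (refl d p) = c (word (c # as @ [d]) p)" using b(2) refl_in[OF dR pX] by simp
      have "c p * b p < 0" using sp(2) 1 by (simp add: f_def)
      moreover have "b (refl d p) * c p > 0" using pos 2 by (simp add: mult.commute)
      ultimately have "b (refl d p) * b p < 0" using mult_pos_neg_trans by blast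
      then show ?thesis by (simp add: mult.commute)
    qed
    then have "proportional b d" using less.prems(1) Cons sp(1) b(1) by (auto simp: wall_def)
    then have bd: "refl b x = refl d x" if "x \<in> X" for x using refl_proportional[OF bR dR] that by blast
    have del: "word (c # as @ [d]) x = word as x" if x: "x \<in> X" for x
    proof -
      have "word (c # as) (refl b x) = refl c (word (c # as) x)"
        by (rule refl_conjugate[OF asR cR bR]) (use b x in auto)
      also have "\<dots> = word as x" using refl_refl[OF cR word_in[OF as'R x]] by simp
      finally show ?thesis using bd[OF x] by simp
    qed
    have eq: "word cs x = word (as @ bs) x" if x: "x \<in> X" for x
      using del[OF word_in[OF bsR x]] Cons sp(1) by simp
    have "\<forall>x\<in>X. word (as @ bs) x = x"
    proof (rule less.hyps)
      show "length (as @ bs) < length cs" using Cons sp(1) by simp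
      show "set (as @ bs) \<subseteq> {g. wall Q p g}" using less.prems(1) Cons sp(1) by auto
      show "same_side Q p (word (as @ bs) p)" using less.prems(2) eq[OF pX] by simp
    qed
    then show ?thesis using eq by simp
  qed simp
qed

theorem word_free:
  assumes Q: "reflection_closed Q" and p: "p \<in> regular X Q" and bs: "set bs \<subseteq> Q"
    and stab: "same_side Q p (word bs p)" and x: "x \<in> X"
  shows "word bs x = x"
proof -
  obtain cs where cs: "set cs \<subseteq> {g. wall Q p g}" "\<forall>x\<in>X. word bs x = word cs x"
    using word_of_walls[OF Q p bs] by blast
  have "p \<in> X" using p by (simp add: regular_iff)
  then show ?thesis using word_of_walls_free[OF Q p cs(1)] stab cs(2) x by simp
qed

text \<open>
  The map \<open>w\<close> given by \<open>- refl \<alpha>\<close> lies in the Weyl group and fixes \<open>v = cr \<alpha>\<close>. Points close to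
  \<open>v\<close> are sent to points close to \<open>v\<close>, and these are separated only by hyperplanes through \<open>v\<close>, that is by roots orthogonal
  to \<open>\<alpha>\<close>. Hence a word in such roots has the same effect as \<open>w\<close> on a chamber close to \<open>v\<close>, and by
  freeness it equals \<open>w\<close>.
\<close>
theorem orthogonal_word:
  assumes a: "\<alpha> \<in> R" and bs: "set bs \<subseteq> R" and neg: "\<And>x. x \<in> X \<Longrightarrow> word bs x = - x"
  shows "\<exists>cs. set cs \<subseteq> {\<beta> \<in> R. \<beta> (cr \<alpha>) = 0} \<and> (\<forall>x\<in>X. word cs x = - refl \<alpha> x)"
proof -
  define v where "v = cr \<alpha>"
  have v: "v \<in> X" "\<alpha> v = 2" using coroot[OF a] by (auto simp: v_def)
  define Q where "Q = {\<beta> \<in> R. \<beta> v = 0}"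
  have QR: "Q \<subseteq> R" by (auto simp: Q_def)
  have Q: "reflection_closed Q" unfolding reflection_closed_def
  proof (intro conjI ballI)
    fix a b assume ab: "a \<in> Q" "b \<in> Q"
    have "refl a v = v" using ab by (simp add: Q_def refl_def)
    then show "refl_root a b \<in> Q" using ab v refl_root_in by (simp add: Q_def refl_root_apply)
  qed (rule QR)
  have "\<exists>u\<in>X. \<forall>b\<in>R. b u \<noteq> 0"
    by (rule generic_point_exists[OF X finite_roots root_functional root_nonzero])
  then obtain u where u: "u \<in> X" "\<And>b. b \<in> R \<Longrightarrow> b u \<noteq> 0" by blast
  have uR: "u \<in> regular X R" using u by (simp add: regular_iff)
  define w where "w = \<alpha> # bs"
  have wR: "set w \<subseteq> R" using a bs by (simp add: w_def)
  have w: "word w x = - refl \<alpha> x" if "x \<in> X" for x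
    using neg[OF that] refl_scale[OF a that, of "-1"] by (simp add: w_def)
  have wv: "word w v = v" using w[OF v(1)] v by (simp add: refl_def v_def scaleR_2)
  have wuR: "word w u \<in> regular X R" by (rule regular_word[OF reflection_closed_roots wR uR])
  have "u \<in> regular X Q" "word w u \<in> regular X Q" using uR wuR QR by (auto simp: regular_iff)
  then obtain cs where cs: "set cs \<subseteq> {g. wall Q u g}" "same_side Q (word cs u) (word w u)"
    using chambers_transitive[OF Q] by blast
  have csQ: "set cs \<subseteq> Q" using cs(1) by (auto simp: wall_def)
  have csR: "set (rev cs) \<subseteq> R" "set cs \<subseteq> R" using csQ QR by auto
  \<comment> \<open>u and y are on the same side of every hyperplane through v, so v plus a small multiple of either lies in one chamber\<close>
  define y where "y = word (rev cs) (word w u)"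
  have wu: "word w u \<in> X" using wuR by (simp add: regular_iff)
  have yR: "y \<in> regular X R" unfolding y_def by (rule regular_word[OF reflection_closed_roots csR(1) wuR])
  have yX: "y \<in> X" using yR by (simp add: regular_iff)
  have "same_side Q (word (rev cs) (word cs u)) (word (rev cs) (word w u))"
    by (rule same_side_word[OF Q _ _ _ cs(2)]) (use csQ csR u wu word_in in auto)
  then have uy: "same_side Q u y" using word_rev[OF csR(2) u(1)] by (simp add: y_def)
  have ynz: "b y \<noteq> 0" if "b \<in> R" for b using yR that by (simp add: regular_iff)
  have pu: "\<forall>\<^sub>F t in at_right (0::real). \<forall>b\<in>R.
      sgn (b (v + t *\<^sub>R u)) = (if b v = 0 then sgn (b u) else sgn (b v))"
    by (rule small_perturbation[where V = X]) (use X finite_roots root_functional v(1) u in auto)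
  have py: "\<forall>\<^sub>F t in at_right (0::real). \<forall>b\<in>R.
      sgn (b (v + t *\<^sub>R y)) = (if b v = 0 then sgn (b y) else sgn (b v))"
    by (rule small_perturbation[where V = X]) (use X finite_roots root_functional v(1) yX ynz in auto)
  have "\<exists>t. (\<forall>b\<in>R. sgn (b (v + t *\<^sub>R u)) = (if b v = 0 then sgn (b u) else sgn (b v))) \<and>
      (\<forall>b\<in>R. sgn (b (v + t *\<^sub>R y)) = (if b v = 0 then sgn (b y) else sgn (b v)))"
    using eventually_happens[OF eventually_conj[OF pu py]] trivial_limit_at_right_real by blast
  then obtain t where tu: "\<And>b. b \<in> R \<Longrightarrow> sgn (b (v + t *\<^sub>R u)) = (if b v = 0 then sgn (b u) else sgn (b v))"
    and ty: "\<And>b. b \<in> R \<Longrightarrow> sgn (b (v + t *\<^sub>R y)) = (if b v = 0 then sgn (b y) else sgn (b v))" by blast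
  define p where "p = v + t *\<^sub>R u"
  have pX: "p \<in> X" using v u X by (simp add: p_def subspace_add subspace_scale)
  have sgn: "sgn (b p) = sgn (b (v + t *\<^sub>R y)) \<and> b p \<noteq> 0" if b: "b \<in> R" for b
  proof (cases "b v = 0")
    case True
    then have "b u * b y > 0" using uy b by (simp add: same_side_def Q_def)
    then have "sgn (b u) = sgn (b y)" by (auto simp: zero_less_mult_iff)
    moreover have "sgn (b u) \<noteq> 0" using u(2)[OF b] by (simp add: sgn_zero_iff)
    ultimately show ?thesis using tu[OF b] ty[OF b] True unfolding p_def by (metis sgn_zero)
  next
    case False
    then show ?thesis using tu[OF b] ty[OF b] unfolding p_def by (metis sgn_zero_iff)
  qed
  have pR: "p \<in> regular X R" using pX sgn by (simp add: regular_iff)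
  have fixv: "word ds v = v" if "set ds \<subseteq> Q" for ds
    using that by (induction ds) (auto simp: Q_def refl_def)
  have "word (rev cs @ w) p = word (rev cs) (v + t *\<^sub>R word w u)"
    using word_add[OF wR v(1), of "t *\<^sub>R u"] word_scale[OF wR u(1)] u(1) X wv
    by (simp add: p_def subspace_scale)
  also have "\<dots> = v + t *\<^sub>R y"
    using word_add[OF csR(1) v(1), of "t *\<^sub>R word w u"] word_scale[OF csR(1) wu] wu X fixv[of "rev cs"] csQ
    by (simp add: y_def subspace_scale)
  finally have "word (rev cs @ w) p = v + t *\<^sub>R y" .
  then have "same_side R p (word (rev cs @ w) p)" unfolding same_side_def
    using sgn sgn_eq_imp_mult_pos by (metis mult.commute)
  then have id: "word (rev cs @ w) x = x" if "x \<in> X" for x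
    using word_free[OF reflection_closed_roots pR _ _ that, of "rev cs @ w"] csR wR by simp
  have "word cs x = - refl \<alpha> x" if x: "x \<in> X" for x
  proof -
    have "word cs (word (rev cs) (word w x)) = word w x"
      by (rule word_rev'[OF csR(2) word_in[OF wR x]])
    then show ?thesis using id[OF x] w[OF x] by simp
  qed
  then show ?thesis using csQ by (intro exI[of _ cs]) (auto simp: Q_def v_def)
qed

end


section \<open>The Weyl group and the root system of a hyperplane\<close>

lemma spans_of_separating:
  fixes Y :: "'v::euclidean_space set"
  assumes Y: "subspace Y" and S: "finite S" "\<And>s. s \<in> S \<Longrightarrow> functional_on Y s"
    and sep: "\<And>y. y \<in> Y \<Longrightarrow> (\<And>s. s \<in> S \<Longrightarrow> s y = 0) \<Longrightarrow> y = 0"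
  shows "spans_dual Y S"
  unfolding spans_dual_def
proof
  fix f assume "f \<in> dual_space Y"
  then have "functional_on Y f" by (simp add: dual_space_iff)
  then obtain r where r: "r \<in> Y" "\<And>x. x \<in> Y \<Longrightarrow> f x = r \<bullet> x" using functional_on_inner[OF Y] by metis
  have "\<exists>q. \<forall>s\<in>S. q s \<in> Y \<and> (\<forall>x\<in>Y. s x = q s \<bullet> x)"
  proof (rule bchoice, rule ballI)
    fix s assume "s \<in> S"
    then obtain a where "a \<in> Y" "\<And>x. x \<in> Y \<Longrightarrow> s x = a \<bullet> x"
      using functional_on_inner[OF Y S(2)] by metis
    then show "\<exists>a. a \<in> Y \<and> (\<forall>x\<in>Y. s x = a \<bullet> x)" by blast
  qed
  then obtain q where q: "\<And>s. s \<in> S \<Longrightarrow> q s \<in> Y" "\<And>s x. s \<in> S \<Longrightarrow> x \<in> Y \<Longrightarrow> s x = q s \<bullet> x" by blast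
  obtain y z where y: "y \<in> span (q ` S)"
    and z: "\<And>w. w \<in> span (q ` S) \<Longrightarrow> orthogonal z w" and eq: "r = y + z"
    using orthogonal_subspace_decomp_exists by blast
  have "y \<in> Y" using y q(1) span_minimal[OF _ Y, of "q ` S"] by blast
  moreover have "z = r - y" using eq by simp
  ultimately have zY: "z \<in> Y" using r(1) Y by (simp add: subspace_diff)
  have "z = 0"
  proof (rule sep[OF zY])
    fix s assume s: "s \<in> S"
    have "orthogonal z (q s)" by (rule z, rule span_base, rule imageI, rule s)
    then show "s z = 0" using q(2)[OF s zY] by (simp add: orthogonal_def inner_commute)
  qed
  then have "r \<in> span (q ` S)" using eq y by simp
  then obtain c where c: "r = (\<Sum>s\<in>S. c s *\<^sub>R q s)" using in_span_image[OF S(1)] by blast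
  have "f x = (\<Sum>s\<in>S. c s * s x)" if x: "x \<in> Y" for x
    using r(2)[OF x] q(2)[OF _ x] unfolding c by (simp add: inner_sum_left)
  then show "\<exists>a. \<forall>x\<in>Y. f x = (\<Sum>s\<in>S. a s * s x)" by blast
qed

context spanning_root_system
begin

text \<open>
  The vector \<open>h\<close> that represents \<open>f\<close> is a combination of coroots, so \<open>form h h = f h = 0\<close>.
\<close>
lemma functional_eq_0:
  assumes f: "functional_on X f" and 0: "\<And>\<gamma>. \<gamma> \<in> R \<Longrightarrow> f (cr \<gamma>) = 0" and x: "x \<in> X"
  shows "f x = 0"
proof -
  have "restrict f X \<in> dual_space X" using f X by (simp add: dual_space_iff functional_on_restrict)
  then obtain a where a: "\<forall>x\<in>X. restrict f X x = (\<Sum>\<gamma>\<in>R. a \<gamma> * \<gamma> x)"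
    using spans unfolding spans_dual_def by blast
  define h where "h = coroot_comb R a"
  have h: "h \<in> X" unfolding h_def by (rule coroot_comb_in) simp
  have formh: "form y h = f y" if "y \<in> X" for y
    using form_coroot_comb[of R y a] a that by (simp add: h_def)
  have "f h = 0" unfolding h_def functional_coroot_comb[OF subset_refl f]
    by (rule sum.neutral) (simp add: 0)
  then have "form h h = 0" using formh[OF h] by simp
  then have "h = 0" using form_pos[OF h] by (cases "h = 0") auto
  then show ?thesis using formh[OF x] functional_on_zero[OF functional_form[OF x] X] by simp
qed

lemma refl_coroots:
  assumes "\<beta> \<in> R" "q \<in> coroots X R" shows "refl \<beta> q \<in> coroots X R"
proof -
  obtain \<gamma> where "\<gamma> \<in> R" "q = cr \<gamma>" using assms(2) by (auto simp: coroots_def)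
  then show ?thesis unfolding coroots_def
    using coroot_refl_root[OF assms(1)] refl_root_in[OF assms(1)] by (intro image_eqI[of _ _ "refl_root \<beta> \<gamma>"]) auto
qed

lemma coroots_in: "coroots X R \<subseteq> X" using coroot(1) by (auto simp: coroots_def)

lemma reflection_eq: "reflection X R \<alpha> = restrict (refl \<alpha>) X"
  unfolding reflection_def by (rule restrict_ext) (simp add: refl_def)

lemma restrict_word_Bij: assumes "set bs \<subseteq> R" shows "restrict (word bs) X \<in> Bij X"
proof -
  have "bij_betw (word bs) X X"
    by (rule bij_betw_byWitness[where f' = "word (rev bs)"])
       (use assms word_rev word_rev' word_in[of bs] word_in[of "rev bs"] in auto)
  then show ?thesis by (simp add: Bij_def bij_betw_restrict_eq)
qed

lemma restrict_word_append:
  assumes "set as \<subseteq> R" "set bs \<subseteq> R"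
  shows "restrict (word as) X \<otimes>\<^bsub>BijGroup X\<^esub> restrict (word bs) X = restrict (word (as @ bs)) X"
  using restrict_word_Bij[OF assms(1)] restrict_word_Bij[OF assms(2)] word_in[OF assms(2)]
  by (auto simp: BijGroup_def compose_def restrict_def fun_eq_iff)

lemma restrict_word_Nil: "\<one>\<^bsub>BijGroup X\<^esub> = restrict (word []) X"
  by (auto simp: BijGroup_def)

lemma reflection_word: "reflection X R \<alpha> = restrict (word [\<alpha>]) X"
  by (auto simp: reflection_eq)

lemma word_in_weyl_group:
  assumes "set bs \<subseteq> R" shows "restrict (word bs) X \<in> weyl_group X R"
  using assms
proof (induction bs)
  case Nil
  show ?case unfolding weyl_group_def using generate.one[of "BijGroup X"] by (simp only: restrict_word_Nil)
next
  case (Cons b bs)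
  have "restrict (word [b]) X \<in> weyl_group X R"
    unfolding weyl_group_def using Cons.prems by (intro generate.incl) (auto simp: reflection_word)
  moreover have "restrict (word bs) X \<in> weyl_group X R"
    by (rule Cons.IH) (use Cons.prems in simp)
  ultimately have "restrict (word [b]) X \<otimes>\<^bsub>BijGroup X\<^esub> restrict (word bs) X \<in> weyl_group X R"
    unfolding weyl_group_def by (rule generate.eng)
  moreover have "restrict (word [b]) X \<otimes>\<^bsub>BijGroup X\<^esub> restrict (word bs) X = restrict (word ([b] @ bs)) X"
    by (rule restrict_word_append) (use Cons.prems in auto)
  ultimately show ?case by (simp only: append.simps)
qed

lemma weyl_group_word:
  assumes "w \<in> weyl_group X R" shows "\<exists>bs. set bs \<subseteq> R \<and> w = restrict (word bs) X"
  using assms unfolding weyl_group_def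
proof (induction rule: generate.induct)
  case one
  have "set [] \<subseteq> R" by simp
  then show ?case using restrict_word_Nil by blast
next
  case (incl h)
  then obtain \<alpha> where "\<alpha> \<in> R" "h = restrict (word [\<alpha>]) X" using reflection_word by blast
  moreover from this have "set [\<alpha>] \<subseteq> R" by simp
  ultimately show ?case by blast
next
  case (inv h)
  then obtain \<alpha> where a: "\<alpha> \<in> R" "h = restrict (word [\<alpha>]) X" using reflection_word by blast
  have s: "set [\<alpha>] \<subseteq> R" using a by simp
  have "h \<otimes>\<^bsub>BijGroup X\<^esub> h = restrict (word ([\<alpha>] @ [\<alpha>])) X"
    unfolding a(2) by (rule restrict_word_append[OF s s])
  also have "\<dots> = restrict (word []) X" by (rule restrict_ext) (use a refl_refl in simp)
  also have "\<dots> = \<one>\<^bsub>BijGroup X\<^esub>" by (rule restrict_word_Nil[symmetric])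
  finally have "inv\<^bsub>BijGroup X\<^esub> h = h"
    using restrict_word_Bij[OF s] unfolding a(2)[symmetric]
    by (intro group.inv_equality[OF group_BijGroup]) (simp_all add: BijGroup_def)
  then show ?case using a(2) s by blast
next
  case (eng g h)
  then obtain as bs where w: "set as \<subseteq> R" "g = restrict (word as) X" "set bs \<subseteq> R" "h = restrict (word bs) X"
    by blast
  then have "set (as @ bs) \<subseteq> R" by simp
  moreover have "g \<otimes>\<^bsub>BijGroup X\<^esub> h = restrict (word (as @ bs)) X"
    unfolding w(2,4) by (rule restrict_word_append[OF w(1,3)])
  ultimately show ?case by blast
qed

end

text \<open>
  Let \<open>\<beta>\<close> and \<open>\<gamma>\<close> be roots of the two systems with the same coroot \<open>v\<close>. The product of their reflections is a
  transvection in direction \<open>v\<close> that preserves the finite set of coroots. So \<open>\<beta>\<close> and \<open>\<gamma>\<close> agree on coroots, and these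
  span \<open>X\<close>.
\<close>
lemma roots_of_coroots:
  fixes X :: "'v::euclidean_space set"
  assumes R: "spanning_root_system X R" and R': "spanning_root_system X R'"
    and eq: "coroots X R = coroots X R'"
  shows "R \<subseteq> R'"
proof
  interpret A: spanning_root_system X R by (rule R)
  interpret B: spanning_root_system X R' by (rule R')
  fix \<beta> assume b: "\<beta> \<in> R"
  define v where "v = coroot X R \<beta>"
  have "v \<in> coroots X R'" using b eq by (auto simp: v_def coroots_def)
  then obtain \<gamma> where c: "\<gamma> \<in> R'" "v = coroot X R' \<gamma>" by (auto simp: coroots_def)
  have v: "v \<in> X" "\<beta> v = 2" "\<gamma> v = 2" using A.coroot[OF b] B.coroot[OF c(1)] c(2) by (auto simp: v_def)
  have vn: "v \<noteq> 0" using v(2) functional_on_zero[OF A.root_functional[OF b] A.X] by auto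
  have eqQ: "\<beta> q - \<gamma> q = 0" if q: "q \<in> coroots X R" for q
  proof (rule ccontr)
    define e where "e = \<beta> q - \<gamma> q"
    assume "\<beta> q - \<gamma> q \<noteq> 0"
    then have e: "e \<noteq> 0" by (simp add: e_def)
    have qX: "q \<in> X" using q A.coroots_in by blast
    \<comment> \<open>the orbit of q under the product of the two reflections\<close>
    define s where "s = (\<lambda>k::nat. q + (real k * e) *\<^sub>R v)"
    have s: "s k \<in> X" for k using qX v A.X by (simp add: s_def subspace_add subspace_scale)
    have "s k \<in> coroots X R" for k
    proof (induction k)
      case (Suc k)
      have bs: "\<beta> (s k) = \<beta> q + real k * e * 2" and cs: "\<gamma> (s k) = \<gamma> q + real k * e * 2"
        unfolding s_def using qX v A.X
        by (simp_all add: A.root_add[OF b] A.root_scale[OF b] B.root_add[OF c(1)] B.root_scale[OF c(1)]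
            subspace_scale)
      have "A.refl \<beta> (s k) \<in> coroots X R'" using A.refl_coroots[OF b Suc] eq by simp
      then have m: "B.refl \<gamma> (A.refl \<beta> (s k)) \<in> coroots X R" using B.refl_coroots[OF c(1)] eq by simp
      have 1: "A.refl \<beta> (s k) = s k - \<beta> (s k) *\<^sub>R v" by (simp add: A.refl_def v_def)
      have 2: "\<gamma> (s k - \<beta> (s k) *\<^sub>R v) = \<gamma> (s k) - 2 * \<beta> (s k)"
        using s[of k] v A.X by (simp add: B.root_minus[OF c(1)] B.root_scale[OF c(1)] subspace_scale)
      have "B.refl \<gamma> (A.refl \<beta> (s k)) = s k + (\<beta> (s k) - \<gamma> (s k)) *\<^sub>R v"
      proof -
        have "(\<gamma> (s k) - 2 * \<beta> (s k)) *\<^sub>R v = \<gamma> (s k) *\<^sub>R v - (\<beta> (s k) *\<^sub>R v + \<beta> (s k) *\<^sub>R v)"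
          by (simp add: scaleR_left_diff_distrib scaleR_2[symmetric])
        then show ?thesis
          unfolding 1 B.refl_def 2 c(2)[symmetric] scaleR_left_diff_distrib by (simp only: algebra_simps)
      qed
      also have "\<beta> (s k) - \<gamma> (s k) = e" unfolding bs cs by (simp add: e_def)
      also have "s k + e *\<^sub>R v = s (Suc k)" by (simp add: s_def algebra_simps)
      finally show ?case using m by simp
    qed (use q in \<open>simp add: s_def\<close>)
    then have "range s \<subseteq> coroots X R" by blast
    moreover have "finite (coroots X R)" using A.finite_roots by (simp add: coroots_def)
    ultimately have "finite (range s)" by (rule finite_subset)
    moreover have "inj s" by (rule injI) (use e vn in \<open>simp add: s_def\<close>)
    ultimately show False using finite_imageD infinite_UNIV_nat by blast
  qed
  have f: "functional_on X (\<lambda>x. 1 * \<beta> x - 1 * \<gamma> x)"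
    by (rule functional_on_lincomb[OF A.root_functional[OF b] B.root_functional[OF c(1)]])
  have "\<beta> = \<gamma>"
  proof (rule A.root_eqI[OF b B.root_extensional[OF c(1)]])
    fix x assume x: "x \<in> X"
    have "1 * \<beta> x - 1 * \<gamma> x = 0"
      by (rule A.functional_eq_0[OF f _ x]) (use eqQ in \<open>auto simp: coroots_def\<close>)
    then show "\<beta> x = \<gamma> x" by simp
  qed
  then show "\<beta> \<in> R'" using c by simp
qed

section \<open>The root system of a hyperplane\<close>

text \<open>
  The set \<open>T\<close> of roots orthogonal to \<open>\<alpha>\<close> consists of the roots whose coroots lie in \<open>Y\<close>; their restrictions \<open>S\<close> will be
  the root system of \<open>Y\<close>. Since they vanish on the coroot of \<open>\<alpha>\<close>, they are determined by their
  restrictions.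
\<close>
locale admissible_root = spanning_root_system +
  fixes \<alpha> assumes root: "\<alpha> \<in> R" and minus_one: "(\<lambda>x\<in>X. - x) \<in> weyl_group X R"
begin

definition "Y = root_hyperplane X \<alpha>"
definition "T = {\<beta> \<in> R. \<beta> (cr \<alpha>) = 0}"
definition "S = (\<lambda>\<beta>. restrict \<beta> Y) ` T"

lemma Y_iff: "x \<in> Y \<longleftrightarrow> x \<in> X \<and> \<alpha> x = 0" by (auto simp: Y_def root_hyperplane_def)

lemma subspace_Y: "subspace Y"
  unfolding subspace_def
  using X functional_on_zero[OF root_functional[OF root] X]
  by (auto simp: Y_iff root_add[OF root] root_scale[OF root] subspace_0 subspace_add subspace_scale)

lemma T_iff: assumes "\<beta> \<in> R" shows "\<beta> \<in> T \<longleftrightarrow> cr \<beta> \<in> Y"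
  using orthogonal_commute[OF assms root] assms coroot(1)[OF assms] by (auto simp: T_def Y_iff)

lemma T_R: "\<beta> \<in> T \<Longrightarrow> \<beta> \<in> R" by (simp add: T_def)

text \<open>The projection to \<open>Y\<close> along the coroot of \<open>\<alpha>\<close>.\<close>
definition "proj x = x - (\<alpha> x / 2) *\<^sub>R cr \<alpha>"

lemma proj_in: assumes "x \<in> X" shows "proj x \<in> Y"
proof -
  have "(\<alpha> x / 2) *\<^sub>R cr \<alpha> \<in> X" using coroot(1)[OF root] X by (simp add: subspace_scale)
  then show ?thesis unfolding Y_iff proj_def using assms X coroot(1,2)[OF root]
    by (simp add: subspace_diff root_minus[OF root] root_scale[OF root])
qed

lemma T_proj: assumes "\<beta> \<in> T" "x \<in> X" shows "\<beta> (proj x) = \<beta> x"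
proof -
  have b: "\<beta> \<in> R" "\<beta> (cr \<alpha>) = 0" using assms by (auto simp: T_def)
  have "(\<alpha> x / 2) *\<^sub>R cr \<alpha> \<in> X" using coroot(1)[OF root] X by (simp add: subspace_scale)
  then show ?thesis using assms(2) b coroot(1)[OF root]
    by (simp add: proj_def root_minus[OF b(1)] root_scale[OF b(1)])
qed

lemma restrict_inj: "inj_on (\<lambda>\<beta>. restrict \<beta> Y) T"
proof (rule inj_onI)
  fix \<beta> \<gamma> assume b: "\<beta> \<in> T" and c: "\<gamma> \<in> T" and eq: "restrict \<beta> Y = restrict \<gamma> Y"
  show "\<beta> = \<gamma>"
  proof (rule root_eqI[OF T_R[OF b] root_extensional[OF T_R[OF c]]])
    fix x assume x: "x \<in> X"
    show "\<beta> x = \<gamma> x" using fun_cong[OF eq, of "proj x"] T_proj[OF b x] T_proj[OF c x] proj_in[OF x] by simp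
  qed
qed

lemma refl_root_T: assumes "\<beta> \<in> T" "\<gamma> \<in> T" shows "refl_root \<beta> \<gamma> \<in> T"
proof -
  have "refl \<beta> (cr \<alpha>) = cr \<alpha>" using assms(1) by (simp add: T_def refl_def)
  then show ?thesis using assms refl_root_in coroot(1)[OF root] by (simp add: T_def refl_root_apply)
qed

lemma restrict_reflection:
  assumes "\<beta> \<in> T" "\<gamma> \<in> T"
  shows "dual_reflection Y (restrict \<beta> Y) (cr \<beta>) (restrict \<gamma> Y) = restrict (refl_root \<beta> \<gamma>) Y"
proof -
  have "cr \<beta> \<in> Y" using T_iff T_R assms by blast
  have "\<gamma> x - \<gamma> (cr \<beta>) * \<beta> x = refl_root \<beta> \<gamma> x" if "x \<in> Y" for x
    using functional_refl[OF root_functional[OF T_R[OF assms(2)]] T_R[OF assms(1)], of x] that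
    by (simp add: refl_root_apply Y_iff)
  then show ?thesis using \<open>cr \<beta> \<in> Y\<close> unfolding dual_reflection_def by (intro restrict_ext) simp
qed

lemma root_system_Y: "root_system Y S"
  unfolding root_system_def
proof (intro conjI ballI allI impI)
  show "subspace Y" by (rule subspace_Y)
  show "finite S" using finite_roots by (simp add: S_def T_def)
  show "S \<subseteq> dual_space Y"
  proof
    fix s assume "s \<in> S"
    then obtain \<beta> where b: "\<beta> \<in> T" "s = restrict \<beta> Y" by (auto simp: S_def)
    have "Y \<subseteq> X" by (auto simp: Y_iff)
    then have "functional_on Y \<beta>" by (rule functional_on_subset[OF root_functional[OF T_R[OF b(1)]]])
    then show "s \<in> dual_space Y"
      unfolding b(2) by (simp only: dual_space_iff functional_on_restrict[OF subspace_Y] restrict_extensional simp_thms)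
  qed
  show "(\<lambda>x\<in>Y. 0) \<notin> S"
  proof
    assume "(\<lambda>x\<in>Y. 0) \<in> S"
    then obtain \<beta> where b: "\<beta> \<in> T" "(\<lambda>x\<in>Y. 0) = restrict \<beta> Y" by (auto simp: S_def)
    obtain x where x: "x \<in> X" "\<beta> x \<noteq> 0" using root_nonzero[OF T_R[OF b(1)]] by blast
    show False using fun_cong[OF b(2), of "proj x"] T_proj[OF b(1) x(1)] proj_in[OF x(1)] x(2) by simp
  qed
  fix s assume "s \<in> S"
  then obtain \<beta> where b: "\<beta> \<in> T" "s = restrict \<beta> Y" by (auto simp: S_def)
  note bR = T_R[OF b(1)]
  have v: "cr \<beta> \<in> Y" using T_iff[OF bR] b(1) by blast
  show "\<exists>v\<in>Y. s v = 2 \<and> dual_reflection Y s v ` S \<subseteq> S \<and> (\<forall>\<beta>\<in>S. \<beta> v \<in> \<int>)"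
  proof (intro bexI[of _ "cr \<beta>"] conjI ballI v)
    show "s (cr \<beta>) = 2" using b v coroot(2)[OF bR] by simp
    show "dual_reflection Y s (cr \<beta>) ` S \<subseteq> S"
      using restrict_reflection[OF b(1)] refl_root_T[OF b(1)] b(2) by (auto simp: S_def)
    fix u assume "u \<in> S"
    then obtain \<gamma> where "\<gamma> \<in> T" "u = restrict \<gamma> Y" by (auto simp: S_def)
    then show "u (cr \<beta>) \<in> \<int>" using v coroot(4)[OF bR T_R] by simp
  qed
  fix t assume "(\<lambda>x\<in>Y. t * s x) \<in> S"
  then obtain \<gamma> where c: "\<gamma> \<in> T" "(\<lambda>x\<in>Y. t * s x) = restrict \<gamma> Y" by (auto simp: S_def)
  show "t = 1 \<or> t = -1"
  proof (rule reduced[OF bR T_R[OF c(1)]])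
    fix x assume x: "x \<in> X"
    show "\<gamma> x = t * \<beta> x"
      using fun_cong[OF c(2), of "proj x"] T_proj[OF b(1) x] T_proj[OF c(1) x] proj_in[OF x] b(2) by simp
  qed
qed

text \<open>
  On \<open>Y\<close> the reflection in \<open>Y\<close> is the identity, so \<open>orthogonal_word\<close> produces \<open>-1\<close>.
\<close>
lemma minus_one_word: "\<exists>cs. set cs \<subseteq> T \<and> (\<forall>y\<in>Y. word cs y = - y)"
proof -
  obtain bs where bs: "set bs \<subseteq> R" "(\<lambda>x\<in>X. - x) = restrict (word bs) X"
    using weyl_group_word[OF minus_one] by blast
  have neg: "word bs x = - x" if "x \<in> X" for x using fun_cong[OF bs(2), of x] that by simp
  obtain cs where cs: "set cs \<subseteq> T" "\<forall>x\<in>X. word cs x = - refl \<alpha> x"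
    using orthogonal_word[OF root bs(1) neg] unfolding T_def by blast
  then show ?thesis by (intro exI[of _ cs]) (simp add: Y_iff refl_def)
qed

text \<open>
  A point of \<open>Y\<close> that is killed by \<open>S\<close> is fixed by every word in \<open>T\<close>, in particular by \<open>-1\<close>.
\<close>
lemma spans_Y: "spans_dual Y S"
proof (rule spans_of_separating[OF subspace_Y])
  show "finite S" using finite_roots by (simp add: S_def T_def)
  show "functional_on Y s" if "s \<in> S" for s
    using root_system_Y that by (auto simp: root_system_def dual_space_iff)
  fix y assume y: "y \<in> Y" "\<And>s. s \<in> S \<Longrightarrow> s y = 0"
  have 0: "\<beta> y = 0" if "\<beta> \<in> T" for \<beta> using y(2)[of "restrict \<beta> Y"] that y(1) by (simp add: S_def)
  have fix_y: "word cs y = y" if "set cs \<subseteq> T" for cs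
    using that by (induction cs) (auto simp: refl_def 0)
  obtain cs where "set cs \<subseteq> T" "\<forall>y\<in>Y. word cs y = - y" using minus_one_word by blast
  then have "y = - y" using fix_y[of cs] y(1) by simp
  then have "y + y = 0" by (metis add.right_inverse)
  then show "y = 0" by (simp flip: scaleR_2)
qed

sublocale Y: spanning_root_system Y S
  by unfold_locales (rule root_system_Y, rule spans_Y)

lemma coroot_Y: assumes "\<beta> \<in> T" shows "Y.cr (restrict \<beta> Y) = cr \<beta>"
proof (rule Y.coroot_eqI)
  note bR = T_R[OF assms]
  show v: "cr \<beta> \<in> Y" using T_iff[OF bR] assms by blast
  show "restrict \<beta> Y \<in> S" using assms by (simp add: S_def)
  show "restrict \<beta> Y (cr \<beta>) = 2" using v coroot(2)[OF bR] by simp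
  fix s assume "s \<in> S"
  then obtain \<gamma> where c: "\<gamma> \<in> T" "s = restrict \<gamma> Y" by (auto simp: S_def)
  show "(\<lambda>x\<in>Y. s x - s (cr \<beta>) * restrict \<beta> Y x) \<in> S"
    using restrict_reflection[OF assms c(1)] refl_root_T[OF assms c(1)] c(2)
    by (auto simp: dual_reflection_def S_def)
qed

lemma coroots_Y: "coroots Y S = coroots X R \<inter> Y"
proof -
  have "coroots Y S = Y.cr ` ((\<lambda>\<beta>. restrict \<beta> Y) ` T)" by (simp only: coroots_def S_def[symmetric])
  also have "\<dots> = cr ` T" unfolding image_image by (rule image_cong[OF HOL.refl coroot_Y])
  also have "\<dots> = coroots X R \<inter> Y" unfolding coroots_def using T_iff T_R by blast
  finally show ?thesis .
qed

lemma hyperplane_system_eq: "hyperplane_system X R Y = S"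
  unfolding hyperplane_system_def
proof (rule the_equality)
  show "root_system Y S \<and> spans_dual Y S \<and> coroots Y S = coroots X R \<inter> Y"
    using root_system_Y spans_Y coroots_Y by blast
  fix S' assume S': "root_system Y S' \<and> spans_dual Y S' \<and> coroots Y S' = coroots X R \<inter> Y"
  then have "spanning_root_system Y S'" by unfold_locales auto
  moreover have "spanning_root_system Y S" by unfold_locales
  ultimately show "S' = S" using roots_of_coroots[of Y S S'] roots_of_coroots[of Y S' S] S' coroots_Y by simp
qed

lemma word_Y: "set cs \<subseteq> T \<Longrightarrow> y \<in> Y \<Longrightarrow> Y.word (map (\<lambda>\<beta>. restrict \<beta> Y) cs) y = word cs y \<and> word cs y \<in> Y"
proof (induction cs)
  case (Cons b cs)
  then have b: "b \<in> T" and "set cs \<subseteq> T" by auto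
  note y = conjunct2[OF Cons.IH[OF this(2) Cons.prems(2)]] conjunct1[OF Cons.IH[OF this(2) Cons.prems(2)]]
  have eq: "Y.refl (restrict b Y) (word cs y) = refl b (word cs y)"
    using y(1) by (simp add: Y.refl_def refl_def coroot_Y[OF b])
  have "restrict b Y \<in> S" using b by (simp add: S_def)
  then have "refl b (word cs y) \<in> Y" using Y.refl_in[OF _ y(1), of "restrict b Y"] eq by simp
  then show ?case by (simp only: list.map word_Cons Y.word_Cons y(2) eq simp_thms)
qed simp

lemma admissible_Y: "admissible Y S"
proof -
  obtain cs where cs: "set cs \<subseteq> T" "\<forall>y\<in>Y. word cs y = - y" using minus_one_word by blast
  have "restrict (Y.word (map (\<lambda>\<beta>. restrict \<beta> Y) cs)) Y \<in> weyl_group Y S"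
    by (rule Y.word_in_weyl_group) (use cs in \<open>auto simp: S_def\<close>)
  also have "restrict (Y.word (map (\<lambda>\<beta>. restrict \<beta> Y) cs)) Y = (\<lambda>x\<in>Y. - x)"
    by (rule restrict_ext) (use word_Y[OF cs(1)] cs(2) in simp)
  finally show ?thesis unfolding admissible_def using root_system_Y spans_Y by blast
qed

end


section \<open>The functions m as sums over cones of rays\<close>

definition rays :: "'v::euclidean_space set \<Rightarrow> ('v \<Rightarrow> real) set \<Rightarrow> 'v set \<Rightarrow> 'v set" where
  "rays X R C = dual_basis X (simple_roots X R C) ` simple_roots X R C"

text \<open>
  The sign with the convention \<open>sg 0 = 1\<close>, so that every value is a unit.
\<close>
definition sg :: "real \<Rightarrow> int" where "sg r = (if r < 0 then - 1 else 1)"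

lemma prod_fixed_point_free_involution:
  fixes f :: "'i \<Rightarrow> int"
  assumes "finite N" "\<And>b. b \<in> N \<Longrightarrow> \<tau> b \<in> N" "\<And>b. b \<in> N \<Longrightarrow> \<tau> (\<tau> b) = b" "\<And>b. b \<in> N \<Longrightarrow> \<tau> b \<noteq> b"
    "\<And>b. b \<in> N \<Longrightarrow> f (\<tau> b) = f b" "\<And>b. b \<in> N \<Longrightarrow> f b * f b = 1"
  shows "(\<Prod>b\<in>N. f b) = 1"
  using assms
proof (induction "card N" arbitrary: N rule: less_induct)
  case less
  show ?case
  proof (cases "N = {}")
    case False
    then obtain b where b: "b \<in> N" by blast
    define N' where "N' = N - {b, \<tau> b}"
    have eq: "N = insert b (insert (\<tau> b) N')" using b less.prems(2) by (auto simp: N'_def)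
    have "card N' < card N" unfolding N'_def
      by (rule psubset_card_mono) (use b less.prems(1) in auto)
    moreover have inv: "\<tau> c \<in> N'" if "c \<in> N'" for c
      using that less.prems(2,3) b unfolding N'_def by (metis DiffD1 DiffD2 DiffI insertE insertI1 insertI2 singletonD)
    ultimately have one: "(\<Prod>b\<in>N'. f b) = 1"
      using less.prems(1,3-6) by (intro less.hyps) (auto simp: N'_def)
    have fin: "finite N'" using less.prems(1) by (simp add: N'_def)
    have "(\<Prod>b\<in>N. f b) = f b * (f (\<tau> b) * (\<Prod>b\<in>N'. f b))"
    proof -
      have "b \<notin> insert (\<tau> b) N'" using less.prems(4)[OF b] by (auto simp: N'_def)
      moreover have "\<tau> b \<notin> N'" by (auto simp: N'_def)
      ultimately show ?thesis unfolding eq using fin by simp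
    qed
    then show ?thesis using one less.prems(5,6)[OF b] by simp
  qed simp
qed

text \<open>
  The elements moved by the involution pair off, and each pair contributes a square.
\<close>
lemma prod_involution:
  fixes f :: "'i \<Rightarrow> int"
  assumes B: "finite B" and \<tau>: "\<And>b. b \<in> B \<Longrightarrow> \<tau> b \<in> B" "\<And>b. b \<in> B \<Longrightarrow> \<tau> (\<tau> b) = b"
    and f: "\<And>b. b \<in> B \<Longrightarrow> f (\<tau> b) = f b" "\<And>b. b \<in> B \<Longrightarrow> f b * f b = 1"
  shows "(\<Prod>b\<in>B. f b) = (\<Prod>b\<in>{b \<in> B. \<tau> b = b}. f b)"
proof -
  have "(\<Prod>b\<in>{b \<in> B. \<tau> b \<noteq> b}. f b) = 1"
  proof (rule prod_fixed_point_free_involution[where \<tau> = \<tau>])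
    show "finite {b \<in> B. \<tau> b \<noteq> b}" using B by simp
    fix b assume b: "b \<in> {b \<in> B. \<tau> b \<noteq> b}"
    then show "\<tau> b \<in> {b \<in> B. \<tau> b \<noteq> b}" using \<tau>(1)[of b] \<tau>(2)[of b] by auto
    show "\<tau> (\<tau> b) = b" "\<tau> b \<noteq> b" "f (\<tau> b) = f b" "f b * f b = 1" using b \<tau> f by auto
  qed
  moreover have "(\<Prod>b\<in>B. f b) = (\<Prod>b\<in>{b \<in> B. \<tau> b = b} \<union> {b \<in> B. \<tau> b \<noteq> b}. f b)"
    by (rule prod.cong) auto
  moreover have "\<dots> = (\<Prod>b\<in>{b \<in> B. \<tau> b = b}. f b) * (\<Prod>b\<in>{b \<in> B. \<tau> b \<noteq> b}. f b)"
    by (rule prod.union_disjoint) (use B in auto)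
  ultimately show ?thesis by simp
qed

context based_root_system
begin

text \<open>
  A positive root is a nontrivial combination of simple roots with nonnegative coefficients.
\<close>
lemma chamber_simple:
  assumes y: "y \<in> X" shows "y \<in> chamber_at X R p \<longleftrightarrow> (\<forall>\<alpha>\<in>\<Delta>. \<alpha> y > 0)"
proof
  assume "y \<in> chamber_at X R p"
  then have "\<alpha> p * \<alpha> y > 0" if "\<alpha> \<in> \<Delta>" for \<alpha> using simpleD[OF that] by (auto simp: chamber_at_def)
  then show "\<forall>\<alpha>\<in>\<Delta>. \<alpha> y > 0" using simpleD by (force simp: zero_less_mult_iff)
next
  assume pos: "\<forall>\<alpha>\<in>\<Delta>. \<alpha> y > 0"
  have P: "\<alpha> y > 0" if a: "\<alpha> \<in> P" for \<alpha>
  proof -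
    obtain c where c: "\<forall>\<beta>\<in>\<Delta>. c \<beta> \<ge> 0" "\<forall>x\<in>X. \<alpha> x = (\<Sum>\<beta>\<in>\<Delta>. c \<beta> * \<beta> x)"
      using positive_root_comb[OF a] by blast
    have "\<exists>\<beta>\<in>\<Delta>. c \<beta> \<noteq> 0"
    proof (rule ccontr)
      assume "\<not> ?thesis"
      then have "\<alpha> p = 0" using c(2) pX by (simp add: sum.neutral)
      then show False using a by (simp add: P_def)
    qed
    then obtain \<beta> where b: "\<beta> \<in> \<Delta>" "c \<beta> > 0" using c(1) by force
    have "0 < (\<Sum>\<beta>\<in>\<Delta>. c \<beta> * \<beta> y)"
    proof (rule sum_pos2[OF finite_simple b(1)])
      show "0 < c \<beta> * \<beta> y" using b pos by simp
      show "0 \<le> c \<gamma> * \<gamma> y" if "\<gamma> \<in> \<Delta>" for \<gamma> using that c(1) pos by (simp add: less_imp_le)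
    qed
    then show ?thesis using c(2) y by simp
  qed
  have "\<alpha> p * \<alpha> y > 0" if a: "\<alpha> \<in> R" for \<alpha>
  proof (cases "\<alpha> p > 0")
    case True
    then show ?thesis using P[of \<alpha>] a by (simp add: P_def)
  next
    case False
    then have neg: "\<alpha> p < 0" using p a by (auto simp: regular_iff not_less order_le_less)
    then have "(\<lambda>x\<in>X. - \<alpha> x) \<in> P" using neg_root[OF a] pX by (simp add: P_def)
    from P[OF this] have "\<alpha> y < 0" using y by simp
    then show ?thesis using neg by (rule mult_neg_neg[rotated])
  qed
  then show "y \<in> chamber_at X R p" using y by (simp add: chamber_at_def)
qed

end

context spanning_root_system
begin

lemma chamber_based: assumes "C \<in> chambers X R"
  obtains p where "based_root_system X R p" "C = chamber_at X R p"
proof -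
  obtain p where "p \<in> regular X R" "C = chamber_at X R p"
    using assms chambers_eq[OF X roots_dual] by auto
  moreover have "based_root_system X R p" by unfold_locales (fact calculation(1))
  ultimately show thesis using that by blast
qed

lemma rays_basis:
  assumes C: "C \<in> chambers X R"
  shows "independent (rays X R C)" "span (rays X R C) = X" "finite (rays X R C)" "card (rays X R C) = dim X"
    and "\<And>s. s \<in> rays X R C \<Longrightarrow> \<exists>\<alpha>\<in>R. \<forall>x\<in>X. representation (rays X R C) x s = \<alpha> x"
    and "\<And>x. x \<in> X \<Longrightarrow> (\<forall>s\<in>rays X R C. representation (rays X R C) x s < 0) \<longleftrightarrow> - x \<in> C"
    and "\<And>x l. x \<in> X \<Longrightarrow> l \<in> dual_space X \<Longrightarrow> psi_chamber X R C x l = psi_rays (rays X R C) x l"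
proof -
  obtain p where p: "based_root_system X R p" and Cp: "C = chamber_at X R p"
    using chamber_based[OF C] by blast
  interpret based_root_system X R p by (rule p)
  have \<Delta>: "simple_roots X R C = \<Delta>" by (simp add: Cp \<Delta>_def)
  interpret b: functional_basis X \<Delta> by (rule functional_basis_simple)
  have rays: "rays X R C = b.\<omega> ` \<Delta>" by (simp add: rays_def \<Delta>)
  show "independent (rays X R C)" "span (rays X R C) = X" "finite (rays X R C)" "card (rays X R C) = dim X"
    unfolding rays using b.rays_independent b.rays_span b.fin b.card_basis card_image[OF b.dual_basis_inj] by auto
  show "\<exists>\<alpha>\<in>R. \<forall>x\<in>X. representation (rays X R C) x s = \<alpha> x" if "s \<in> rays X R C" for s
    using that b.rays_representation simpleD unfolding rays by blast
  show "psi_chamber X R C x l = psi_rays (rays X R C) x l" if "x \<in> X" "l \<in> dual_space X" for x l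
    using psi_chamber_eq_psi_rays[of X R C x l] that functional_basis_simple by (simp add: \<Delta> rays_def)
  show "(\<forall>s\<in>rays X R C. representation (rays X R C) x s < 0) \<longleftrightarrow> - x \<in> C" if x: "x \<in> X" for x
  proof -
    have "(\<forall>s\<in>rays X R C. representation (rays X R C) x s < 0) \<longleftrightarrow> (\<forall>\<alpha>\<in>\<Delta>. \<alpha> x < 0)"
      unfolding rays using b.rays_representation[OF x] by auto
    also have "\<dots> \<longleftrightarrow> (\<forall>\<alpha>\<in>\<Delta>. \<alpha> (- x) > 0)"
    proof (rule ball_cong[OF HOL.refl])
      show "\<alpha> x < 0 \<longleftrightarrow> \<alpha> (- x) > 0" if "\<alpha> \<in> \<Delta>" for \<alpha>
        using root_uminus[of \<alpha> x] simpleD[OF that] x by simp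
    qed
    also have "\<dots> \<longleftrightarrow> - x \<in> C" unfolding Cp using chamber_simple[of "- x"] x X by (simp add: subspace_neg)
    finally show ?thesis .
  qed
qed

lemma regular_uminus: assumes "x \<in> regular X R" shows "- x \<in> regular X R"
  unfolding regular_iff
proof (intro conjI ballI)
  have x: "x \<in> X" using assms by (simp add: regular_iff)
  then show "- x \<in> X" using X by (simp add: subspace_neg)
  fix \<alpha> assume "\<alpha> \<in> R"
  then show "\<alpha> (- x) \<noteq> 0" using root_uminus[of \<alpha> x] x assms by (simp add: regular_iff)
qed

lemma chamber_at_in: "x \<in> regular X R \<Longrightarrow> chamber_at X R x \<in> chambers X R"
  using chambers_eq[OF X roots_dual] by blast

lemma fin_chambers: "finite (chambers X R)" by (rule finite_chambers[OF X roots_dual finite_roots])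

text \<open>
  For \<open>l = 0\<close> the only chamber that contributes is the one that contains \<open>- x\<close>.
\<close>
lemma sum_psi_rays_zero:
  assumes x: "x \<in> regular X R"
  shows "(\<Sum>C\<in>chambers X R. f C * psi_rays (rays X R C) x (\<lambda>_. 0)) = (- 1) ^ dim X * f (chamber_at X R (- x))"
proof -
  have xX: "x \<in> X" using x by (simp add: regular_iff)
  have "- x \<in> C \<longleftrightarrow> C = chamber_at X R (- x)" if C: "C \<in> chambers X R" for C
  proof -
    obtain p where p: "p \<in> regular X R" "C = chamber_at X R p" using C chambers_eq[OF X roots_dual] by auto
    show ?thesis using chamber_at_eq_iff[OF p(1) regular_uminus[OF x]] p(2) by simp
  qed
  then have "f C * psi_rays (rays X R C) x (\<lambda>_. 0) =
      (if C = chamber_at X R (- x) then (- 1) ^ dim X * f C else 0)" if "C \<in> chambers X R" for C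
    using psi_rays_zero_functional[OF rays_basis(3)[OF that], of x] rays_basis(4,6)[OF that] xX that by simp
  then have "(\<Sum>C\<in>chambers X R. f C * psi_rays (rays X R C) x (\<lambda>_. 0)) =
      (\<Sum>C\<in>chambers X R. if C = chamber_at X R (- x) then (- 1) ^ dim X * f C else 0)"
    by (rule sum.cong[OF HOL.refl])
  also have "\<dots> = (- 1) ^ dim X * f (chamber_at X R (- x))"
    using chamber_at_in[OF regular_uminus[OF x]] fin_chambers by simp
  finally show ?thesis .
qed

lemma m_fun_eq:
  assumes "x \<in> regular X R" "l \<in> dual_space X"
  shows "m_fun X R x l =
    (\<Sum>C\<in>chambers X R. chamber_sign X R (chamber_at X R x) C * psi_rays (rays X R C) x l)"
  unfolding m_fun_def psi_def chamber_of_eq[OF X roots_dual assms(1)]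
  using rays_basis(7)[OF _ _ assms(2)] assms(1) by (intro sum.cong) (auto simp: regular_iff)

lemma root_hyperplane_eq:
  assumes a: "\<alpha> \<in> R" and b: "\<beta> \<in> R" and eq: "root_hyperplane X \<beta> = root_hyperplane X \<alpha>"
  shows "\<beta> = \<alpha> \<or> \<beta> = (\<lambda>x\<in>X. - \<alpha> x)"
proof (rule proportional_roots[OF b a])
  obtain u where u: "u \<in> X" "\<alpha> u \<noteq> 0" using root_nonzero[OF a] by blast
  have "\<beta> x = (\<beta> u / \<alpha> u) * \<alpha> x" if x: "x \<in> X" for x
    using functional_proportional[where f = \<beta> and g = \<alpha> and u = u and x = x and V = X]
      X root_functional[OF a] root_functional[OF b] u x eq
    by (auto simp: root_hyperplane_def field_simps)
  then show "proportional \<beta> \<alpha>" unfolding proportional_def by blast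
qed

lemma root_hyperplane_neg: "\<alpha> \<in> R \<Longrightarrow> root_hyperplane X (\<lambda>x\<in>X. - \<alpha> x) = root_hyperplane X \<alpha>"
  by (auto simp: root_hyperplane_def)

text \<open>
  A reduced system has exactly one root that is positive at \<open>p\<close> for each root hyperplane.
\<close>
lemma chamber_sign_eq:
  assumes x: "x \<in> regular X R" and y: "y \<in> regular X R" and p: "p \<in> regular X R"
  shows "chamber_sign X R (chamber_at X R x) (chamber_at X R y) = (\<Prod>\<alpha>\<in>{\<alpha> \<in> R. \<alpha> p > 0}. sg (\<alpha> x * \<alpha> y))"
proof -
  have pxy: "p \<in> X" "x \<in> X" "y \<in> X" using p x y by (auto simp: regular_iff)
  have img: "root_hyperplane X ` {\<alpha> \<in> R. \<alpha> x * \<alpha> y < 0} =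
      root_hyperplane X ` {\<alpha> \<in> {\<alpha> \<in> R. \<alpha> p > 0}. \<alpha> x * \<alpha> y < 0}"
  proof (intro subset_antisym subsetI)
    fix H assume "H \<in> root_hyperplane X ` {\<alpha> \<in> R. \<alpha> x * \<alpha> y < 0}"
    then obtain \<alpha> where a: "\<alpha> \<in> R" "\<alpha> x * \<alpha> y < 0" "H = root_hyperplane X \<alpha>" by blast
    show "H \<in> root_hyperplane X ` {\<alpha> \<in> {\<alpha> \<in> R. \<alpha> p > 0}. \<alpha> x * \<alpha> y < 0}"
    proof (cases "\<alpha> p > 0")
      case False
      then have "\<alpha> p < 0" using p a(1) by (auto simp: regular_iff not_less order_le_less)
      then show ?thesis using a neg_root[OF a(1)] root_hyperplane_neg[OF a(1)] pxy
        by (intro image_eqI[of _ _ "\<lambda>x\<in>X. - \<alpha> x"]) auto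
    qed (use a in blast)
  qed blast
  have inj: "inj_on (root_hyperplane X) {\<alpha> \<in> {\<alpha> \<in> R. \<alpha> p > 0}. \<alpha> x * \<alpha> y < 0}"
  proof (rule inj_onI)
    fix \<beta> \<alpha> assume b: "\<beta> \<in> {\<alpha> \<in> {\<alpha> \<in> R. \<alpha> p > 0}. \<alpha> x * \<alpha> y < 0}"
      and a: "\<alpha> \<in> {\<alpha> \<in> {\<alpha> \<in> R. \<alpha> p > 0}. \<alpha> x * \<alpha> y < 0}" and eq: "root_hyperplane X \<beta> = root_hyperplane X \<alpha>"
    have "\<beta> = \<alpha> \<or> \<beta> = (\<lambda>x\<in>X. - \<alpha> x)" by (rule root_hyperplane_eq[OF _ _ eq]) (use a b in auto)
    moreover have "\<beta> p > 0" "\<alpha> p > 0" using a b by auto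
    ultimately show "\<beta> = \<alpha>" using pxy(1) by auto
  qed
  have fin: "finite {\<alpha> \<in> R. \<alpha> p > 0}" using finite_roots by simp
  have "chamber_sign X R (chamber_at X R x) (chamber_at X R y) =
      (- 1) ^ card {\<alpha> \<in> {\<alpha> \<in> R. \<alpha> p > 0}. \<alpha> x * \<alpha> y < 0}"
    unfolding chamber_sign_def separating_hyperplanes_chamber_at[OF x y] img card_image[OF inj] ..
  also have "\<dots> = (\<Prod>\<alpha>\<in>{\<alpha> \<in> {\<alpha> \<in> R. \<alpha> p > 0}. \<alpha> x * \<alpha> y < 0}. - 1)" by simp
  also have "\<dots> = (\<Prod>\<alpha>\<in>{\<alpha> \<in> R. \<alpha> p > 0}. sg (\<alpha> x * \<alpha> y))"
    unfolding sg_def by (rule prod.inter_filter[OF fin])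
  finally show ?thesis .
qed

lemma chamber_sign_mult:
  assumes x: "x \<in> regular X R" and y: "y \<in> regular X R" and z: "z \<in> regular X R"
  shows "chamber_sign X R (chamber_at X R x) (chamber_at X R z) =
    chamber_sign X R (chamber_at X R x) (chamber_at X R y) * chamber_sign X R (chamber_at X R y) (chamber_at X R z)"
  unfolding chamber_sign_eq[OF x z x] chamber_sign_eq[OF x y x] chamber_sign_eq[OF y z x]
    prod.distrib[symmetric]
proof (rule prod.cong[OF HOL.refl])
  fix \<alpha> assume "\<alpha> \<in> {\<alpha> \<in> R. \<alpha> x > 0}"
  then have "\<alpha> x \<noteq> 0" "\<alpha> y \<noteq> 0" "\<alpha> z \<noteq> 0" using x y z by (auto simp: regular_iff)
  then show "sg (\<alpha> x * \<alpha> z) = sg (\<alpha> x * \<alpha> y) * sg (\<alpha> y * \<alpha> z)"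
    by (auto simp: sg_def mult_less_0_iff)
qed

lemma m_fun_eq_0:
  assumes x: "x \<in> regular X R" and l: "l \<in> dual_space X" and pos: "l x > 0"
  shows "m_fun X R x l = 0"
  unfolding m_fun_eq[OF x l]
proof (rule sum.neutral, rule ballI)
  fix C assume C: "C \<in> chambers X R"
  have "psi_rays (rays X R C) x l = 0"
    by (rule psi_rays_eq_0[OF rays_basis(3,1)[OF C]])
       (use rays_basis(2)[OF C] x l pos in \<open>auto simp: regular_iff dual_space_iff\<close>)
  then show "chamber_sign X R (chamber_at X R x) C * psi_rays (rays X R C) x l = 0" by simp
qed

end

section \<open>Restriction of signs to a hyperplane\<close>

context admissible_root
begin

lemma dim_X: "dim X = Suc (dim Y)"
proof -
  note c = coroot(1,2)[OF root]
  have sY: "span Y = Y" using subspace_Y by (simp add: span_eq_iff)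
  have "cr \<alpha> \<notin> Y" using c Y_iff[of "cr \<alpha>"] by simp
  then have "cr \<alpha> \<notin> span Y" unfolding sY .
  then have "dim (insert (cr \<alpha>) Y) = Suc (dim Y)" by (simp add: dim_insert)
  moreover have "span (insert (cr \<alpha>) Y) = X"
  proof
    show "span (insert (cr \<alpha>) Y) \<subseteq> X" by (rule span_minimal) (use c X in \<open>auto simp: Y_iff\<close>)
    show "X \<subseteq> span (insert (cr \<alpha>) Y)"
    proof
      fix x assume "x \<in> X"
      then have "proj x \<in> span (insert (cr \<alpha>) Y)" using proj_in by (intro span_base) simp
      moreover have "(\<alpha> x / 2) *\<^sub>R cr \<alpha> \<in> span (insert (cr \<alpha>) Y)" by (intro span_scale span_base) simp
      ultimately have "proj x + (\<alpha> x / 2) *\<^sub>R cr \<alpha> \<in> span (insert (cr \<alpha>) Y)" by (rule span_add)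
      then show "x \<in> span (insert (cr \<alpha>) Y)" by (simp add: proj_def)
    qed
  qed
  ultimately show ?thesis by (metis dim_span)
qed

lemma root_hyperplane_zero: "root_hyperplane X \<beta> = Y \<Longrightarrow> y \<in> Y \<Longrightarrow> \<beta> y = 0"
  unfolding root_hyperplane_def by blast

text \<open>
  Here \<open>x\<close> and \<open>q\<close> are close to the points \<open>y\<close> and \<open>z\<close> of \<open>Y\<close>, so a hyperplane other than \<open>Y\<close> separates \<open>x\<close> from
  \<open>q\<close> if and only if it separates \<open>y\<close> from \<open>z\<close>. The reflection in \<open>\<alpha>\<close> fixes \<open>y\<close> and \<open>z\<close> and permutes
  these hyperplanes. Those that it moves cancel in pairs, and those that it fixes belong to the roots
  orthogonal to \<open>\<alpha>\<close>.
\<close>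
lemma chamber_sign_restrict:
  assumes x: "x \<in> regular X R" "\<alpha> x > 0" and y: "y \<in> Y"
    and xy: "\<And>\<beta>. \<beta> \<in> R \<Longrightarrow> root_hyperplane X \<beta> \<noteq> Y \<Longrightarrow> \<beta> x * \<beta> y > 0"
    and q: "q \<in> regular X R" and z: "z \<in> Y"
    and qz: "\<And>\<beta>. \<beta> \<in> R \<Longrightarrow> root_hyperplane X \<beta> \<noteq> Y \<Longrightarrow> \<beta> q * \<beta> z > 0"
  shows "chamber_sign X R (chamber_at X R x) (chamber_at X R q) =
    sg (\<alpha> q) * chamber_sign Y S (chamber_at Y S y) (chamber_at Y S z)"
proof -
  have X': "x \<in> X" "y \<in> X" "q \<in> X" "z \<in> X" "\<alpha> y = 0" "\<alpha> z = 0" using x q y z by (auto simp: regular_iff Y_iff)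
  \<comment> \<open>the positive roots at x other than \<alpha> are exactly the roots that are positive at y\<close>
  define B where "B = {\<beta> \<in> R. \<beta> x > 0} - {\<alpha>}"
  have B: "\<beta> \<in> B \<longleftrightarrow> \<beta> \<in> R \<and> \<beta> y > 0" for \<beta>
  proof
    assume b: "\<beta> \<in> B"
    have "root_hyperplane X \<beta> \<noteq> Y"
    proof
      assume "root_hyperplane X \<beta> = Y"
      then have "\<beta> = \<alpha> \<or> \<beta> = (\<lambda>x\<in>X. - \<alpha> x)"
        using root_hyperplane_eq[OF root, of \<beta>] b by (auto simp: B_def Y_def)
      then show False using b x(2) X' by (auto simp: B_def)
    qed
    then show "\<beta> \<in> R \<and> \<beta> y > 0" using xy[of \<beta>] b by (auto simp: B_def zero_less_mult_iff)
  next
    assume b: "\<beta> \<in> R \<and> \<beta> y > 0"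
    then have "root_hyperplane X \<beta> \<noteq> Y" using root_hyperplane_zero[OF _ y, of \<beta>] by (metis less_irrefl)
    then show "\<beta> \<in> B" using xy[of \<beta>] b X' by (auto simp: B_def zero_less_mult_iff)
  qed
  have Bh: "root_hyperplane X \<beta> \<noteq> Y" if "\<beta> \<in> B" for \<beta>
    using that root_hyperplane_zero[OF _ y, of \<beta>] unfolding B by (metis less_irrefl)
  have zT: "\<beta> z \<noteq> 0" if "\<beta> \<in> B" for \<beta> using qz[OF _ Bh[OF that]] that by (auto simp: B)
  have fixed: "refl \<alpha> y = y" "refl \<alpha> z = z" using X' by (auto simp: refl_def)
  have "chamber_sign X R (chamber_at X R x) (chamber_at X R q) = (\<Prod>\<beta>\<in>{\<beta> \<in> R. \<beta> x > 0}. sg (\<beta> x * \<beta> q))"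
    by (rule chamber_sign_eq[OF x(1) q x(1)])
  also have "\<dots> = sg (\<alpha> x * \<alpha> q) * (\<Prod>\<beta>\<in>B. sg (\<beta> x * \<beta> q))"
    unfolding B_def using finite_roots root x(2) by (intro prod.remove) auto
  also have "sg (\<alpha> x * \<alpha> q) = sg (\<alpha> q)" using x(2) by (simp add: sg_def mult_less_0_iff)
  also have "(\<Prod>\<beta>\<in>B. sg (\<beta> x * \<beta> q)) = (\<Prod>\<beta>\<in>B. sg (\<beta> z))"
  proof (rule prod.cong[OF HOL.refl])
    fix \<beta> assume b: "\<beta> \<in> B"
    have "\<beta> q * \<beta> z > 0" "\<beta> x > 0" using qz[OF _ Bh[OF b]] b B by (auto simp: B_def)
    then show "sg (\<beta> x * \<beta> q) = sg (\<beta> z)" by (auto simp: sg_def mult_less_0_iff zero_less_mult_iff)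
  qed
  also have "\<dots> = (\<Prod>\<beta>\<in>{\<beta> \<in> B. refl_root \<alpha> \<beta> = \<beta>}. sg (\<beta> z))"
  proof (rule prod_involution)
    show "finite B" using finite_roots by (simp add: B_def)
    fix \<beta> assume b: "\<beta> \<in> B"
    then have bR: "\<beta> \<in> R" by (simp add: B)
    show "refl_root \<alpha> \<beta> \<in> B"
      using b refl_root_in[OF root bR] fixed X' by (simp add: B refl_root_apply)
    show "refl_root \<alpha> (refl_root \<alpha> \<beta>) = \<beta>" by (rule refl_root_refl_root[OF root bR])
    show "sg (refl_root \<alpha> \<beta> z) = sg (\<beta> z)" using fixed X' by (simp add: refl_root_apply)
    show "sg (\<beta> z) * sg (\<beta> z) = 1" by (simp add: sg_def)
  qed
  also have "{\<beta> \<in> B. refl_root \<alpha> \<beta> = \<beta>} = {\<beta> \<in> T. \<beta> y > 0}"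
  proof -
    have "refl_root \<alpha> \<beta> = \<beta> \<longleftrightarrow> \<beta> (cr \<alpha>) = 0" if bR: "\<beta> \<in> R" for \<beta>
    proof
      note c = coroot(1,2)[OF root]
      assume "refl_root \<alpha> \<beta> = \<beta>"
      from fun_cong[OF this, of "cr \<alpha>"] show "\<beta> (cr \<alpha>) = 0"
        using functional_refl[OF root_functional[OF bR] root c(1)] c by (simp add: refl_root_apply)
    next
      assume 0: "\<beta> (cr \<alpha>) = 0"
      show "refl_root \<alpha> \<beta> = \<beta>"
      proof (rule root_eqI[OF refl_root_in[OF root bR] root_extensional[OF bR]])
        fix x assume x: "x \<in> X"
        show "refl_root \<alpha> \<beta> x = \<beta> x"
          using functional_refl[OF root_functional[OF bR] root x] 0 x by (simp add: refl_root_apply)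
      qed
    qed
    then show ?thesis unfolding B T_def by blast
  qed
  also have "(\<Prod>\<beta>\<in>{\<beta> \<in> T. \<beta> y > 0}. sg (\<beta> z)) = chamber_sign Y S (chamber_at Y S y) (chamber_at Y S z)"
  proof -
    have nzT: "\<beta> y \<noteq> 0 \<and> \<beta> z \<noteq> 0" if t: "\<beta> \<in> T" for \<beta>
    proof -
      have bR: "\<beta> \<in> R" using T_R[OF t] .
      have "root_hyperplane X \<beta> \<noteq> Y"
      proof
        assume "root_hyperplane X \<beta> = Y"
        then have "\<beta> = \<alpha> \<or> \<beta> = (\<lambda>x\<in>X. - \<alpha> x)" using root_hyperplane_eq[OF root bR] by (simp add: Y_def)
        then show False using t coroot(1,2)[OF root] by (auto simp: T_def)
      qed
      then show ?thesis using xy[OF bR] qz[OF bR] by force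
    qed
    have reg: "y \<in> regular Y S" "z \<in> regular Y S"
      using y z nzT by (auto simp: regular_iff S_def)
    have set: "{\<sigma> \<in> S. \<sigma> y > 0} = (\<lambda>\<beta>. restrict \<beta> Y) ` {\<beta> \<in> T. \<beta> y > 0}"
      unfolding S_def using y by auto
    have inj: "inj_on (\<lambda>\<beta>. restrict \<beta> Y) {\<beta> \<in> T. \<beta> y > 0}"
      by (rule inj_on_subset[OF restrict_inj]) auto
    have "chamber_sign Y S (chamber_at Y S y) (chamber_at Y S z) = (\<Prod>\<sigma>\<in>{\<sigma> \<in> S. \<sigma> y > 0}. sg (\<sigma> y * \<sigma> z))"
      by (rule Y.chamber_sign_eq[OF reg reg(1)])
    also have "\<dots> = (\<Prod>\<beta>\<in>{\<beta> \<in> T. \<beta> y > 0}. sg (restrict \<beta> Y y * restrict \<beta> Y z))"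
      unfolding set prod.reindex[OF inj] o_def ..
    also have "\<dots> = (\<Prod>\<beta>\<in>{\<beta> \<in> T. \<beta> y > 0}. sg (\<beta> z))"
      using y z by (intro prod.cong) (auto simp: sg_def mult_less_0_iff)
    finally show ?thesis by simp
  qed
  finally show ?thesis .
qed

end


section \<open>Wall crossing and uniqueness\<close>

context admissible_root
begin

text \<open>
  Passing from \<open>x\<close> to \<open>x'\<close> reverses all chamber signs, so the sum on the left is the jump of
  a single sum with fixed signs, and \<open>wall_crossing_sum\<close> expresses it by facets in \<open>Y\<close>. The asserted equality is
  then a linear relation between cones in \<open>Y\<close>. It is enough to verify it for \<open>l = 0\<close>. There both sides are single
  chamber signs: the facets give the difference of the signs at two points \<open>- p\<close> and \<open>- q\<close> close to \<open>- z\<close> on the two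
  sides of \<open>Y\<close>, and by \<open>chamber_sign_restrict\<close> these are opposite to each other and equal, up to sign, to the sign in \<open>Y\<close>.
\<close>
theorem m_fun_wall_crossing:
  assumes x: "x \<in> regular X R" "\<alpha> x > 0" and x': "x' \<in> regular X R" "\<alpha> x' < 0"
    and sep: "\<And>\<beta>. \<beta> \<in> R \<Longrightarrow> \<beta> x * \<beta> x' < 0 \<Longrightarrow> root_hyperplane X \<beta> = Y"
    and y: "y \<in> Y" "y \<in> closed_segment x x'" and l: "l \<in> dual_space X"
  shows "m_fun X R x l + m_fun X R x' l = 2 * m_fun Y S y (restrict l Y)" and "y \<in> regular Y S"
proof -
  have xX: "x \<in> X" "x' \<in> X" using x x' by (auto simp: regular_iff)
  have YX: "Y \<subseteq> X" by (auto simp: Y_iff)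
  have lf: "functional_on X l" using l by (simp add: dual_space_iff)
  have side: "\<beta> x * \<beta> y > 0 \<and> \<beta> x' * \<beta> y > 0" if b: "\<beta> \<in> R" "root_hyperplane X \<beta> \<noteq> Y" for \<beta>
  proof -
    obtain u where u: "0 \<le> u" "u \<le> 1" "y = (1 - u) *\<^sub>R x + u *\<^sub>R x'"
      using y(2) by (auto simp: closed_segment_def)
    have by_eq: "\<beta> y = (1 - u) * \<beta> x + u * \<beta> x'"
      unfolding u(3) using xX X by (simp add: root_add[OF b(1)] root_scale[OF b(1)] subspace_scale)
    have "\<beta> x \<noteq> 0" "\<beta> x' \<noteq> 0" using x x' b by (auto simp: regular_iff)
    moreover have "\<not> \<beta> x * \<beta> x' < 0" using sep b by blast
    ultimately consider "\<beta> x > 0" "\<beta> x' > 0" | "\<beta> x < 0" "\<beta> x' < 0"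
      by (auto simp: mult_less_0_iff not_less order_le_less)
    then show ?thesis
    proof cases
      case 1
      then have "\<beta> y > 0" unfolding by_eq using u
        by (cases "u = 0") (auto intro: add_nonneg_pos simp: mult_pos_pos)
      then show ?thesis using 1 by simp
    next
      case 2
      then have "- \<beta> y > 0" unfolding by_eq using u mult_nonneg_nonpos[of "1 - u" "\<beta> x"] mult_pos_neg[of u "\<beta> x'"]
        by (cases "u = 0") auto
      then show ?thesis using 2 by (simp add: mult_neg_neg)
    qed
  qed
  have van: "root_hyperplane X \<beta> = Y \<Longrightarrow> \<forall>z\<in>Y. \<beta> z = 0" for \<beta> using root_hyperplane_zero by blast
  have T_off: "root_hyperplane X \<beta> \<noteq> Y" if t: "\<beta> \<in> T" for \<beta>
  proof
    assume "root_hyperplane X \<beta> = Y"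
    then have "\<beta> = \<alpha> \<or> \<beta> = (\<lambda>x\<in>X. - \<alpha> x)" using root_hyperplane_eq[OF root T_R[OF t]] by (simp add: Y_def)
    then show False using t coroot(1,2)[OF root] by (auto simp: T_def)
  qed
  have regY: "z \<in> regular Y S"
    if z: "z \<in> Y" "\<And>\<beta>. \<beta> \<in> R \<Longrightarrow> root_hyperplane X \<beta> \<noteq> Y \<Longrightarrow> \<beta> z \<noteq> 0" for z
    using z T_off T_R by (auto simp: regular_iff S_def)
  have y_off: "\<beta> y \<noteq> 0" if "\<beta> \<in> R" "root_hyperplane X \<beta> \<noteq> Y" for \<beta> using side[OF that] by auto
  show yreg: "y \<in> regular Y S" using regY[of y] y(1) y_off by blast
  define n where "n = chamber_sign X R (chamber_at X R x)"
  define ny where "ny = chamber_sign Y S (chamber_at Y S y)"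
  \<comment> \<open>p and z are on the same side of every root hyperplane other than Y\<close>
  define near where "near p z \<longleftrightarrow> p \<in> X \<and> (\<forall>\<beta>\<in>R. root_hyperplane X \<beta> \<noteq> Y \<longrightarrow> \<beta> p * \<beta> z > 0)" for p z
  have near_x: "near x y" "near x' y" using side xX by (auto simp: near_def)
  have n_eq: "n (chamber_at X R q) = sg (\<alpha> q) * ny (chamber_at Y S z)"
    if "q \<in> regular X R" "z \<in> Y" "near q z" for q z
    unfolding n_def ny_def
  proof (rule chamber_sign_restrict[OF x y(1) _ that(1,2)])
    show "\<beta> x * \<beta> y > 0" if "\<beta> \<in> R" "root_hyperplane X \<beta> \<noteq> Y" for \<beta> using side[OF that] by blast
    show "\<beta> q * \<beta> z > 0" if "\<beta> \<in> R" "root_hyperplane X \<beta> \<noteq> Y" for \<beta>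
      using \<open>near q z\<close> that unfolding near_def by blast
  qed
  have flip: "chamber_sign X R (chamber_at X R x') C = - n C" if C: "C \<in> chambers X R" for C
  proof -
    obtain q where q: "q \<in> regular X R" "C = chamber_at X R q" using C chambers_eq[OF X roots_dual] by auto
    have s1: "chamber_sign X R (chamber_at X R x) (chamber_at X R x) = 1"
      unfolding chamber_sign_eq[OF x(1) x(1) x(1)] by (rule prod.neutral) (auto simp: sg_def mult_less_0_iff)
    have "n (chamber_at X R x') = - ny (chamber_at Y S y)"
      using n_eq[OF x'(1) y(1) near_x(2)] x'(2) by (simp add: sg_def)
    moreover have "n (chamber_at X R x) = ny (chamber_at Y S y)"
      using n_eq[OF x(1) y(1) near_x(1)] x(2) by (simp add: sg_def)
    ultimately have "n (chamber_at X R x') = - 1" using s1 by (simp add: n_def)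
    moreover have "n C = n (chamber_at X R x') * chamber_sign X R (chamber_at X R x') C"
      unfolding n_def q(2) by (rule chamber_sign_mult[OF x(1) x'(1) q(1)])
    ultimately show ?thesis by simp
  qed
  obtain K' n' T' where K': "K' \<subseteq> chambers X R"
    and T': "\<forall>k\<in>K'. independent (T' k) \<and> span (T' k) = Y \<and> T' k \<subseteq> rays X R k"
    and cross: "\<forall>p\<in>X. \<forall>q\<in>X. \<forall>z\<in>Y. \<forall>l. \<alpha> p > 0 \<longrightarrow> \<alpha> q < 0 \<longrightarrow>
       adjacent_along (chambers X R) (rays X R) Y z p \<longrightarrow> adjacent_along (chambers X R) (rays X R) Y z q \<longrightarrow>
       (\<Sum>k\<in>chambers X R. n k * psi_rays (rays X R k) p l) - (\<Sum>k\<in>chambers X R. n k * psi_rays (rays X R k) q l) =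
       (\<Sum>k\<in>K'. n' k * psi_rays (T' k) z l)"
  proof -
    have "\<alpha> x \<noteq> 0" using x by simp
    have "Y = {x \<in> X. \<alpha> x = 0}" by (auto simp: Y_iff)
    from wall_crossing_sum[where n = n and S = "rays X R", OF X fin_chambers rays_basis(1) rays_basis(2)
        root_functional[OF root] xX(1) \<open>\<alpha> x \<noteq> 0\<close> this]
    show thesis using that by blast
  qed
  have along: "adjacent_along (chambers X R) (rays X R) Y z p"
    if z: "z \<in> Y" and p: "near p z" for z p
    unfolding adjacent_along_def
  proof (intro ballI)
    fix C s assume C: "C \<in> chambers X R" and s: "s \<in> rays X R C"
    obtain \<beta> where b: "\<beta> \<in> R" "\<forall>x\<in>X. representation (rays X R C) x s = \<beta> x"
      using rays_basis(5)[OF C s] by blast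
    show "representation (rays X R C) p s * representation (rays X R C) z s > 0 \<or>
        (\<forall>x\<in>Y. representation (rays X R C) x s = 0)"
    proof (cases "root_hyperplane X \<beta> = Y")
      case True
      then have "\<forall>x\<in>Y. representation (rays X R C) x s = 0" using van b(2) YX by (metis subsetD)
      then show ?thesis ..
    next
      case False
      then have "\<beta> p * \<beta> z > 0" "p \<in> X" "z \<in> X" using p b(1) z YX unfolding near_def by blast+
      then show ?thesis using b(2) by simp
    qed
  qed
  have lhs: "m_fun X R x l + m_fun X R x' l = (\<Sum>k\<in>K'. n' k * psi_rays (T' k) y l)"
  proof -
    have "m_fun X R x l + m_fun X R x' l =
       (\<Sum>k\<in>chambers X R. n k * psi_rays (rays X R k) x l) - (\<Sum>k\<in>chambers X R. n k * psi_rays (rays X R k) x' l)"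
      unfolding m_fun_eq[OF x(1) l] m_fun_eq[OF x'(1) l] n_def[symmetric] using flip by (simp add: sum_negf)
    also have "\<dots> = (\<Sum>k\<in>K'. n' k * psi_rays (T' k) y l)"
      by (rule cross[rule_format, OF xX y(1) x(2) x'(2) along[OF y(1) near_x(1)] along[OF y(1) near_x(2)]])
    finally show ?thesis .
  qed
  have rhs: "m_fun Y S y (restrict l Y) = (\<Sum>D\<in>chambers Y S. ny D * psi_rays (rays Y S D) y l)"
  proof -
    have "restrict l Y \<in> dual_space Y"
      using functional_on_restrict[OF subspace_Y] functional_on_subset[OF lf YX] by (simp add: dual_space_iff)
    then have "m_fun Y S y (restrict l Y) = (\<Sum>D\<in>chambers Y S. ny D * psi_rays (rays Y S D) y (restrict l Y))"
      unfolding ny_def by (rule Y.m_fun_eq[OF yreg])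
    also have "\<dots> = (\<Sum>D\<in>chambers Y S. ny D * psi_rays (rays Y S D) y l)"
    proof (rule sum.cong[OF HOL.refl])
      fix D assume "D \<in> chambers Y S"
      then have "rays Y S D \<subseteq> Y" using Y.rays_basis(2) span_base by blast
      then have "psi_rays (rays Y S D) y (restrict l Y) = psi_rays (rays Y S D) y l"
        by (intro psi_rays_cong) auto
      then show "ny D * psi_rays (rays Y S D) y (restrict l Y) = ny D * psi_rays (rays Y S D) y l" by simp
    qed
    finally show ?thesis .
  qed
  define A where "A = {\<beta> \<in> R. root_hyperplane X \<beta> \<noteq> Y}"
  have zero: "(\<Sum>k\<in>K'. n' k * psi_rays (T' k) z (\<lambda>_. 0)) =
      2 * (\<Sum>D\<in>chambers Y S. ny D * psi_rays (rays Y S D) z (\<lambda>_. 0))"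
    if z: "z \<in> Y" and zA: "\<And>\<beta>. \<beta> \<in> A \<Longrightarrow> \<beta> z \<noteq> 0" for z
  proof -
    have zX: "z \<in> X" using z YX by blast
    have mxX: "- x \<in> X" using xX X by (simp add: subspace_neg)
    have xnz: "\<beta> x \<noteq> 0" and mxnz: "\<beta> (- x) \<noteq> 0" if "\<beta> \<in> R" for \<beta>
      using x(1) that root_uminus[OF that xX(1)] by (auto simp: regular_iff)
    obtain s where s: "\<And>\<beta>. \<beta> \<in> R \<Longrightarrow> sgn (\<beta> (z + s *\<^sub>R x)) = (if \<beta> z = 0 then sgn (\<beta> x) else sgn (\<beta> z))"
      using small_perturbation_ex[OF X finite_roots root_functional zX xX(1)] xnz by metis
    obtain r where r: "\<And>\<beta>. \<beta> \<in> R \<Longrightarrow> sgn (\<beta> (z + r *\<^sub>R - x)) = (if \<beta> z = 0 then sgn (\<beta> (- x)) else sgn (\<beta> z))"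
      using small_perturbation_ex[OF X finite_roots root_functional zX mxX] mxnz by metis
    define p where "p = z + s *\<^sub>R x"
    define q where "q = z + r *\<^sub>R - x"
    have pq: "p \<in> X" "q \<in> X" using zX xX mxX X by (auto simp: p_def q_def subspace_add subspace_diff subspace_scale)
    have nzp: "\<beta> p \<noteq> 0" and nzq: "\<beta> q \<noteq> 0" if b: "\<beta> \<in> R" for \<beta>
      using arg_cong[OF s[OF b], of "\<lambda>a. a = 0"] arg_cong[OF r[OF b], of "\<lambda>a. a = 0"] xnz[OF b] mxnz[OF b]
      unfolding p_def[symmetric] q_def[symmetric]
      by (auto simp: sgn_zero_iff split: if_splits)
    have preg: "p \<in> regular X R" and qreg: "q \<in> regular X R"
      using pq nzp nzq by (auto simp: regular_iff)
    have "\<alpha> z = 0" using z by (simp add: Y_iff)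
    then have "sgn (\<alpha> p) = sgn (\<alpha> x)" "sgn (\<alpha> q) = sgn (- \<alpha> x)"
      using s[OF root] r[OF root] root_uminus[OF root xX(1)] by (simp_all add: p_def q_def)
    then have ap: "\<alpha> p > 0" and aq: "\<alpha> q < 0" using x(2) by (simp_all add: sgn_1_pos sgn_1_neg)
    have pz: "near p z" unfolding near_def
    proof (intro conjI ballI impI pq)
      fix \<beta> assume b: "\<beta> \<in> R" "root_hyperplane X \<beta> \<noteq> Y"
      then have z0: "\<beta> z \<noteq> 0" using zA[of \<beta>] by (simp add: A_def)
      then show "\<beta> p * \<beta> z > 0" using s[OF b(1)] by (intro sgn_eq_imp_mult_pos) (simp add: p_def)
    qed
    have qz: "near q z" unfolding near_def
    proof (intro conjI ballI impI pq)
      fix \<beta> assume b: "\<beta> \<in> R" "root_hyperplane X \<beta> \<noteq> Y"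
      then have z0: "\<beta> z \<noteq> 0" using zA[of \<beta>] by (simp add: A_def)
      then show "\<beta> q * \<beta> z > 0" using r[OF b(1)] by (intro sgn_eq_imp_mult_pos) (simp add: q_def)
    qed
    have mz: "- z \<in> Y" using z subspace_Y by (simp add: subspace_neg)
    have near_neg: "near (- u) (- z)" if u: "near u z" for u
      unfolding near_def
    proof (intro conjI ballI impI)
      have uX: "u \<in> X" using u by (simp add: near_def)
      then show "- u \<in> X" using X by (simp add: subspace_neg)
      fix \<beta> assume b: "\<beta> \<in> R" "root_hyperplane X \<beta> \<noteq> Y"
      then have "\<beta> u * \<beta> z > 0" using u by (simp add: near_def)
      then show "\<beta> (- u) * \<beta> (- z) > 0"
        unfolding root_uminus[OF b(1) uX] root_uminus[OF b(1) zX] by simp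
    qed
    have np: "n (chamber_at X R (- p)) = - ny (chamber_at Y S (- z))"
      using n_eq[OF regular_uminus[OF preg] mz near_neg[OF pz]] ap root_uminus[OF root pq(1)] by (simp add: sg_def)
    have nq: "n (chamber_at X R (- q)) = ny (chamber_at Y S (- z))"
      using n_eq[OF regular_uminus[OF qreg] mz near_neg[OF qz]] aq root_uminus[OF root pq(2)] by (simp add: sg_def)
    have zreg: "z \<in> regular Y S" using regY[of z] z zA unfolding A_def by blast
    have "(\<Sum>k\<in>K'. n' k * psi_rays (T' k) z (\<lambda>_. 0)) =
       (\<Sum>k\<in>chambers X R. n k * psi_rays (rays X R k) p (\<lambda>_. 0)) -
       (\<Sum>k\<in>chambers X R. n k * psi_rays (rays X R k) q (\<lambda>_. 0))"
      using cross[rule_format, OF pq z ap aq along[OF z pz] along[OF z qz]] by simp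
    also have "\<dots> = (- 1) ^ dim X * n (chamber_at X R (- p)) - (- 1) ^ dim X * n (chamber_at X R (- q))"
      unfolding sum_psi_rays_zero[OF preg] sum_psi_rays_zero[OF qreg] ..
    also have "\<dots> = 2 * ((- 1) ^ dim Y * ny (chamber_at Y S (- z)))"
      unfolding np nq dim_X by simp
    also have "\<dots> = 2 * (\<Sum>D\<in>chambers Y S. ny D * psi_rays (rays Y S D) z (\<lambda>_. 0))"
      unfolding Y.sum_psi_rays_zero[OF zreg] ..
    finally show ?thesis .
  qed
  \<comment> \<open>the relation: facets of chambers of R, minus twice the chambers of the root system of Y\<close>
  define N where "N = case_sum n' (\<lambda>D. - 2 * ny D)"
  define F where "F = case_sum T' (rays Y S)"
  have split: "(\<Sum>k\<in>K' <+> chambers Y S. N k * psi_rays (F k) z f) =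
      (\<Sum>k\<in>K'. n' k * psi_rays (T' k) z f) - 2 * (\<Sum>D\<in>chambers Y S. ny D * psi_rays (rays Y S D) z f)" for z f
    using finite_subset[OF K' fin_chambers] Y.fin_chambers
    by (simp add: sum.Plus N_def F_def sum_distrib_left sum_negf mult.assoc)
  have "(\<Sum>k\<in>K' <+> chambers Y S. N k * psi_rays (F k) y l) = 0"
  proof (rule psi_rays_linear_relation[where V = Y and A = A])
    show "subspace Y" by (rule subspace_Y)
    show "finite (K' <+> chambers Y S)" using finite_subset[OF K' fin_chambers] Y.fin_chambers by simp
    show "independent (F k)" "span (F k) = Y" if "k \<in> K' <+> chambers Y S" for k
      using that T' Y.rays_basis(1,2) by (auto simp: F_def)
    show "finite A" using finite_roots by (simp add: A_def)
    show "functional_on Y a" if "a \<in> A" for a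
      using that root_functional functional_on_subset[OF _ YX] by (auto simp: A_def)
    show "(\<Sum>k\<in>K' <+> chambers Y S. N k * psi_rays (F k) z (\<lambda>_. 0)) = 0"
      if "z \<in> Y" "\<And>a. a \<in> A \<Longrightarrow> a z \<noteq> 0" for z
      unfolding split using zero[of z] that by simp
    show "functional_on Y l" by (rule functional_on_subset[OF lf YX])
    show "y \<in> Y" by (rule y(1))
    show "a y \<noteq> 0" if "a \<in> A" for a using y_off that by (auto simp: A_def)
    fix k s assume "k \<in> K' <+> chambers Y S" and s: "s \<in> F k"
    then consider (old) C where "C \<in> K'" "k = Inl C" | (new) D where "D \<in> chambers Y S" "k = Inr D" by blast
    then show "representation (F k) y s \<noteq> 0"
    proof cases
      case old
      have C: "C \<in> chambers X R" using old K' by blast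
      have sT: "s \<in> T' C" using s old by (simp add: F_def)
      then have sR: "s \<in> rays X R C" and sY: "s \<in> Y" using T' old span_base by blast+
      have yT: "y \<in> span (T' C)" using T' old y(1) by blast
      obtain \<beta> where b: "\<beta> \<in> R" "\<forall>x\<in>X. representation (rays X R C) x s = \<beta> x"
        using rays_basis(5)[OF C sR] by blast
      have eq: "representation (rays X R C) y = representation (T' C) y"
        by (rule representation_extend[OF rays_basis(1)[OF C] yT]) (use T' old in blast)
      have "representation (rays X R C) s s = 1"
        using representation_basis[OF rays_basis(1)[OF C] sR] by simp
      then have "\<beta> s \<noteq> 0" using b(2) sY YX by auto
      then have "root_hyperplane X \<beta> \<noteq> Y" using van sY by blast
      then have "\<beta> y \<noteq> 0" using y_off b(1) by blast
      moreover have "y \<in> X" using y(1) YX by blast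
      ultimately have "representation (T' C) y s \<noteq> 0" using b(2) unfolding eq[symmetric] by simp
      then show ?thesis using old(2) by (simp add: F_def)
    next
      case new
      obtain \<sigma> where "\<sigma> \<in> S" "\<forall>x\<in>Y. representation (rays Y S D) x s = \<sigma> x"
        using Y.rays_basis(5)[OF new(1), of s] s new(2) by (auto simp: F_def)
      then show ?thesis using yreg new(2) by (auto simp: F_def regular_iff)
    qed
  qed
  then show "m_fun X R x l + m_fun X R x' l = 2 * m_fun Y S y (restrict l Y)"
    unfolding split lhs rhs by simp
qed

end

lemma empty_root_system:
  assumes "spanning_root_system X {}"
  shows "X = {0}" and "l \<in> dual_space X \<Longrightarrow> l = (\<lambda>x\<in>{0}. 0)" and "m_fun {0} {} 0 l = 1"
proof -
  interpret spanning_root_system X "{}" by (rule assms)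
  show X0: "X = {0}" using separating subspace_0[OF X] by auto
  have reg: "regular {0::'a} {} = {0}" by (auto simp: regular_iff)
  have "chambers X {} = {{0}}"
    using chambers_eq[OF X, of "{}"] by (auto simp: X0 reg chamber_at_def)
  then have ch: "chambers {0} {} = {{0::'a}}" using X0 by simp
  have "chamber_of X {} 0 = {0}"
    using chamber_of_eq[OF X, of "{}" 0] by (auto simp: X0 reg chamber_at_def)
  then have co: "chamber_of {0} {} 0 = {0::'a}" using X0 by simp
  show "l \<in> dual_space X \<Longrightarrow> l = (\<lambda>x\<in>{0}. 0)" 
    unfolding X0 dual_space_iff using functional_on_zero[of "{0}" l]
    by (intro extensionalityI[of _ "{0}"]) (auto simp: subspace_single_0)
  show "m_fun {0} {} 0 l = 1"
    by (simp add: m_fun_def psi_def ch co chamber_sign_def separating_hyperplanes_def psi_chamber_def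
        simple_roots_def positive_roots_def)
qed

text \<open>
  Both families satisfy the same recursion, and the right-hand sides agree by induction on the dimension. Hence equality
  at one point of a chamber is equivalent to equality at any point of an adjacent chamber. Nothing relates the values
  of \<open>c\<close> at two points of one chamber directly, so the gallery argument transports the existence of a \<^emph>\<open>good\<close> point in the
  chamber, and a last step to an adjacent chamber and back reaches \<open>x\<close> itself.
\<close>
lemma stable_constants_eq_m_fun:
  fixes c :: "'v::euclidean_space set \<Rightarrow> ('v \<Rightarrow> real) set \<Rightarrow> 'v \<Rightarrow> ('v \<Rightarrow> real) \<Rightarrow> int"
  assumes c: "stable_discrete_series_constants c"
  shows "admissible X R \<Longrightarrow> x \<in> regular X R \<Longrightarrow> l \<in> dual_regular X R \<Longrightarrow> c X R x l = m_fun X R x l"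
proof (induction "dim X" arbitrary: X R x l rule: less_induct)
  case less
  note adm = less.prems(1)
  interpret spanning_root_system X R by unfold_locales (use adm in \<open>auto simp: admissible_def\<close>)
  have l: "l \<in> dual_space X" using less.prems(3) by (simp add: dual_regular_def)
  have lf: "functional_on X l" using l by (simp add: dual_space_iff)
  have vanish: "c X R p l = 0" if "p \<in> regular X R" "\<not> l p \<le> 0" for p
    using c that adm less.prems(3) unfolding stable_discrete_series_constants_def by blast
  have recursion: "c X R p l + c X R q l = 2 * c Y (hyperplane_system X R Y) y (restrict l Y)"
    if "p \<in> regular X R" "q \<in> regular X R"
      "separating_hyperplanes X R (chamber_of X R p) (chamber_of X R q) = {Y}" "y \<in> Y \<inter> closed_segment p q" for p q Y y
    using c that adm less.prems(3) unfolding stable_discrete_series_constants_def by blast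
  show ?case
  proof (cases "R = {}")
    case True
    then have e: "spanning_root_system X {}" using spanning_root_system_axioms by simp
    have "x = 0" using less.prems(2) empty_root_system(1)[OF e] by (simp add: regular_iff)
    then show ?thesis using empty_root_system[OF e] l c True by (simp add: stable_discrete_series_constants_def)
  next
    case False
    have cross: "c X R p l + c X R q l = m_fun X R p l + m_fun X R q l"
      if ad: "adjacent R g p q" and gp: "g p > 0" for g p q
    proof -
      have p: "p \<in> regular X R" and q: "q \<in> regular X R" and g: "g \<in> R" "g p * g q < 0"
        using ad by (auto simp: adjacent_def)
      have pqX: "p \<in> X" "q \<in> X" using p q by (auto simp: regular_iff)
      interpret a: admissible_root X R g
        by unfold_locales (use g adm in \<open>auto simp: admissible_def\<close>)
      have gq: "g q < 0" using g(2) gp by (auto simp: mult_less_0_iff)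
      have sep: "root_hyperplane X b = a.Y" if b: "b \<in> R" "b p * b q < 0" for b
      proof -
        have "proportional b g" using ad b by (auto simp: adjacent_def)
        then have "b = g \<or> b = (\<lambda>x\<in>X. - g x)" using proportional_roots[OF b(1) g(1)] by blast
        then show ?thesis using root_hyperplane_neg[OF g(1)] by (auto simp: a.Y_def)
      qed
      have seps: "separating_hyperplanes X R (chamber_of X R p) (chamber_of X R q) = {a.Y}"
        unfolding chamber_of_eq[OF X roots_dual p] chamber_of_eq[OF X roots_dual q]
          separating_hyperplanes_chamber_at[OF p q]
      proof (intro equalityI subsetI)
        fix H assume "H \<in> root_hyperplane X ` {b \<in> R. b p * b q < 0}"
        then obtain b where "b \<in> R" "b p * b q < 0" "H = root_hyperplane X b" by blast
        then show "H \<in> {a.Y}" using sep[of b] by simp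
      next
        fix H assume "H \<in> {a.Y}"
        then have "H = root_hyperplane X g" by (simp add: a.Y_def)
        then show "H \<in> root_hyperplane X ` {b \<in> R. b p * b q < 0}" using g by blast
      qed
      \<comment> \<open>the segment from p to q meets the hyperplane of g at parameter t\<close>
      define t where "t = g p / (g p - g q)"
      define y where "y = (1 - t) *\<^sub>R p + t *\<^sub>R q"
      have t: "0 \<le> t" "t \<le> 1" using gp gq by (auto simp: t_def divide_simps)
      have yseg: "y \<in> closed_segment p q" using t by (auto simp: y_def closed_segment_def)
      have "g y = (1 - t) * g p + t * g q"
        unfolding y_def using pqX X by (simp add: root_add[OF g(1)] root_scale[OF g(1)] subspace_scale)
      also have "\<dots> = 0" using gp gq by (simp add: t_def field_simps)
      finally have yY: "y \<in> a.Y"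
        unfolding a.Y_iff using pqX X by (simp add: y_def subspace_add subspace_scale)
      note m = a.m_fun_wall_crossing[OF p gp q gq sep yY yseg l]
      have "c a.Y a.S y (restrict l a.Y) = m_fun a.Y a.S y (restrict l a.Y)"
      proof (rule less.hyps[OF _ a.admissible_Y])
        show "dim a.Y < dim X" using a.dim_X by simp
        show "y \<in> regular a.Y a.S" by (rule m(2))
        have "a.Y \<subseteq> X" by (auto simp: a.Y_iff)
        then show "restrict l a.Y \<in> dual_regular a.Y a.S"
          using functional_on_restrict[OF a.subspace_Y] functional_on_subset[OF lf] less.prems(3) a.coroots_Y
          by (auto simp: dual_regular_def dual_space_iff)
      qed
      then show ?thesis using m(1) recursion[OF p q seps] yY yseg by (simp add: a.hyperplane_system_eq)
    qed
    have adjacent_commute: "adjacent R g q p" if "adjacent R g p q" for g p q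
      using that by (simp add: adjacent_def mult.commute)
    have cross': "c X R p l = m_fun X R p l \<longleftrightarrow> c X R q l = m_fun X R q l" if ad: "adjacent R g p q" for g p q
    proof -
      have "g p > 0 \<or> g q > 0" using ad by (auto simp: adjacent_def mult_less_0_iff)
      then show ?thesis using cross[OF ad] cross[OF adjacent_commute[OF ad]] by auto
    qed
    have adjacent_same: "adjacent R g p' q" if ad: "adjacent R g p q" and p': "p' \<in> regular X R" "same_side R p p'" for g p p' q
      unfolding adjacent_def
    proof (intro conjI ballI impI)
      show "p' \<in> regular X R" "q \<in> regular X R" "g \<in> R" using ad p' by (auto simp: adjacent_def)
      have s: "b p' * b p > 0" if "b \<in> R" for b using p'(2) that by (auto simp: same_side_def mult.commute)
      show "g p' * g q < 0" using ad s[of g] mult_pos_neg_trans by (auto simp: adjacent_def)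
      fix b assume b: "b \<in> R" "b p' * b q < 0"
      have "b p * b p' > 0" using s[OF b(1)] by (simp add: mult.commute)
      then have "b p * b q < 0" using b(2) by (rule mult_pos_neg_trans)
      then show "proportional b g" using ad b(1) by (auto simp: adjacent_def)
    qed
    define good where "good = (\<lambda>p. \<exists>p'. p' \<in> regular X R \<and> same_side R p p' \<and> c X R p' l = m_fun X R p' l)"
    have "\<exists>p\<in>X. \<forall>a\<in>insert l R. a p \<noteq> 0"
    proof (rule generic_point_exists[OF X])
      obtain \<alpha> where "\<alpha> \<in> R" using False by blast
      then have "cr \<alpha> \<in> X" "l (cr \<alpha>) \<noteq> 0"
        using coroot(1) less.prems(3) by (auto simp: dual_regular_def coroots_def)
      then show "\<exists>x\<in>X. a x \<noteq> 0" if "a \<in> insert l R" for a using that root_nonzero by auto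
    qed (use finite_roots root_functional lf in auto)
    then obtain p0 where p0: "p0 \<in> regular X R" "l p0 \<noteq> 0" by (auto simp: regular_iff)
    define p where "p = (if l p0 > 0 then p0 else - p0)"
    have p: "p \<in> regular X R" "l p > 0"
      using p0 regular_uminus[OF p0(1)] functional_on_uminus[OF lf, of p0] by (auto simp: p_def regular_iff)
    have "good p" unfolding good_def
      using p vanish[OF p(1)] m_fun_eq_0[OF p(1) l p(2)] same_side_refl[OF p(1)] by (intro exI[of _ p]) auto
    have "good x"
    proof (rule root_gallery_induct[where Pr = good, OF reflection_closed_roots p(1) less.prems(2) \<open>good p\<close>])
      fix u v assume v: "v \<in> regular X R" and uv: "same_side R u v" and "good u"
      have "same_side R v u" using uv by (simp add: same_side_def mult.commute)
      then show "good v" using \<open>good u\<close> same_side_trans unfolding good_def by blast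
    next
      fix g u v assume ad: "adjacent R g u v" and "good u"
      then obtain u' where u': "u' \<in> regular X R" "same_side R u u'" "c X R u' l = m_fun X R u' l"
        by (auto simp: good_def)
      have "c X R v l = m_fun X R v l" using cross'[OF adjacent_same[OF ad u'(1,2)]] u'(3) by simp
      moreover have "v \<in> regular X R" using ad by (simp add: adjacent_def)
      ultimately show "good v" using same_side_refl unfolding good_def by blast
    qed
    then obtain x' where x': "x' \<in> regular X R" "same_side R x x'" "c X R x' l = m_fun X R x' l"
      by (auto simp: good_def)
    have xX: "x \<in> X" using less.prems(2) by (simp add: regular_iff)
    obtain cs where cs: "set cs \<subseteq> {g. wall R x g}" "same_side R (word cs x) (- x)"
      using chambers_transitive[OF reflection_closed_roots less.prems(2) regular_uminus[OF less.prems(2)]] by blast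
    \<comment> \<open>a word that leads from x to - x is not empty, so the chamber of x has a wall g\<close>
    have "cs \<noteq> []"
    proof
      assume "cs = []"
      then have "same_side R x (- x)" using cs(2) by simp
      moreover obtain \<alpha> where a: "\<alpha> \<in> R" using False by blast
      ultimately have "\<alpha> x * \<alpha> (- x) > 0" by (auto simp: same_side_def)
      then show False using root_uminus[OF a xX] by (simp add: not_less)
    qed
    then obtain g where w: "wall R x g" using cs(1) by (cases cs) auto
    have g: "g \<in> R" using w by (simp add: wall_def)
    have gx: "g x \<noteq> 0" using less.prems(2) g by (simp add: regular_iff)
    have "adjacent R g x (refl g x)" unfolding adjacent_def
    proof (intro conjI)
      show "x \<in> regular X R" by (rule less.prems(2))
      show "refl g x \<in> regular X R" using regular_word[OF reflection_closed_roots, of "[g]" x] g less.prems(2) by simp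
      show "g \<in> R" by (rule g)
      have "g (refl g x) = - g x"
        using functional_refl[OF root_functional[OF g] g xX] coroot(2)[OF g] by simp
      moreover have "g x * g x > 0" using gx by (simp flip: power2_eq_square)
      ultimately show "g x * g (refl g x) < 0" by simp
      show "\<forall>b\<in>R. b x * b (refl g x) < 0 \<longrightarrow> proportional b g" using w by (simp add: wall_def)
    qed
    then show ?thesis using cross' adjacent_same[OF _ x'(1,2)] x'(3) by blast
  qed
qed

theorem theorem3p1:
  fixes c :: "'v::euclidean_space set \<Rightarrow> ('v \<Rightarrow> real) set \<Rightarrow> 'v \<Rightarrow> ('v \<Rightarrow> real) \<Rightarrow> int"
    and X :: "'v set" and R :: "('v \<Rightarrow> real) set"
  assumes "stable_discrete_series_constants c"
    and "root_system X R"
    and "spans_dual X R"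
    and "(\<lambda>x\<in>X. - x) \<in> weyl_group X R"
  shows "\<forall>x\<in>regular X R. \<forall>l\<in>dual_regular X R. c X R x l = m_fun X R x l"
  using stable_constants_eq_m_fun[OF assms(1)] assms(2-4) by (simp add: admissible_def)

end
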